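(* Let $a>0$, let $q\in L^2(0,a)$ be complex-valued, and let $\alpha_0\ge0$, $\alpha>0$, $\beta_0,\beta\in\mathbb{C}$. If $\alpha_0\ne1$ and $\alpha_0$ is known a priori (respectively, if $\alpha\ne1$ and $\alpha$ is known a priori), then all zeros of $\Delta_+(\lambda)$ and all non-zero zeros of $\Delta_-(\lambda)$ (including multiplicity) uniquely determine $\alpha$ (respectively $\alpha_0$), $\beta_0$, $\beta$ and $q(x)$ a.e. on $(0,a)$.
   Context: Let $y(\lambda,x)$ be the solution of $-y''+q(x)y=\lambda^2y$ on $(0,a)$ with $y(\lambda,0)=1$, $y'(\lambda,0)=i\alpha_0\lambda+\beta_0$ (prime is $d/dx$, $\lambda\in\mathbb{C}$). Put $$\Delta_\pm(\lambda)=y'(\lambda,a)+(\pm i\alpha\lambda+\beta)y(\lambda,a).$$ These are entire functions, the characteristic functions of the boundary value problems $-y''+qy=\lambda^2y$, $y'(0)-(i\alpha_0\lambda+\beta_0)y(0)=0$, $y'(a)+(\pm i\alpha\lambda+\beta)y(a)=0$. "Uniquely determine" means: if two such collections $(q,\alpha_0,\beta_0,\alpha,\beta)$ and $(\tilde q,\tilde\alpha_0,\tilde\beta_0,\tilde\alpha,\tilde\beta)$ (same $a$) both satisfy the hypotheses, share the a priori known parameter, and have the same spectral data as listed, then the listed unknowns coincide. *)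

theory Defs
  imports "HOL-Complex_Analysis.Complex_Analysis"
begin

definition L2_on :: "real set \<Rightarrow> (real \<Rightarrow> complex) \<Rightarrow> bool" where
  "L2_on S f \<longleftrightarrow> f \<in> borel_measurable (lebesgue_on S) \<and>
     integrable (lebesgue_on S) (\<lambda>x. (cmod (f x))\<^sup>2)"

text \<open>The derivative relative to the closed interval, hence one-sided at the endpoints.\<close>

definition dx :: "real \<Rightarrow> (real \<Rightarrow> complex) \<Rightarrow> real \<Rightarrow> complex" where
  "dx a y x = vector_derivative y (at x within {0..a})"

text \<open>
  Solutions of \<open>- y'' + q y = \<rho>\<^sup>2 y\<close> for \<open>q \<in> L\<^sup>2(0,a)\<close> are understood in the usual
  (Caratheodory) sense: \<open>y\<close> is differentiable on \<open>[0,a]\<close>, \<open>y'\<close> is absolutely continuous,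
  i.e. the indefinite Lebesgue integral of a summable function \<open>y''\<close>, and the equation
  holds almost everywhere.
\<close>

definition sl_solution ::
  "real \<Rightarrow> (real \<Rightarrow> complex) \<Rightarrow> complex \<Rightarrow> (real \<Rightarrow> complex) \<Rightarrow> bool" where
  "sl_solution a q \<rho> y \<longleftrightarrow>
     (\<forall>x\<in>{0..a}. y differentiable (at x within {0..a})) \<and>
     (\<exists>y2. y2 absolutely_integrable_on {0..a} \<and>
        (\<forall>x\<in>{0..a}. dx a y x = dx a y 0 + integral {0..x} y2) \<and>
        (AE x in lebesgue. x \<in> {0<..<a} \<longrightarrow> - y2 x + q x * y x = \<rho>\<^sup>2 * y x))"

text \<open>
  \<open>y \<rho> x\<close> is the solution of the initial value problem for every spectral parameter \<open>\<rho>\<close>;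
  this determines \<open>y \<rho> x\<close> for all \<open>\<rho>\<close> and all \<open>x \<in> [0,a]\<close>.
\<close>

definition solves_ivp ::
  "real \<Rightarrow> (real \<Rightarrow> complex) \<Rightarrow> real \<Rightarrow> complex \<Rightarrow> (complex \<Rightarrow> real \<Rightarrow> complex) \<Rightarrow> bool" where
  "solves_ivp a q \<alpha>\<^sub>0 \<beta>\<^sub>0 y \<longleftrightarrow>
     (\<forall>\<rho>. sl_solution a q \<rho> (y \<rho>) \<and> y \<rho> 0 = 1 \<and>
          dx a (y \<rho>) 0 = \<i> * of_real \<alpha>\<^sub>0 * \<rho> + \<beta>\<^sub>0)"

definition Delta_plus ::
  "real \<Rightarrow> real \<Rightarrow> complex \<Rightarrow> (complex \<Rightarrow> real \<Rightarrow> complex) \<Rightarrow> complex \<Rightarrow> complex" where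
  "Delta_plus a \<alpha> \<beta> y \<rho> = dx a (y \<rho>) a + (\<i> * of_real \<alpha> * \<rho> + \<beta>) * y \<rho> a"

definition Delta_minus ::
  "real \<Rightarrow> real \<Rightarrow> complex \<Rightarrow> (complex \<Rightarrow> real \<Rightarrow> complex) \<Rightarrow> complex \<Rightarrow> complex" where
  "Delta_minus a \<alpha> \<beta> y \<rho> = dx a (y \<rho>) a + (- (\<i> * of_real \<alpha> * \<rho>) + \<beta>) * y \<rho> a"

text \<open>
  Equality of the zeros in \<open>S\<close> of two entire functions, counted with multiplicity. At a zero
  of an entire function that is not identically zero, \<^const>\<open>zorder\<close> is its multiplicity;
  if \<open>\<alpha>\<^sub>0 \<noteq> 1\<close> or \<open>\<alpha> \<noteq> 1\<close>, neither characteristic function vanishes identically.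
\<close>

definition same_zeros_on ::
  "complex set \<Rightarrow> (complex \<Rightarrow> complex) \<Rightarrow> (complex \<Rightarrow> complex) \<Rightarrow> bool" where
  "same_zeros_on S f g \<longleftrightarrow>
     (\<forall>z\<in>S. (f z = 0 \<longleftrightarrow> g z = 0) \<and> (f z = 0 \<longrightarrow> zorder f z = zorder g z))"

end

theory Submission
  imports Defs "HOL-Real_Asymp.Real_Asymp"
begin

text \<open>
  By a Hadamard-type argument the quotient of two functions of exponential type with the same zeros
  is \<open>exp (b + d \<lambda>)\<close> up to a power of \<open>\<lambda>\<close>. The asymptotics of \<open>\<Delta>\<^sub>+\<close> and \<open>\<Delta>\<^sub>-\<close> on a half of the
  imaginary axis where the leading coefficient does not vanish (this is where \<open>\<alpha>\<^sub>0 \<noteq> 1\<close> or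
  \<open>\<alpha> \<noteq> 1\<close> enters) force \<open>d = 0\<close> and give the same constant for both functions. So
  \<open>\<alpha> y(\<lambda>,a)\<close> and \<open>y'(\<lambda>,a) + \<beta> y(\<lambda>,a)\<close> are known up to that constant. Their even parts in
  \<open>\<lambda>\<close> come from the solution \<open>\<phi>\<close> with \<open>\<phi>(0) = 1\<close>, \<open>\<phi>'(0) = \<beta>\<^sub>0\<close>; comparing leading terms
  shows that the constant is 1, which fixes the remaining one of \<open>\<alpha>\<close>, \<open>\<alpha>\<^sub>0\<close>. The
  potential, \<open>\<beta>\<close> and \<open>\<beta>\<^sub>0\<close> then follow from a Borg-Marchenko argument at the endpoint \<open>a\<close>:
  a cross product of the fundamental systems of the two problems is entire in \<open>\<lambda>\<close>, of exponential type
  and decays off the real axis, hence vanishes by Phragmen-Lindeloef and Liouville.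
\<close>

subsection \<open>Functions of exponential type\<close>

text \<open>At \<open>\<lambda> = \<i> * s * \<tau>\<close> with \<open>s\<close> equal to 1 or -1
  and \<tau> tending to infinity, a characteristic function with boundary coefficient \<delta>
  behaves like \<open>(1 - s * \<alpha>\<^sub>0) * (1 - s * \<delta>) / 2\<close> times
  \<open>\<tau> * exp (\<tau> * a)\<close>. For \<open>\<delta> = \<alpha>\<close> the choice
  \<open>s = -1\<close> is always safe. For \<open>\<delta> = - \<alpha>\<close> each half-axis has
  one factor that may vanish, \<open>1 - \<alpha>\<^sub>0\<close> or \<open>1 - \<alpha>\<close>;
  the half-axis is chosen so that this factor belongs to the known parameter. It then cancels
  between the two problems, which is why both functions receive the same constant. One ray is
  enough: a function \<open>exp (d * \<lambda>)\<close> times a power of \<lambda> with a finite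
  nonzero limit there has \<open>d = 0\<close> and power 0. This also settles the order of the zero
  at the origin, which is not among the data for the second function. Even parts are used because
  \<phi> does not involve \<open>\<alpha>\<^sub>0\<close>, which need not agree at that stage. Near
  the real axis \<open>\<phi>(a)\<close> admits no lower bound, so the decay of the cross product is
  known only off that axis; this gap is what Phragmen-Lindeloef closes.\<close>

definition exp_type :: "(complex \<Rightarrow> complex) \<Rightarrow> bool" where
  "exp_type f \<longleftrightarrow> (\<exists>C B. \<forall>z. cmod (f z) \<le> exp (C + B * cmod z))"

text \<open>The multiplicative constant sits inside the exponent, so products merely add constants.
  With both constants nonnegative, later estimates may enlarge either one freely.\<close>

lemma exp_typeE:
  assumes "exp_type f"
  obtains C B where "C \<ge> 0" "B \<ge> 0" "\<And>z. cmod (f z) \<le> exp (C + B * cmod z)"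
proof -
  obtain C B where *: "\<And>z. cmod (f z) \<le> exp (C + B * cmod z)"
    using assms unfolding exp_type_def by auto
  have "cmod (f z) \<le> exp (\<bar>C\<bar> + \<bar>B\<bar> * cmod z)" for z
    by (rule order_trans[OF *]) (simp add: add_mono mult_right_mono)
  then show ?thesis using that[of "\<bar>C\<bar>" "\<bar>B\<bar>"] by auto
qed

lemma exp_typeI:
  assumes "\<And>z. cmod (f z) \<le> exp (C + B * cmod z)"
  shows "exp_type f"
  using assms unfolding exp_type_def by blast

lemma exp_type_mult:
  assumes "exp_type f" "exp_type g"
  shows "exp_type (\<lambda>z. f z * g z)"
proof -
  obtain C B where f: "\<And>z. cmod (f z) \<le> exp (C + B * cmod z)" using assms exp_typeE by metis
  obtain C' B' where g: "\<And>z. cmod (g z) \<le> exp (C' + B' * cmod z)" using assms exp_typeE by metis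
  have "cmod (f z * g z) \<le> exp ((C + C') + (B + B') * cmod z)" for z
  proof -
    have "cmod (f z * g z) \<le> exp (C + B * cmod z) * exp (C' + B' * cmod z)"
      unfolding norm_mult by (intro mult_mono f g) auto
    then show ?thesis by (simp add: exp_add[symmetric] algebra_simps)
  qed
  then show ?thesis by (rule exp_typeI)
qed

lemma exp_type_add:
  assumes "exp_type f" "exp_type g"
  shows "exp_type (\<lambda>z. f z + g z)"
proof -
  obtain C B where f: "\<And>z. cmod (f z) \<le> exp (C + B * cmod z)" and "C \<ge> 0" "B \<ge> 0"
    using assms exp_typeE by metis
  obtain C' B' where g: "\<And>z. cmod (g z) \<le> exp (C' + B' * cmod z)" and "C' \<ge> 0" "B' \<ge> 0"
    using assms exp_typeE by metis
  have "cmod (f z + g z) \<le> exp ((C + C' + 1) + (B + B') * cmod z)" for z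
  proof -
    define X where "X = exp (C + C' + (B + B') * cmod z)"
    have "exp (C + B * cmod z) \<le> X" "exp (C' + B' * cmod z) \<le> X"
      unfolding X_def using \<open>C \<ge> 0\<close> \<open>B \<ge> 0\<close> \<open>C' \<ge> 0\<close> \<open>B' \<ge> 0\<close>
      by (simp_all add: distrib_right)
    then have "cmod (f z + g z) \<le> 2 * X"
      using norm_triangle_ineq[of "f z" "g z"] f[of z] g[of z] by linarith
    also have "\<dots> \<le> exp 1 * X"
      using exp_ge_add_one_self[of 1] by (intro mult_right_mono) (auto simp: X_def)
    also have "\<dots> = exp ((C + C' + 1) + (B + B') * cmod z)"
      by (simp add: X_def exp_add[symmetric] algebra_simps)
    finally show ?thesis .
  qed
  then show ?thesis by (rule exp_typeI)
qed

lemma exp_type_const [intro]: "exp_type (\<lambda>z. c)"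
proof (rule exp_typeI[where B=0])
  fix z :: complex
  show "cmod c \<le> exp (cmod c + 0 * cmod z)"
    using exp_ge_add_one_self[of "cmod c"] unfolding mult_zero_left add_0_right by linarith
qed

lemma exp_type_id [intro]: "exp_type (\<lambda>z. z)"
proof (rule exp_typeI[where B=1 and C=0])
  fix z :: complex
  show "cmod z \<le> exp (0 + 1 * cmod z)"
    using exp_ge_add_one_self[of "cmod z"] unfolding mult_1 add_0 by linarith
qed

lemma exp_type_minus: "exp_type f \<Longrightarrow> exp_type (\<lambda>z. - f z)"
  unfolding exp_type_def by simp

lemma exp_type_diff: "exp_type f \<Longrightarrow> exp_type g \<Longrightarrow> exp_type (\<lambda>z. f z - g z)"
  using exp_type_add[OF _ exp_type_minus, of f g] by simp

lemmas exp_type_intros = exp_type_mult exp_type_add exp_type_minus exp_type_diff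
  exp_type_const exp_type_id

lemma exp_type_outside_ball:
  assumes "continuous_on UNIV f"
    and out: "\<And>z. cmod z \<ge> R \<Longrightarrow> cmod (f z) \<le> exp (C + B * cmod z)"
  shows "exp_type f"
proof -
  have "compact (f ` cball 0 R)"
    by (intro compact_continuous_image continuous_on_subset[OF assms(1)]) auto
  then obtain M where M: "\<And>z. z \<in> cball 0 R \<Longrightarrow> cmod (f z) \<le> M" 
    using compact_imp_bounded bounded_iff by (metis image_eqI)
  have "cmod (f z) \<le> exp ((\<bar>C\<bar> + \<bar>M\<bar>) + \<bar>B\<bar> * cmod z)" for z
  proof (cases "cmod z \<ge> R")
    case True
    have "C + B * cmod z \<le> (\<bar>C\<bar> + \<bar>M\<bar>) + \<bar>B\<bar> * cmod z"
      by (intro add_mono mult_right_mono) auto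
    then show ?thesis using out[OF True] by (meson exp_le_cancel_iff order_trans)
  next
    case False
    then have "cmod (f z) \<le> \<bar>M\<bar>" using M[of z] by auto
    also have "\<dots> \<le> exp \<bar>M\<bar>" using exp_ge_add_one_self[of "\<bar>M\<bar>"] by linarith
    also have "\<dots> \<le> exp ((\<bar>C\<bar> + \<bar>M\<bar>) + \<bar>B\<bar> * cmod z)" by simp
    finally show ?thesis .
  qed
  then show ?thesis by (rule exp_typeI)
qed

section \<open>Removing zeros, the Borel-Caratheodory bound and zero-free quotients\<close>

lemma entire_factor_at:
  fixes f :: "complex \<Rightarrow> complex"
  assumes f: "f holomorphic_on UNIV" and nz: "f z0 \<noteq> 0"
  obtains n g where "g holomorphic_on UNIV" "g w \<noteq> 0" "\<And>z. f z = (z - w) ^ n * g z"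
proof (cases "f w = 0")
  case False
  then show ?thesis using that[of f 0] f by auto
next
  case True
  then have "\<not> f constant_on UNIV" using nz unfolding constant_on_def by (metis UNIV_I)
  then obtain g r n where "0 < n" "0 < r" and g: "g holomorphic_on ball w r"
    and fg: "\<And>z. z \<in> ball w r \<Longrightarrow> f z = (z - w) ^ n * g z"
    and gnz: "\<And>z. z \<in> ball w r \<Longrightarrow> g z \<noteq> 0"
    using holomorphic_factor_zero_nonconstant[OF f open_UNIV connected_UNIV UNIV_I True] by metis
  \<comment> \<open>The local cofactor exists only on a disc. Off \<open>w\<close> it must be the
    quotient, so the two holomorphic functions glue along the open cover by \<open>ball w r\<close>
    and \<open>- {w}\<close>.\<close>
  define G where "G z = (if z = w then g w else f z / (z - w) ^ n)" for z
  have 1: "G holomorphic_on ball w r"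
    by (rule holomorphic_transform[OF g]) (auto simp: G_def fg)
  have 2: "G holomorphic_on - {w}"
  proof (rule holomorphic_transform[of "\<lambda>z. f z / (z - w) ^ n"])
    show "(\<lambda>z. f z / (z - w) ^ n) holomorphic_on - {w}"
      by (intro holomorphic_intros holomorphic_on_subset[OF f]) auto
  qed (auto simp: G_def)
  have "G holomorphic_on ball w r \<union> - {w}"
    using 1 2 by (rule holomorphic_on_Un) auto
  moreover have "ball w r \<union> - {w} = UNIV" using \<open>0 < r\<close> by auto
  ultimately have "G holomorphic_on UNIV" by simp
  moreover have "G w \<noteq> 0" using gnz \<open>0 < r\<close> by (simp add: G_def)
  moreover have "f z = (z - w) ^ n * G z" for z
    using True \<open>0 < n\<close> by (simp add: G_def)
  ultimately show ?thesis using that by blast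
qed

text \<open>Each zero \<open>w\<close> in the disc is moved to its mirror image: on the circle
  \<open>\<bar>z - w\<bar> = \<bar>R\<^sup>2 - cnj w * z\<bar> / R\<close>.\<close>

lemma remove_zeros_in_ball:
  fixes g :: "complex \<Rightarrow> complex"
  assumes "g holomorphic_on UNIV" "g 0 \<noteq> 0" "R > 0"
  shows "\<exists>h. h holomorphic_on UNIV \<and> (\<forall>z\<in>ball 0 R. h z \<noteq> 0) \<and>
    (\<forall>z\<in>sphere 0 R. cmod (h z) = cmod (g z)) \<and> cmod (h 0) \<ge> cmod (g 0)"
  using assms
\<comment> \<open>Zeros are counted without multiplicity: each step strips a zero with its whole
  order, and the replacement factor has no zero in the disc.\<close>
proof (induction "card {z\<in>ball 0 R. g z = 0}" arbitrary: g rule: less_induct)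
  case less
  define Z where "Z = {z\<in>ball 0 R. g z = 0}"
  show ?case
  proof (cases "Z = {}")
    case True
    then show ?thesis using less.prems unfolding Z_def by (intro exI[of _ g]) auto
  next
    case False
    then obtain w where w: "w \<in> ball 0 R" "g w = 0" unfolding Z_def by auto
    have "\<not> g constant_on UNIV" using w(2) less.prems(2) unfolding constant_on_def by (metis UNIV_I)
    then have "finite {z\<in>cball 0 R. g z = 0}"
      using holomorphic_compact_finite_zeros[OF less.prems(1) open_UNIV connected_UNIV compact_cball] by blast
    then have fin: "finite Z" by (rule rev_finite_subset) (auto simp: Z_def)
    obtain n h where h: "h holomorphic_on UNIV" "h w \<noteq> 0" and gh: "\<And>z. g z = (z - w) ^ n * h z"
      using entire_factor_at[OF less.prems(1,2)] by metis
    define k where "k z = ((R\<^sup>2 - cnj w * z) / R) ^ n * h z" for z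
    have k: "k holomorphic_on UNIV"
      unfolding k_def using \<open>R > 0\<close> by (intro holomorphic_intros h) auto
    have nz: "R\<^sup>2 - cnj w * z \<noteq> 0" if "z \<in> ball 0 R" for z
    proof
      assume "R\<^sup>2 - cnj w * z = 0"
      then have "cmod (cnj w * z) = R\<^sup>2"
        by (metis eq_iff_diff_eq_0 norm_of_real abs_power2 of_real_power)
      moreover have "cmod (cnj w * z) < R * R"
        unfolding norm_mult complex_mod_cnj using that w(1) by (intro mult_strict_mono') auto
      ultimately show False by (simp add: power2_eq_square)
    qed
    have sub: "{z\<in>ball 0 R. k z = 0} \<subseteq> Z - {w}"
      using nz h(2) \<open>R > 0\<close> by (auto simp: k_def Z_def gh)
    have "w \<in> Z" using w by (simp add: Z_def)
    then have "card {z\<in>ball 0 R. k z = 0} < card Z"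
      using sub fin by (intro psubset_card_mono) auto
    moreover have w0: "w \<noteq> 0" using w(2) less.prems(2) by auto
    \<comment> \<open>At the centre each factor of modulus \<open>cmod w\<close> becomes
      \<open>R\<close>, so the value there can only grow. This is the Jensen-type inequality that
      later bounds a logarithm from below.\<close>
    have k0: "cmod (k 0) \<ge> cmod (g 0)"
    proof -
      have "cmod w ^ n \<le> R ^ n" using w(1) by (intro power_mono) auto
      then have "cmod w ^ n * cmod (h 0) \<le> R ^ n * cmod (h 0)" by (intro mult_right_mono) auto
      moreover have "cmod (k 0) = R ^ n * cmod (h 0)"
        using \<open>R > 0\<close> by (simp add: k_def norm_mult norm_power norm_divide power2_eq_square)
      ultimately show ?thesis by (simp add: gh norm_mult norm_power)
    qed
    moreover have "k 0 \<noteq> 0" using k0 less.prems(2) by auto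
    ultimately obtain h' where h': "h' holomorphic_on UNIV" "\<forall>z\<in>ball 0 R. h' z \<noteq> 0"
      "\<forall>z\<in>sphere 0 R. cmod (h' z) = cmod (k z)" "cmod (h' 0) \<ge> cmod (k 0)"
      using less.hyps[of k] k \<open>R > 0\<close> unfolding Z_def by metis
    have "cmod (k z) = cmod (g z)" if "z \<in> sphere 0 R" for z
    proof -
      have zR: "cmod z = R" using that by simp
      then have "complex_of_real (R\<^sup>2) = z * cnj z" 
        using complex_norm_square[of z] by simp
      then have "cmod (R\<^sup>2 - cnj w * z) = cmod (z * cnj (z - w))"
        by (simp add: algebra_simps)
      also have "\<dots> = R * cmod (z - w)" by (simp only: norm_mult complex_mod_cnj zR)
      finally show ?thesis
        using \<open>R > 0\<close> by (simp add: k_def gh norm_mult norm_power norm_divide)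
    qed
    then show ?thesis using h' k0 by (intro exI[of _ h']) auto
  qed
qed

text \<open>A Moebius map sends the half-plane \<open>Re < B\<close> to the unit disc and fixes 0,
  so the Schwarz lemma applies. At half the radius it yields
  \<open>cmod g \<le> (2 * B + cmod g) / 2\<close>, which is solved for
  \<open>cmod g\<close>.\<close>

lemma borel_caratheodory_half:
  fixes f :: "complex \<Rightarrow> complex"
  assumes f: "f holomorphic_on ball 0 R" and R: "R > 0"
    and bd: "\<And>z. z \<in> ball 0 R \<Longrightarrow> Re (f z - f 0) < B" and z: "cmod z \<le> R / 2"
  shows "cmod (f z - f 0) \<le> 2 * B"
proof -
  have B: "B > 0" using bd[of 0] R by simp
  define g where "g \<zeta> = f (of_real R * \<zeta>) - f 0" for \<zeta> :: complex
  define h where "h \<zeta> = g \<zeta> / (2 * B - g \<zeta>)" for \<zeta>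
  have in_ball: "of_real R * \<zeta> \<in> ball 0 R" if "\<zeta> \<in> ball 0 1" for \<zeta> :: complex
    using that R by (simp add: norm_mult)
  have gB: "Re (g \<zeta>) < B" if "\<zeta> \<in> ball 0 1" for \<zeta>
    unfolding g_def using bd[OF in_ball[OF that]] .
  have nz: "2 * B - g \<zeta> \<noteq> 0" if "\<zeta> \<in> ball 0 1" for \<zeta>
  proof
    assume "2 * B - g \<zeta> = 0"
    then have "Re (g \<zeta>) = 2 * B" by (simp add: complex_eq_iff)
    then show False using gB[OF that] B by simp
  qed
  have "(\<lambda>\<zeta>. f (of_real R * \<zeta>)) holomorphic_on ball 0 1"
    using holomorphic_on_compose_gen[of "\<lambda>\<zeta>. of_real R * \<zeta>" "ball 0 1" f "ball 0 R"] f in_ball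
    by (force simp: o_def intro!: holomorphic_intros)
  then have "g holomorphic_on ball 0 1" unfolding g_def by (intro holomorphic_intros)
  then have hol: "h holomorphic_on ball 0 1"
    unfolding h_def using nz by (intro holomorphic_intros) auto
  have h1: "cmod (h \<zeta>) < 1" if "cmod \<zeta> < 1" for \<zeta>
  proof -
    have "\<zeta> \<in> ball 0 1" using that by simp
    note n = nz[OF this] and b = gB[OF this]
    have "(cmod (g \<zeta>))\<^sup>2 < (cmod (2 * B - g \<zeta>))\<^sup>2"
    proof -
      have "(2 * B - Re (g \<zeta>))\<^sup>2 - (Re (g \<zeta>))\<^sup>2 = 4 * B * (B - Re (g \<zeta>))"
        by (simp add: power2_eq_square algebra_simps)
      moreover have "4 * B * (B - Re (g \<zeta>)) > 0" using b B by simp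
      ultimately show ?thesis by (simp add: cmod_power2)
    qed
    then have "cmod (g \<zeta>) < cmod (2 * B - g \<zeta>)" by (rule power_less_imp_less_base) simp
    then show ?thesis using n by (simp add: h_def norm_divide)
  qed
  define \<zeta> where "\<zeta> = z / R"
  have \<zeta>: "cmod \<zeta> \<le> 1 / 2" using z R by (simp add: \<zeta>_def norm_divide field_simps)
  then have b1: "\<zeta> \<in> ball 0 1" by simp
  have "h 0 = 0" by (simp add: h_def g_def)
  then have "cmod (h \<zeta>) \<le> cmod \<zeta>"
    using Schwarz_Lemma(1)[OF hol _ h1] \<zeta> by auto
  then have "cmod (g \<zeta>) \<le> cmod \<zeta> * cmod (2 * B - g \<zeta>)"
    using nz[OF b1] by (simp add: h_def norm_divide field_simps)
  also have "\<dots> \<le> (1/2) * cmod (2 * B - g \<zeta>)" using \<zeta> by (intro mult_right_mono) auto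
  also have "\<dots> \<le> (1/2) * (2 * B + cmod (g \<zeta>))"
    using norm_triangle_ineq4[of "2 * complex_of_real B" "g \<zeta>"] B by simp
  finally have "cmod (g \<zeta>) \<le> 2 * B" by simp
  then show ?thesis using R by (simp add: g_def \<zeta>_def)
qed

text \<open>The logarithm of \<open>Q\<close> must be shown to grow linearly, but dividing by
  \<open>g\<close> gives nothing near the zeros of \<open>g\<close>. In each disc \<open>g\<close>
  is replaced by a zero-free \<open>k\<close> of equal modulus on the circle: the maximum principle
  bounds \<open>k\<close> and \<open>Q * k\<close>, and Borel-Caratheodory turns the upper bound for
  \<open>k\<close> into a lower one.\<close>

lemma zero_free_quotient_is_exp_linear:
  fixes f g Q :: "complex \<Rightarrow> complex"
  assumes Q: "Q holomorphic_on UNIV" "\<And>z. Q z \<noteq> 0" and g: "g holomorphic_on UNIV" "g 0 \<noteq> 0"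
    and fQ: "\<And>z. f z = Q z * g z" and "exp_type f" "exp_type g"
  obtains b d where "\<And>z. Q z = exp (b + d * z)"
proof -
  obtain C1 B1 where f1: "C1 \<ge> 0" "B1 \<ge> 0" "\<And>z. cmod (f z) \<le> exp (C1 + B1 * cmod z)"
    using exp_typeE[OF \<open>exp_type f\<close>] by metis
  obtain C2 B2 where g1: "C2 \<ge> 0" "B2 \<ge> 0" "\<And>z. cmod (g z) \<le> exp (C2 + B2 * cmod z)"
    using exp_typeE[OF \<open>exp_type g\<close>] by metis
  define C where "C = C1 + C2"
  define B where "B = B1 + B2"
  define L where "L = ln (cmod (g 0))"
  \<comment> \<open>The extra 1 makes \<open>Re (l w - l 0) < K R\<close> strict, as the
    Borel-Caratheodory bound demands.\<close>
  define K where "K R = C + B * R - L + 1" for R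
  have CB: "C \<ge> 0" "B \<ge> 0" using f1 g1 by (auto simp: C_def B_def)
  obtain h where h: "h holomorphic_on UNIV" "\<And>z. Q z = exp (h z)"
    using contractible_imp_holomorphic_log[OF Q(1) contractible_UNIV] Q(2) by auto
  \<comment> \<open>Obtained from \<open>Re (h z) + Re (l z) \<le> C + B * R\<close> and
    \<open>Re (l z) \<ge> L - 2 * K R\<close>.\<close>
  have Reh: "Re (h z) \<le> 3 * K R" if R: "R > 0" and z: "cmod z \<le> R / 2" for R z
  proof -
    obtain k where k: "k holomorphic_on UNIV" "\<forall>z\<in>ball 0 R. k z \<noteq> 0"
      "\<forall>z\<in>sphere 0 R. cmod (k z) = cmod (g z)" "cmod (k 0) \<ge> cmod (g 0)"
      using remove_zeros_in_ball[OF g R] by auto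
    have bk: "cmod (k w) \<le> exp (C + B * R)" and bQ: "cmod (Q w * k w) \<le> exp (C + B * R)"
      if w: "w \<in> ball 0 R" for w
    proof -
      have le1: "C2 + B2 * R \<le> C + B * R" and le2: "C1 + B1 * R \<le> C + B * R"
        using f1 g1 R by (auto simp: C_def B_def distrib_right)
      have "cmod (k w) \<le> exp (C + B * R)"
      proof (rule maximum_modulus_frontier[of k "ball 0 R"])
        fix v :: complex assume "v \<in> frontier (ball 0 R)"
        then have "v \<in> sphere 0 R" using R by auto
        then show "cmod (k v) \<le> exp (C + B * R)"
          using k(3) g1(3)[of v] le1 by (auto intro: order_trans)
      qed (use w k(1) in \<open>auto intro: holomorphic_on_subset holomorphic_on_imp_continuous_on continuous_on_subset\<close>)
      moreover have "cmod (Q w * k w) \<le> exp (C + B * R)"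
      proof (rule maximum_modulus_frontier[of "\<lambda>w. Q w * k w" "ball 0 R"])
        fix v :: complex assume "v \<in> frontier (ball 0 R)"
        then have v: "v \<in> sphere 0 R" using R by auto
        then have "cmod (Q v * k v) = cmod (f v)" using k(3) by (simp add: norm_mult fQ)
        then show "cmod (Q v * k v) \<le> exp (C + B * R)"
          using f1(3)[of v] le2 v by (auto intro: order_trans)
      next
        have "(\<lambda>w. Q w * k w) holomorphic_on UNIV" using Q(1) k(1) by (intro holomorphic_intros)
        then show "(\<lambda>w. Q w * k w) holomorphic_on interior (ball 0 R)"
            "continuous_on (closure (ball 0 R)) (\<lambda>w. Q w * k w)"
          by (auto intro: holomorphic_on_subset holomorphic_on_imp_continuous_on continuous_on_subset)
      qed (use w in auto)
      ultimately show "cmod (k w) \<le> exp (C + B * R)" "cmod (Q w * k w) \<le> exp (C + B * R)" by auto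
    qed
    have "k holomorphic_on ball 0 R" using k(1) holomorphic_on_subset by blast
    then obtain l where l: "l holomorphic_on ball 0 R" "\<And>z. z \<in> ball 0 R \<Longrightarrow> k z = exp (l z)"
      using contractible_imp_holomorphic_log[of k "ball 0 R"] k(2)
        convex_imp_contractible[OF convex_ball] by metis
    have l0: "Re (l 0) \<ge> L"
    proof -
      have "cmod (g 0) \<le> exp (Re (l 0))" using k(4) l(2)[of 0] R by simp
      then show ?thesis unfolding L_def using g(2)
        by (metis exp_gt_zero ln_exp ln_le_cancel_iff zero_less_norm_iff)
    qed
    have lz: "Re (l w) \<le> C + B * R" if "w \<in> ball 0 R" for w
      using bk[OF that] l(2)[OF that] by simp
    have "cmod (l z - l 0) \<le> 2 * K R"
    proof (rule borel_caratheodory_half[OF l(1) R _ z])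
      fix w :: complex assume "w \<in> ball 0 R"
      then show "Re (l w - l 0) < K R" using lz[of w] l0 by (simp add: K_def)
    qed
    then have "Re (l z) \<ge> L - 2 * K R"
      using l0 abs_Re_le_cmod[of "l z - l 0"] by simp
    moreover have zb: "z \<in> ball 0 R" using z R by auto
    have "exp (Re (h z) + Re (l z)) \<le> exp (C + B * R)"
      using bQ[OF zb] l(2)[OF zb] h(2)[of z] by (simp add: norm_mult exp_add)
    ultimately show ?thesis unfolding K_def by simp
  qed
  define A where "A = \<bar>C\<bar> + \<bar>L\<bar> + 1 + \<bar>Re (h 0)\<bar>"
  have bd: "cmod (h z - h 0) \<le> (8 * A + 24 * B) * cmod z ^ 1" if "1 \<le> norm z" for z
  proof -
    \<comment> \<open>The radius is halved twice: a bound at \<open>z\<close> needs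
      \<open>Re h\<close> on the disc of radius \<open>2 * cmod z\<close>, which in turn needs
      \<open>K\<close> at radius \<open>4 * cmod z\<close>.\<close>
    have "cmod (h z - h 0) \<le> 2 * (3 * K (4 * cmod z) - Re (h 0) + 1)"
    proof (rule borel_caratheodory_half)
      show "h holomorphic_on ball 0 (2 * cmod z)" using h(1) holomorphic_on_subset by blast
      fix w :: complex assume "w \<in> ball 0 (2 * cmod z)"
      then show "Re (h w - h 0) < 3 * K (4 * cmod z) - Re (h 0) + 1"
        using Reh[of "4 * cmod z" w] that by (cases "z = 0") auto
    qed (use that in auto)
    also have "\<dots> \<le> 8 * A + 24 * B * cmod z"
      unfolding K_def A_def using CB by (simp add: algebra_simps)
    also have "\<dots> \<le> (8 * A + 24 * B) * cmod z ^ 1"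
    proof -
      have "8 * A * 1 \<le> 8 * A * cmod z" using that by (intro mult_left_mono) (auto simp: A_def)
      then show ?thesis by (simp add: algebra_simps)
    qed
    finally show ?thesis .
  qed
  define k where "k z = h z - h 0" for z
  have "k z = (\<Sum>j\<le>1. (deriv ^^ j) k 0 / fact j * z ^ j)" for z
  proof (rule Liouville_polynomial)
    show "k holomorphic_on UNIV" unfolding k_def by (intro holomorphic_intros h)
    show "cmod (k z) \<le> (8 * A + 24 * B) * cmod z ^ 1" if "1 \<le> cmod z" for z
      using bd[OF that] by (simp add: k_def)
  qed
  then have "k z = deriv k 0 * z" for z
    by (auto simp: k_def)
  then have "h z = h 0 + deriv k 0 * z" for z
    by (metis k_def add_diff_cancel_left' diff_add_cancel add.commute)
  then show ?thesis using that[of "h 0" "deriv k 0"] h(2) by metis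
qed

section \<open>Entire functions of exponential type with the same zeros\<close>

lemma entire_quotient_of_same_zeros:
  fixes f g :: "complex \<Rightarrow> complex"
  assumes f: "f holomorphic_on UNIV" "f 0 \<noteq> 0" and g: "g holomorphic_on UNIV" "g 0 \<noteq> 0"
    and loc: "\<And>w. \<exists>n F G. F holomorphic_on UNIV \<and> G holomorphic_on UNIV \<and> F w \<noteq> 0 \<and> G w \<noteq> 0 \<and>
      (\<forall>z. f z = (z - w) ^ n * F z \<and> g z = (z - w) ^ n * G z)"
  obtains Q where "Q holomorphic_on UNIV" "\<And>z. Q z \<noteq> 0" "\<And>z. f z = Q z * g z"
proof -
  \<comment> \<open>Taken literally, \<open>f z / g z\<close> is 0 at the zeros of \<open>g\<close>.
    \<open>remove_sings\<close> fills in the limit instead, which at \<open>w\<close> is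
    \<open>F w / G w\<close> because the common power cancels.\<close>
  define Q where "Q = remove_sings (\<lambda>z. f z / g z)"
  have at: "Q analytic_on {w} \<and> Q w \<noteq> 0 \<and> f w = Q w * g w" for w
  proof -
    obtain n F G where F: "F holomorphic_on UNIV" "F w \<noteq> 0" and G: "G holomorphic_on UNIV" "G w \<noteq> 0"
      and fg: "\<And>z. f z = (z - w) ^ n * F z" "\<And>z. g z = (z - w) ^ n * G z"
      using loc[of w] by metis
    have an: "(\<lambda>z. F z / G z) analytic_on {w}"
      using F G by (intro analytic_on_divide) (auto simp: analytic_on_holomorphic)
    have ev: "\<forall>\<^sub>F z in at w. F z / G z = f z / g z"
      by (auto simp: fg eventually_at_filter)
    have lim: "(\<lambda>z. F z / G z) \<midarrow>w\<rightarrow> F w / G w"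
      using analytic_at_imp_isCont[OF an] by (simp add: isCont_def)
    then have lim': "(\<lambda>z. f z / g z) \<midarrow>w\<rightarrow> F w / G w"
      by (rule Lim_transform_eventually[OF _ ev])
    moreover have "isolated_singularity_at (\<lambda>z. f z / g z) w"
      using isolated_singularity_at_cong[OF ev refl] isolated_singularity_at_analytic[OF an] by simp
    ultimately have "Q analytic_on {w}" unfolding Q_def by (intro remove_sings_analytic_at)
    moreover have Qw: "Q w = F w / G w" unfolding Q_def using lim' by (rule remove_sings_eqI)
    moreover have "f w = Q w * g w" using G by (cases n) (auto simp: Qw fg)
    ultimately show ?thesis using F G by auto
  qed
  have "Q analytic_on UNIV" using at analytic_on_analytic_at by blast
  then show ?thesis using that[of Q] at by (auto simp: analytic_on_open)
qed

lemma zorder_entire_factor: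
  assumes "g holomorphic_on UNIV" "g w \<noteq> 0" "\<And>z. f z = (z - w) ^ n * g z"
  shows "zorder f w = int n"
  by (rule zorder_eqI[OF open_UNIV _ assms(1,2)]) (auto simp: assms(3))

lemma exp_type_divide_power:
  assumes f: "exp_type f" and g: "g holomorphic_on UNIV" and fg: "\<And>z. f z = z ^ n * g z"
  shows "exp_type g"
proof -
  obtain C B where fb: "\<And>z. cmod (f z) \<le> exp (C + B * cmod z)" using exp_typeE[OF f] by metis
  show ?thesis
  proof (rule exp_type_outside_ball[where R=1])
    show "continuous_on UNIV g" using g holomorphic_on_imp_continuous_on by blast
    fix z assume z: "cmod z \<ge> 1"
    have "1 * cmod (g z) \<le> cmod z ^ n * cmod (g z)" using z by (intro mult_right_mono) auto
    also have "\<dots> = cmod (f z)" by (simp add: fg norm_mult norm_power)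
    finally show "cmod (g z) \<le> exp (C + B * cmod z)" using fb[of z] by simp
  qed
qed

text \<open>Isolates the cancellation in \<open>E (s + t) / E t\<close> below, with
  \<open>x = t\<close> and \<open>y = s + t\<close>. Two powers are kept because \<open>k\<close>
  and \<open>m\<close> are naturals in unknown order.\<close>

lemma quotient_rearrange:
  fixes e e2 x y :: complex
  assumes "e2 \<noteq> 0" "x \<noteq> 0" "y \<noteq> 0"
  shows "(e * e2 * y ^ k / y ^ m) / (e2 * x ^ k / x ^ m) = e * ((y / x) ^ k / (y / x) ^ m)"
  using assms by (simp add: power_divide)

text \<open>A nonzero limit makes \<open>E (s + t) / E t\<close> tend to 1 for every shift
  \<open>s\<close>, while the formula for \<open>E\<close> makes it tend to
  \<open>exp (\<kappa> * s)\<close>. Oscillating exponentials are thereby excluded along with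
  growing and decaying ones.\<close>

lemma exp_linear_ray_limit:
  fixes \<kappa> L :: complex and k m :: nat
  assumes lim: "((\<lambda>t::real. exp (b + \<kappa> * t) * t ^ k / t ^ m) \<longlongrightarrow> L) at_top" and L: "L \<noteq> 0"
  shows "\<kappa> = 0" "k = m"
proof -
  define E where "E t = exp (b + \<kappa> * of_real t) * of_real t ^ k / of_real t ^ m" for t :: real
  have E: "(E \<longlongrightarrow> L) at_top" using lim by (simp add: E_def[abs_def])
  have shift: "exp (\<kappa> * of_real s) = 1" for s :: real
  proof -
    have "((\<lambda>t. E (s + t)) \<longlongrightarrow> L) at_top"
      using filterlim_compose[OF E filterlim_tendsto_add_at_top[OF tendsto_const filterlim_ident]] .
    then have 1: "((\<lambda>t. E (s + t) / E t) \<longlongrightarrow> L / L) at_top" using E L by (rule tendsto_divide)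
    have st: "((\<lambda>t::real. (s + t) / t) \<longlongrightarrow> 1) at_top" by real_asymp
    have "((\<lambda>t::real. exp (\<kappa> * of_real s) * (complex_of_real ((s + t) / t) ^ k / complex_of_real ((s + t) / t) ^ m)) 
        \<longlongrightarrow> exp (\<kappa> * of_real s) * (of_real 1 ^ k / of_real 1 ^ m)) at_top"
      by (intro tendsto_intros tendsto_of_real st) auto
    moreover have "\<forall>\<^sub>F t in at_top. exp (\<kappa> * of_real s) * (complex_of_real ((s + t) / t) ^ k / complex_of_real ((s + t) / t) ^ m)
        = E (s + t) / E t"
      using eventually_gt_at_top[of "\<bar>s\<bar> + 1"]
    proof eventually_elim
      case (elim t)
      then have nz: "complex_of_real t \<noteq> 0" "complex_of_real (s + t) \<noteq> 0"
        by (auto simp del: of_real_add)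
      have ee: "exp (b + \<kappa> * of_real (s + t)) = exp (\<kappa> * of_real s) * exp (b + \<kappa> * of_real t)"
        by (simp add: exp_add[symmetric] algebra_simps)
      show ?case
        unfolding E_def of_real_divide ee
        by (rule quotient_rearrange[OF exp_not_eq_zero nz, symmetric])
    qed
    ultimately have "((\<lambda>t. E (s + t) / E t) \<longlongrightarrow> exp (\<kappa> * of_real s) * (of_real 1 ^ k / of_real 1 ^ m)) at_top"
      by (rule Lim_transform_eventually)
    from tendsto_unique[OF _ this 1] show ?thesis using L by simp
  qed
  \<comment> \<open>A single \<open>s\<close> would leave \<open>\<kappa> * s\<close> free up to
    multiples of \<open>2 * pi * \<i>\<close>; since the identity holds for all real
    \<open>s\<close>, its derivative at 0 gives \<open>\<kappa> = 0\<close>.\<close>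
  have "((\<lambda>s::real. exp (\<kappa> * of_real s)) has_vector_derivative \<kappa> * exp (\<kappa> * of_real 0)) (at 0)"
    by (rule has_vector_derivative_real_field) (auto intro!: derivative_eq_intros)
  moreover have "((\<lambda>s::real. exp (\<kappa> * of_real s)) has_vector_derivative 0) (at 0)"
    by (simp add: shift)
  ultimately show \<kappa>: "\<kappa> = 0" using vector_derivative_unique_at by fastforce
  \<comment> \<open>With \<open>\<kappa> = 0\<close> shifts no longer detect the power of
    \<open>t\<close>; doubling does, through the factor \<open>2 ^ k / 2 ^ m\<close>.\<close>
  have "((\<lambda>t. E (2 * t)) \<longlongrightarrow> L) at_top"
    using filterlim_compose[OF E, of "\<lambda>t. 2 * t" at_top] filterlim_tendsto_pos_mult_at_top[OF tendsto_const _ filterlim_ident, of "2::real"] by simp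
  then have 1: "((\<lambda>t. E (2 * t) / E t) \<longlongrightarrow> L / L) at_top" using E L by (rule tendsto_divide)
  have "\<forall>\<^sub>F t in at_top. E (2 * t) / E t = 2 ^ k / 2 ^ m"
    using eventually_gt_at_top[of 0]
  proof eventually_elim
    case (elim t)
    then have t: "complex_of_real t \<noteq> 0" "complex_of_real (2 * t) \<noteq> 0" by auto
    show ?case
      using quotient_rearrange[OF exp_not_eq_zero[of b] t, of 1 k m] t(1) by (simp add: E_def \<kappa>)
  qed
  from Lim_transform_eventually[OF 1 this]
  have "(2::complex) ^ k / 2 ^ m = 1" using L by (simp add: tendsto_const_iff)
  then have "(2::complex) ^ k = 2 ^ m" by (simp add: field_simps)
  then have "(2::nat) ^ k = 2 ^ m"
    by (metis of_nat_eq_iff of_nat_numeral of_nat_power)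
  then show "k = m" by simp
qed

text \<open>The hypothesis does not compare the orders \<open>k\<close> and \<open>m\<close> at 0,
  so these powers are split off first. The limit on a single ray then removes the exponential
  factor, forces \<open>k = m\<close> and supplies the constant.\<close>

lemma same_zeros_proportional:
  fixes f g :: "complex \<Rightarrow> complex"
  assumes f: "f holomorphic_on UNIV" "exp_type f" and g: "g holomorphic_on UNIV" "exp_type g"
    and zeros: "same_zeros_on (- {0}) f g" and \<zeta>: "\<zeta> \<noteq> 0"
    and lim: "((\<lambda>t::real. f (\<zeta> * t) / g (\<zeta> * t)) \<longlongrightarrow> L) at_top" and L: "L \<noteq> 0"
  shows "f z = L * g z"
proof -
  \<comment> \<open>Since \<open>x / 0 = 0\<close>, a nonzero quotient certifies that numerator and
    denominator are both nonzero at some point, hence that neither function vanishes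
    identically.\<close>
  have "\<forall>\<^sub>F t in at_top. f (\<zeta> * complex_of_real t) / g (\<zeta> * complex_of_real t) \<noteq> 0"
    using tendsto_imp_eventually_ne[OF lim L] .
  then obtain t0 :: real where t0: "f (\<zeta> * t0) / g (\<zeta> * t0) \<noteq> 0"
    by (metis (mono_tags, lifting) eventually_at_top_linorder order_refl)
  then have nz: "f (\<zeta> * t0) \<noteq> 0" "g (\<zeta> * t0) \<noteq> 0" by auto
  obtain k f0 where f0: "f0 holomorphic_on UNIV" "f0 0 \<noteq> 0" and ff: "\<And>z. f z = (z - 0) ^ k * f0 z"
    using entire_factor_at[OF f(1) nz(1), of 0] by metis
  obtain m g0 where g0: "g0 holomorphic_on UNIV" "g0 0 \<noteq> 0" and gg: "\<And>z. g z = (z - 0) ^ m * g0 z"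
    using entire_factor_at[OF g(1) nz(2), of 0] by metis
  have nz0: "f0 (\<zeta> * t0) \<noteq> 0" "g0 (\<zeta> * t0) \<noteq> 0" using nz ff gg by auto
  have loc: "\<exists>n F G. F holomorphic_on UNIV \<and> G holomorphic_on UNIV \<and> F w \<noteq> 0 \<and> G w \<noteq> 0 \<and>
      (\<forall>z. f0 z = (z - w) ^ n * F z \<and> g0 z = (z - w) ^ n * G z)" for w
  proof (cases "w = 0")
    case True
    then show ?thesis using f0 g0 by (intro exI[of _ 0] exI[of _ f0] exI[of _ g0]) auto
  next
    case False
    obtain n F where F: "F holomorphic_on UNIV" "F w \<noteq> 0" and fF: "\<And>z. f0 z = (z - w) ^ n * F z"
      using entire_factor_at[OF f0(1) nz0(1), of w] by metis
    obtain n' G where G: "G holomorphic_on UNIV" "G w \<noteq> 0" and gG: "\<And>z. g0 z = (z - w) ^ n' * G z"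
      using entire_factor_at[OF g0(1) nz0(2), of w] by metis
    \<comment> \<open>Away from 0 the factor \<open>z ^ k\<close> does not vanish, so
      \<open>f\<close> and \<open>f0\<close> have the same order at \<open>w\<close>; likewise
      \<open>g\<close> and \<open>g0\<close>.\<close>
    have zf: "zorder f w = int n"
    proof (rule zorder_entire_factor)
      show "(\<lambda>z. z ^ k * F z) holomorphic_on UNIV" using F by (intro holomorphic_intros)
    qed (use F False in \<open>auto simp: ff fF\<close>)
    have zg: "zorder g w = int n'"
    proof (rule zorder_entire_factor)
      show "(\<lambda>z. z ^ m * G z) holomorphic_on UNIV" using G by (intro holomorphic_intros)
    qed (use G False in \<open>auto simp: gg gG\<close>)
    have "f w = 0 \<longleftrightarrow> n \<noteq> 0" "g w = 0 \<longleftrightarrow> n' \<noteq> 0"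
      using False F(2) G(2) by (auto simp: ff fF gg gG)
    moreover have "(f w = 0 \<longleftrightarrow> g w = 0) \<and> (f w = 0 \<longrightarrow> zorder f w = zorder g w)"
      using zeros False unfolding same_zeros_on_def by auto
    ultimately have "n = n'" using zf zg by auto
    then show ?thesis using F G fF gG by blast
  qed
  obtain Q where Q: "Q holomorphic_on UNIV" "\<And>z. Q z \<noteq> 0" "\<And>z. f0 z = Q z * g0 z"
    using entire_quotient_of_same_zeros[OF f0 g0 loc] by metis
  have "exp_type f0" by (rule exp_type_divide_power[OF f(2) f0(1), of k]) (simp add: ff)
  moreover have "exp_type g0" by (rule exp_type_divide_power[OF g(2) g0(1), of m]) (simp add: gg)
  ultimately obtain b d where bd: "\<And>z. Q z = exp (b + d * z)"
    using zero_free_quotient_is_exp_linear[OF Q(1,2) g0 Q(3)] by metis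
  have ev: "\<forall>\<^sub>F t in at_top. f (\<zeta> * complex_of_real t) / g (\<zeta> * complex_of_real t) =
      (\<zeta> ^ k / \<zeta> ^ m) * (exp (b + (d * \<zeta>) * of_real t) * of_real t ^ k / of_real t ^ m)"
    using eventually_gt_at_top[of 0] tendsto_imp_eventually_ne[OF lim L]
  proof eventually_elim
    case (elim t)
    then have g0nz: "g0 (\<zeta> * t) \<noteq> 0" by (auto simp: gg)
    have "f (\<zeta> * t) / g (\<zeta> * t) = (\<zeta> * t) ^ k * exp (b + d * (\<zeta> * t)) / (\<zeta> * t) ^ m"
      using g0nz by (simp add: ff gg Q(3) bd)
    also have "\<dots> = (\<zeta> ^ k / \<zeta> ^ m) * (exp (b + (d * \<zeta>) * t) * of_real t ^ k / of_real t ^ m)"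
      by (simp add: power_mult_distrib mult_ac)
    finally show ?case .
  qed
  from Lim_transform_eventually[OF lim ev]
  have "((\<lambda>t::real. (\<zeta> ^ m / \<zeta> ^ k) * ((\<zeta> ^ k / \<zeta> ^ m) * (exp (b + (d * \<zeta>) * of_real t) * of_real t ^ k / of_real t ^ m)))
    \<longlongrightarrow> (\<zeta> ^ m / \<zeta> ^ k) * L) at_top" by (intro tendsto_mult tendsto_const)
  then have "((\<lambda>t::real. exp (b + (d * \<zeta>) * of_real t) * of_real t ^ k / of_real t ^ m) 
    \<longlongrightarrow> (\<zeta> ^ m / \<zeta> ^ k) * L) at_top" using \<zeta> by (simp add: mult.assoc[symmetric])
  from exp_linear_ray_limit[OF this] have "d * \<zeta> = 0" and km: "k = m" using L \<zeta> by auto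
  then have "d = 0" using \<zeta> by simp
  then have fQ: "f z = exp b * g z" for z by (simp add: ff gg Q(3) bd km)
  have "\<forall>\<^sub>F t in at_top. f (\<zeta> * complex_of_real t) / g (\<zeta> * complex_of_real t) = exp b"
    using tendsto_imp_eventually_ne[OF lim L] by eventually_elim (auto simp: fQ)
  from Lim_transform_eventually[OF lim this] have "L = exp b" by (simp add: tendsto_const_iff)
  then show ?thesis using fQ by simp
qed

text \<open>The Phragmen-Lindeloef argument in the sectors around the real axis, where
  \<open>exp (- \<epsilon> z\<^sup>2)\<close> decays faster than any function of exponential type grows.\<close>

lemma sector_bound:
  fixes H :: "complex \<Rightarrow> complex"
  assumes H: "H holomorphic_on UNIV" "exp_type H" and "M > 0"
    and M: "\<And>z. \<bar>Re z\<bar> \<le> 2 * \<bar>Im z\<bar> \<Longrightarrow> cmod (H z) \<le> M"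
    and z: "Re z > 0" "\<bar>Re z\<bar> > 2 * \<bar>Im z\<bar>"
  shows "cmod (H z) \<le> M"
proof -
  obtain C B where CB: "C \<ge> 0" "B \<ge> 0" "\<And>z. cmod (H z) \<le> exp (C + B * cmod z)"
    using exp_typeE[OF H(2)] by metis
  \<comment> \<open>The slope 2 yields \<open>3 * (Im w)\<^sup>2 \<le> (Re w)\<^sup>2\<close> on
    \<open>S\<close>, which is what \<open>Re (w\<^sup>2) \<ge> (cmod w)\<^sup>2 / 2\<close>
    requires; the damping factor is then Gaussian in every direction of \<open>S\<close>.\<close>
  define S where "S = {z. Re z \<ge> 0 \<and> 2 * Im z \<le> Re z \<and> - 2 * Im z \<le> Re z}"
  have clS: "closed S" unfolding S_def
    by (intro closed_Collect_conj closed_Collect_le continuous_intros)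
  have Re2: "Re (w\<^sup>2) \<ge> (cmod w)\<^sup>2 / 2" "Re (w\<^sup>2) \<ge> 0" if "w \<in> S" for w
  proof -
    have "(2 * \<bar>Im w\<bar>)\<^sup>2 \<le> (Re w)\<^sup>2" using that by (intro power_mono) (auto simp: S_def)
    then have "4 * (Im w)\<^sup>2 \<le> (Re w)\<^sup>2" by simp
    moreover have "Re (w\<^sup>2) = (Re w)\<^sup>2 - (Im w)\<^sup>2" by (simp add: power2_eq_square)
    moreover have "3 * (Im w)\<^sup>2 \<le> 4 * (Im w)\<^sup>2" by simp
    ultimately have "(cmod w)\<^sup>2 \<le> 2 * Re (w\<^sup>2)" unfolding cmod_power2 by argo
    then show "Re (w\<^sup>2) \<ge> (cmod w)\<^sup>2 / 2" by simp
    then show "Re (w\<^sup>2) \<ge> 0" using zero_le_power2[of "cmod w"] by linarith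
  qed
  have frS: "w \<in> S \<Longrightarrow> w \<notin> interior S \<Longrightarrow> \<bar>Re w\<bar> \<le> 2 * \<bar>Im w\<bar>" for w
  proof (rule ccontr)
    assume w: "w \<in> S" "w \<notin> interior S" "\<not> \<bar>Re w\<bar> \<le> 2 * \<bar>Im w\<bar>"
    define U where "U = {z. Re z > 0 \<and> 2 * Im z < Re z \<and> - 2 * Im z < Re z}"
    have "open U" unfolding U_def
      by (intro open_Collect_conj open_Collect_less continuous_intros)
    moreover have "U \<subseteq> S" by (auto simp: U_def S_def)
    moreover have "w \<in> U" using w(1,3) by (auto simp: U_def S_def)
    ultimately show False using w(2) interiorI by blast
  qed
  have eps: "cmod (H z) * exp (- \<epsilon> * Re (z\<^sup>2)) \<le> M" if \<epsilon>: "\<epsilon> > 0" for \<epsilon>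
  proof -
    define F where "F z = H z * exp (- of_real \<epsilon> * z\<^sup>2)" for z
    have F: "F holomorphic_on UNIV" unfolding F_def by (intro holomorphic_intros H)
    have nF: "cmod (F w) = cmod (H w) * exp (- \<epsilon> * Re (w\<^sup>2))" for w
      by (simp add: F_def norm_mult)
    have "((\<lambda>r::real. exp (C + B * r - \<epsilon> * (r\<^sup>2 / 2))) \<longlongrightarrow> 0) at_top"
      using \<epsilon> by real_asymp
    then have "\<forall>\<^sub>F r in at_top. exp (C + B * r - \<epsilon> * (r\<^sup>2 / 2)) < M"
      using order_tendstoD(2) \<open>M > 0\<close> by blast
    then have "\<forall>\<^sub>F r in at_top. exp (C + B * r - \<epsilon> * (r\<^sup>2 / 2)) < M \<and> r > cmod z"
      using eventually_gt_at_top[of "cmod z"] eventually_conj by blast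
    \<comment> \<open>On the outer arc the Gaussian must already beat the exponential type, and the
      arc must lie beyond \<open>z\<close>.\<close>
    then obtain R where R: "exp (C + B * R - \<epsilon> * (R\<^sup>2 / 2)) < M" "R > cmod z"
      by (metis (mono_tags, lifting) eventually_at_top_linorder order_refl)
    have "cmod (F z) \<le> M"
    proof (rule maximum_modulus_frontier[of F "S \<inter> cball 0 R"])
      fix w assume "w \<in> frontier (S \<inter> cball 0 R)"
      then have "w \<in> S \<inter> cball 0 R" "w \<notin> interior S \<inter> interior (cball 0 R)"
        using clS by (auto simp: frontier_def closed_Int)
      then have w: "w \<in> S" and "w \<notin> interior S \<or> cmod w = R" by auto
      then consider "\<bar>Re w\<bar> \<le> 2 * \<bar>Im w\<bar>" | "cmod w = R" using frS by blast
      then show "cmod (F w) \<le> M"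
      proof cases
        case 1
        have "cmod (H w) * exp (- \<epsilon> * Re (w\<^sup>2)) \<le> M * 1"
          using M[OF 1] Re2(2)[OF w] \<epsilon> \<open>M > 0\<close> by (intro mult_mono) auto
        then show ?thesis by (simp add: nF)
      next
        case 2
        have "cmod (F w) \<le> exp (C + B * R) * exp (- \<epsilon> * (R\<^sup>2 / 2))"
          unfolding nF using CB(3)[of w] Re2(1)[OF w] \<epsilon> 2 by (intro mult_mono) auto
        also have "\<dots> = exp (C + B * R - \<epsilon> * (R\<^sup>2 / 2))" by (simp add: exp_add[symmetric])
        finally show ?thesis using R(1) by simp
      qed
    next
      show "z \<in> S \<inter> cball 0 R" using z R(2) by (auto simp: S_def)
    qed (use F in \<open>auto intro: holomorphic_on_subset holomorphic_on_imp_continuous_on continuous_on_subset bounded_Int\<close>)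
    then show ?thesis by (simp add: nF)
  qed
  \<comment> \<open>Only the truncation radius depended on \<epsilon>, so with \<open>z\<close>
    fixed the damping can be removed.\<close>
  have "((\<lambda>\<epsilon>. cmod (H z) * exp (- \<epsilon> * Re (z\<^sup>2))) \<longlongrightarrow> cmod (H z) * exp (- 0 * Re (z\<^sup>2))) (at_right 0)"
    by (intro tendsto_intros)
  then have "cmod (H z) * exp (- 0 * Re (z\<^sup>2)) \<le> M"
    by (rule tendsto_upperbound) (use eps in \<open>auto simp: eventually_at_filter\<close>)
  then show ?thesis by simp
qed

text \<open>Both sectors around the real half-axes fall under \<open>sector_bound\<close>, the left
  one after \<open>z\<close> is replaced by \<open>- z\<close>. Liouville makes \<open>H\<close>
  constant, and decay along the imaginary axis leaves only the constant 0.\<close>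

lemma exp_type_vanishing_off_sector:
  fixes H :: "complex \<Rightarrow> complex"
  assumes H: "H holomorphic_on UNIV" "exp_type H"
    and decay: "\<And>z. \<bar>Re z\<bar> \<le> 2 * \<bar>Im z\<bar> \<Longrightarrow> cmod z \<ge> R \<Longrightarrow> cmod (H z) \<le> C / cmod z"
  shows "H z = 0"
proof -
  have "compact (H ` cball 0 (max 1 R))"
    by (intro compact_continuous_image continuous_on_subset[OF holomorphic_on_imp_continuous_on[OF H(1)]]) auto
  then obtain M1 where M1: "\<And>z. z \<in> cball 0 (max 1 R) \<Longrightarrow> cmod (H z) \<le> M1"
    using compact_imp_bounded bounded_iff by (metis image_eqI)
  define M where "M = \<bar>M1\<bar> + \<bar>C\<bar> + 1"
  have off: "cmod (H z) \<le> M" if "\<bar>Re z\<bar> \<le> 2 * \<bar>Im z\<bar>" for z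
  proof (cases "cmod z \<le> max 1 R")
    case True
    then show ?thesis using M1[of z] by (simp add: M_def)
  next
    case False
    then have "cmod (H z) \<le> C / cmod z" using decay that by auto
    also have "\<dots> \<le> \<bar>C\<bar> / 1" using False by (intro frac_le) auto
    finally show ?thesis by (simp add: M_def)
  qed
  have M: "M > 0" by (simp add: M_def)
  have H': "(\<lambda>z. H (- z)) holomorphic_on UNIV" "exp_type (\<lambda>z. H (- z))"
  proof -
    show "(\<lambda>z. H (- z)) holomorphic_on UNIV"
      using holomorphic_on_compose_gen[OF holomorphic_on_minus[OF holomorphic_on_ident] H(1)]
      by (simp add: o_def)
    obtain C B where "\<And>z. cmod (H z) \<le> exp (C + B * cmod z)" using exp_typeE[OF H(2)] by metis
    then show "exp_type (\<lambda>z. H (- z))" by (metis exp_typeI norm_minus_cancel)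
  qed
  have bd: "cmod (H z) \<le> M" for z
  proof (cases "\<bar>Re z\<bar> \<le> 2 * \<bar>Im z\<bar>")
    case False
    then consider "Re z > 0" | "Re (- z) > 0" by fastforce
    then show ?thesis
    proof cases
      case 1 then show ?thesis using sector_bound[OF H M off] False by auto
    next
      case 2
      have "cmod (H (- (- z))) \<le> M"
        by (rule sector_bound[OF H' M]) (use off 2 False in auto)
      then show ?thesis by simp
    qed
  qed (rule off)
  then have "bounded (range H)" unfolding bounded_iff by blast
  then obtain c where c: "\<And>z. H z = c"
    using Liouville_theorem[OF H(1)] unfolding constant_on_def by auto
  have "c = 0"
  proof (rule ccontr)
    assume "c \<noteq> 0"
    define r where "r = \<bar>R\<bar> + \<bar>C\<bar> / cmod c + 1"
    have "\<bar>C\<bar> / cmod c \<ge> 0" by simp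
    then have r: "r > 0" "r \<ge> R" "r > \<bar>C\<bar> / cmod c" unfolding r_def by linarith+
    have "cmod (H (\<i> * of_real r)) \<le> C / cmod (\<i> * of_real r)"
      by (rule decay) (use r in \<open>auto simp: norm_mult\<close>)
    then have "cmod c \<le> C / r" using r by (simp add: c norm_mult)
    then show False using r \<open>c \<noteq> 0\<close> by (simp add: field_simps)
  qed
  then show ?thesis using c by simp
qed

subsection \<open>Indefinite Lebesgue integrals\<close>

lemma absolutely_integrable_mult_continuous:
  fixes p y :: "real \<Rightarrow> complex"
  assumes "p absolutely_integrable_on {a..b}" "continuous_on {a..b} y"
  shows "(\<lambda>t. p t * y t) absolutely_integrable_on {a..b}"
proof -
  have "(\<lambda>t. y t * p t) absolutely_integrable_on {a..b}"
  proof (rule absolutely_integrable_bounded_measurable_product[OF bilinear_times])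
    show "y \<in> borel_measurable (lebesgue_on {a..b})"
      using assms(2) by (intro continuous_imp_measurable_on_sets_lebesgue) auto
    show "bounded (y ` {a..b})"
      using assms(2) by (intro compact_imp_bounded compact_continuous_image) auto
  qed (use assms in auto)
  then show ?thesis by (simp add: mult.commute)
qed

lemma absolutely_integrable_on_Icc_subset:
  fixes p :: "real \<Rightarrow> complex"
  assumes "p absolutely_integrable_on {0..a}" "0 \<le> s" "t \<le> a"
  shows "p absolutely_integrable_on {s..t}"
  by (rule absolutely_integrable_on_subinterval[OF assms(1)]) (use assms in auto)

lemma continuous_indefinite_integral:
  fixes f :: "real \<Rightarrow> complex"
  assumes "f absolutely_integrable_on {0..a}"
  shows "continuous_on {0..a} (\<lambda>x. integral {0..x} f)"
  using assms by (intro indefinite_integral_continuous_1 absolutely_integrable_on_def[THEN iffD1, THEN conjunct1])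

text \<open>Summed over a fine partition, the increments of \<open>N\<close> telescope, so the total
  error is \<open>e * (N x - N 0)\<close> however many steps are taken. With \<open>N\<close> the
  integral of a summable function, this replaces a derivative argument for functions differentiable
  only almost everywhere.\<close>

lemma eq_start_of_small_increments:
  fixes E :: "real \<Rightarrow> 'a::real_normed_vector" and N :: "real \<Rightarrow> real"
  assumes "\<And>e. e > 0 \<Longrightarrow> \<exists>d>0. \<forall>s t. 0 \<le> s \<longrightarrow> s \<le> t \<longrightarrow> t \<le> a \<longrightarrow> t - s < d \<longrightarrow> norm (E t - E s) \<le> e * (N t - N s)"
    and x: "0 \<le> x" "x \<le> a"
  shows "E x = E 0"
proof -
  have small: "norm (E x - E 0) \<le> e * (N x - N 0)" if e: "e > 0" for e
  proof -
    obtain d where d: "d > 0" and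
      D: "\<And>s t. 0 \<le> s \<Longrightarrow> s \<le> t \<Longrightarrow> t \<le> a \<Longrightarrow> t - s < d \<Longrightarrow> norm (E t - E s) \<le> e * (N t - N s)"
      using assms(1)[OF e] by metis
    obtain n :: nat where n: "n > 0" "x / n < d"
    proof -
      obtain n :: nat where "x / d < n" using reals_Archimedean2 by blast
      then have "x < d * real (Suc n)" using d by (simp add: field_simps)
      then have "x / Suc n < d" by (simp add: field_simps)
      then show ?thesis using that[of "Suc n"] by simp
    qed
    define u where "u i = x * real i / n" for i :: nat
    have step: "norm (E (u (Suc i)) - E (u i)) \<le> e * (N (u (Suc i)) - N (u i))" if "i < n" for i
    proof (rule D)
      show "0 \<le> u i" using x by (simp add: u_def)
      show "u i \<le> u (Suc i)" unfolding u_def using x by (intro divide_right_mono mult_left_mono) auto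
      have "x * real (Suc i) \<le> x * real n" using x that by (intro mult_left_mono) auto
      then have "u (Suc i) \<le> x" using n by (simp add: u_def divide_le_eq)
      then show "u (Suc i) \<le> a" using x by simp
      have "u (Suc i) - u i = x / n" unfolding u_def diff_divide_distrib[symmetric] by (simp add: algebra_simps)
      then show "u (Suc i) - u i < d" using n by simp
    qed
    have "norm (E (u k) - E (u 0)) \<le> e * (N (u k) - N (u 0))" if "k \<le> n" for k
      using that
    proof (induction k)
      case (Suc k)
      have "norm (E (u (Suc k)) - E (u 0)) \<le> norm (E (u (Suc k)) - E (u k)) + norm (E (u k) - E (u 0))"
        using norm_triangle_ineq[of "E (u (Suc k)) - E (u k)" "E (u k) - E (u 0)"] by simp
      also have "\<dots> \<le> e * (N (u (Suc k)) - N (u k)) + e * (N (u k) - N (u 0))"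
        using Suc step[of k] by (intro add_mono) auto
      finally show ?case by (simp add: algebra_simps)
    qed simp
    from this[of n] show ?thesis using n by (simp add: u_def)
  qed
  have "norm (E x - E 0) \<le> 0"
  proof (rule field_le_epsilon)
    fix e :: real assume "e > 0"
    define K where "K = \<bar>N x - N 0\<bar> + 1"
    have "norm (E x - E 0) \<le> e / K * (N x - N 0)" using small[of "e / K"] \<open>e > 0\<close> by (simp add: K_def)
    also have "\<dots> \<le> e / K * K" using \<open>e > 0\<close> by (intro mult_left_mono) (auto simp: K_def)
    finally show "norm (E x - E 0) \<le> 0 + e" by (simp add: K_def)
  qed
  then show ?thesis by simp
qed

text \<open>Integration by parts for absolutely continuous functions. On a short interval the error
  is an integral of \<open>f\<close> and \<open>g\<close> against oscillations of \<open>G\<close>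
  and \<open>F\<close>; uniform continuity makes it small relative to the integral of
  \<open>n\<close>, the additive quantity fed to the previous lemma.\<close>

lemma product_rule_integral:
  fixes f g F G :: "real \<Rightarrow> complex"
  assumes f: "f absolutely_integrable_on {0..a}" and g: "g absolutely_integrable_on {0..a}"
    and F: "\<And>x. x \<in> {0..a} \<Longrightarrow> F x = F 0 + integral {0..x} f"
    and G: "\<And>x. x \<in> {0..a} \<Longrightarrow> G x = G 0 + integral {0..x} g"
    and x: "x \<in> {0..a}"
  shows "F x * G x = F 0 * G 0 + integral {0..x} (\<lambda>t. f t * G t + g t * F t)"
proof -
  have "continuous_on {0..a} (\<lambda>x. F 0 + integral {0..x} f)"
    by (intro continuous_intros continuous_indefinite_integral f)
  then have Fc: "continuous_on {0..a} F" by (rule continuous_on_eq) (rule F[symmetric])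
  have "continuous_on {0..a} (\<lambda>x. G 0 + integral {0..x} g)"
    by (intro continuous_intros continuous_indefinite_integral g)
  then have Gc: "continuous_on {0..a} G" by (rule continuous_on_eq) (rule G[symmetric])
  define h where "h t = f t * G t + g t * F t" for t
  have h: "h absolutely_integrable_on {0..a}" unfolding h_def
    by (intro set_integral_add absolutely_integrable_mult_continuous f g Fc Gc)
  define n where "n t = norm (f t) + norm (g t)" for t
  have n: "n absolutely_integrable_on {0..a}" unfolding n_def
    by (intro set_integral_add absolutely_integrable_norm[unfolded o_def] f g)
  have int: "k integrable_on {s..t}" if "k absolutely_integrable_on {0..a}" "0 \<le> s" "t \<le> a" for k :: "real \<Rightarrow> 'b::euclidean_space" and s t
    using absolutely_integrable_on_subinterval[OF that(1), of s t] that(2,3) absolutely_integrable_on_def by fastforce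
  have split: "integral {0..t} k - integral {0..s} k = integral {s..t} k"
    if "k absolutely_integrable_on {0..a}" "0 \<le> s" "s \<le> t" "t \<le> a" for k :: "real \<Rightarrow> 'b::euclidean_space" and s t
    using Henstock_Kurzweil_Integration.integral_combine[of 0 s t k] int[OF that(1), of 0 t] that by (simp add: algebra_simps)
  have "(\<lambda>x. F x * G x - integral {0..x} h) x = (\<lambda>x. F x * G x - integral {0..x} h) 0"
  proof (rule eq_start_of_small_increments[where N = "\<lambda>x. integral {0..x} n" and a = a])
    fix e :: real assume e: "e > 0"
    have "uniformly_continuous_on {0..a} F" "uniformly_continuous_on {0..a} G"
      using Fc Gc by (auto intro: compact_uniformly_continuous)
    then obtain d1 d2 where d: "d1 > 0" "d2 > 0"
      and d1: "\<And>s t. s \<in> {0..a} \<Longrightarrow> t \<in> {0..a} \<Longrightarrow> dist t s < d1 \<Longrightarrow> dist (F t) (F s) < e"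
      and d2: "\<And>s t. s \<in> {0..a} \<Longrightarrow> t \<in> {0..a} \<Longrightarrow> dist t s < d2 \<Longrightarrow> dist (G t) (G s) < e"
      using e unfolding uniformly_continuous_on_def by metis
    show "\<exists>d>0. \<forall>s t. 0 \<le> s \<longrightarrow> s \<le> t \<longrightarrow> t \<le> a \<longrightarrow> t - s < d \<longrightarrow>
      norm ((F t * G t - integral {0..t} h) - (F s * G s - integral {0..s} h)) \<le> e * (integral {0..t} n - integral {0..s} n)"
    proof (intro exI[of _ "min d1 d2"] conjI allI impI)
      fix s t assume st: "0 \<le> s" "s \<le> t" "t \<le> a" "t - s < min d1 d2"
      have Ft: "F t - F s = integral {s..t} f" and Gt: "G t - G s = integral {s..t} g"
        using F[of t] F[of s] G[of t] G[of s] split[OF f st(1-3)] split[OF g st(1-3)] st by auto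
      have cont: "continuous_on {s..t} F" "continuous_on {s..t} G"
        using Fc Gc st by (auto intro: continuous_on_subset)
      have fst: "f absolutely_integrable_on {s..t}" and gst: "g absolutely_integrable_on {s..t}"
        using absolutely_integrable_on_Icc_subset f g st by auto
      have i1: "(\<lambda>u. f u * (G t - G u)) integrable_on {s..t}"
        and i2: "(\<lambda>u. g u * (F s - F u)) integrable_on {s..t}"
        by (intro absolutely_integrable_mult_continuous[THEN absolutely_integrable_on_def[THEN iffD1, THEN conjunct1]]
          fst gst continuous_intros cont)+
      have fi: "f integrable_on {s..t}" and gi: "g integrable_on {s..t}" and hi: "h integrable_on {s..t}"
        using int f g h st by auto
      \<comment> \<open>Taking \<open>G\<close> at the right end and \<open>F\<close> at the left
        end makes the splitting exact: no product of two increments is left over.\<close>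
      have "F t * G t - F s * G s = integral {s..t} f * G t + F s * integral {s..t} g"
        unfolding Ft[symmetric] Gt[symmetric] by (simp add: algebra_simps)
      also have "\<dots> = integral {s..t} (\<lambda>u. f u * G t + g u * F s)"
        using fi gi by (simp add: integral_add integrable_on_mult_left integrable_on_mult_right mult.commute)
      finally have "(F t * G t - integral {0..t} h) - (F s * G s - integral {0..s} h)
         = integral {s..t} (\<lambda>u. f u * G t + g u * F s) - integral {s..t} h"
        using split[OF h st(1-3)] by (simp add: algebra_simps)
      also have "\<dots> = integral {s..t} (\<lambda>u. f u * G t + g u * F s - h u)"
        using fi gi hi by (subst integral_diff) (auto intro!: integrable_add integrable_on_mult_left)
      also have "\<dots> = integral {s..t} (\<lambda>u. f u * (G t - G u) + g u * (F s - F u))"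
        by (simp add: h_def algebra_simps)
      finally have eq: "(F t * G t - integral {0..t} h) - (F s * G s - integral {0..s} h)
        = integral {s..t} (\<lambda>u. f u * (G t - G u) + g u * (F s - F u))" .
      have "norm (integral {s..t} (\<lambda>u. f u * (G t - G u) + g u * (F s - F u))) \<le> integral {s..t} (\<lambda>u. e * n u)"
      proof (rule integral_norm_bound_integral)
        show "(\<lambda>u. f u * (G t - G u) + g u * (F s - F u)) integrable_on {s..t}"
          using i1 i2 by (rule integrable_add)
        show "(\<lambda>u. e * n u) integrable_on {s..t}" using int[OF n] st by (intro integrable_on_mult_right) auto
        fix u assume u: "u \<in> {s..t}"
        then have b: "norm (G t - G u) \<le> e" "norm (F s - F u) \<le> e"
          using d1[of u s] d2[of u t] st by (auto simp: dist_norm)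
        have "norm (f u * (G t - G u) + g u * (F s - F u)) \<le> norm (f u) * e + norm (g u) * e"
          by (rule order_trans[OF norm_triangle_ineq]) (auto simp: norm_mult intro!: add_mono mult_left_mono b)
        then show "norm (f u * (G t - G u) + g u * (F s - F u)) \<le> e * n u"
          by (simp add: n_def algebra_simps)
      qed
      also have "\<dots> = e * (integral {0..t} n - integral {0..s} n)"
        using split[OF n st(1-3)] by simp
      finally show "norm ((F t * G t - integral {0..t} h) - (F s * G s - integral {0..s} h))
        \<le> e * (integral {0..t} n - integral {0..s} n)" unfolding eq .
    qed (use d in auto)
  qed (use x in auto)
  then show ?thesis by (simp add: h_def[abs_def] diff_eq_eq)
qed

subsection \<open>Sturm-Liouville solutions with summable potential\<close>

text \<open>Solutions of \<open>y'' = p y + g\<close> with \<open>yp\<close> for \<open>y'\<close>. The forcing term \<open>g\<close> is there for the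
  derivative of a solution with respect to the spectral parameter.\<close>

definition ode_sol :: "real \<Rightarrow> (real \<Rightarrow> complex) \<Rightarrow> (real \<Rightarrow> complex) \<Rightarrow> (real \<Rightarrow> complex) \<Rightarrow> (real \<Rightarrow> complex) \<Rightarrow> bool" where
  "ode_sol a p g y yp \<longleftrightarrow> continuous_on {0..a} y \<and> continuous_on {0..a} yp \<and>
     (\<forall>x\<in>{0..a}. y x = y 0 + integral {0..x} yp) \<and>
     (\<forall>x\<in>{0..a}. yp x = yp 0 + integral {0..x} (\<lambda>t. p t * y t + g t))"

lemma ode_solD:
  assumes "ode_sol a p g y yp"
  shows "continuous_on {0..a} y" "continuous_on {0..a} yp"
    and "x \<in> {0..a} \<Longrightarrow> y x = y 0 + integral {0..x} yp"
    and "x \<in> {0..a} \<Longrightarrow> yp x = yp 0 + integral {0..x} (\<lambda>t. p t * y t + g t)"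
  using assms unfolding ode_sol_def by blast+

lemma ode_solD0:
  assumes "ode_sol a p (\<lambda>t. 0) y yp" "x \<in> {0..a}"
  shows "yp x = yp 0 + integral {0..x} (\<lambda>t. p t * y t)"
  using ode_solD(4)[OF assms] by (simp only: add_0_right)

section \<open>A priori bounds and existence for the initial value problem\<close>

lemma integral_exp_le:
  fixes \<kappa> x :: real assumes "\<kappa> > 0" "x \<ge> 0"
  shows "integral {0..x} (\<lambda>t. exp (\<kappa> * t)) \<le> exp (\<kappa> * x) / \<kappa>"
proof -
  have "((\<lambda>t. exp (\<kappa> * t)) has_integral (exp (\<kappa> * x) / \<kappa> - exp (\<kappa> * 0) / \<kappa>)) {0..x}"
    using assms by (intro fundamental_theorem_of_calculus)
      (auto simp flip: has_real_derivative_iff_has_vector_derivative intro!: derivative_eq_intros)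
  then have "integral {0..x} (\<lambda>t. exp (\<kappa> * t)) = exp (\<kappa> * x) / \<kappa> - 1 / \<kappa>" by (simp add: integral_unique)
  then show ?thesis using assms by simp
qed

lemma norm_integral_mult_le:
  fixes p f :: "real \<Rightarrow> complex"
  assumes p: "p absolutely_integrable_on {0..a}" and f: "continuous_on {0..a} f"
    and le: "\<And>t. t \<in> {0..x} \<Longrightarrow> norm (f t) \<le> M" and x: "x \<in> {0..a}" and "M \<ge> 0"
  shows "norm (integral {0..x} (\<lambda>t. p t * f t)) \<le> M * integral {0..a} (\<lambda>t. norm (p t))"
proof -
  have pn: "(\<lambda>t. norm (p t)) integrable_on {0..a}" using p by (simp add: absolutely_integrable_on_def)
  then have pnx: "(\<lambda>t. norm (p t)) integrable_on {0..x}"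
    by (rule integrable_on_subinterval) (use x in auto)
  have "norm (integral {0..x} (\<lambda>t. p t * f t)) \<le> integral {0..x} (\<lambda>t. M * norm (p t))"
  proof (rule integral_norm_bound_integral)
    have "(\<lambda>t. p t * f t) integrable_on {0..a}"
      using absolutely_integrable_mult_continuous[OF p f] by (simp add: absolutely_integrable_on_def)
    then show "(\<lambda>t. p t * f t) integrable_on {0..x}"
      by (rule integrable_on_subinterval) (use x in auto)
    show "(\<lambda>t. M * norm (p t)) integrable_on {0..x}" using pnx by (rule integrable_on_mult_right)
    fix t assume "t \<in> {0..x}"
    then show "norm (p t * f t) \<le> M * norm (p t)"
      using le[of t] by (simp add: norm_mult mult.commute mult_right_mono)
  qed
  also have "\<dots> = M * integral {0..x} (\<lambda>t. norm (p t))" by simp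
  also have "\<dots> \<le> M * integral {0..a} (\<lambda>t. norm (p t))"
    using x pn pnx \<open>M \<ge> 0\<close> by (intro mult_left_mono integral_subset_le) auto
  finally show ?thesis .
qed

text \<open>In the weighted norm \<open>sup \<bar>y x\<bar> exp (- \<kappa> x)\<close> the second integration gains a factor \<open>1 / \<kappa>\<close>.\<close>

lemma double_integral_bound:
  fixes p f :: "real \<Rightarrow> complex"
  assumes p: "p absolutely_integrable_on {0..a}" and f: "continuous_on {0..a} f"
    and le: "\<And>t. t \<in> {0..a} \<Longrightarrow> norm (f t) \<le> m * exp (\<kappa> * t)" and "m \<ge> 0"
    and \<kappa>: "\<kappa> = 2 * integral {0..a} (\<lambda>t. norm (p t)) + 1" and x: "x \<in> {0..a}"
  shows "norm (integral {0..x} (\<lambda>s. integral {0..s} (\<lambda>t. p t * f t))) \<le> m / 2 * exp (\<kappa> * x)"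
proof -
  define P where "P = integral {0..a} (\<lambda>t. norm (p t))"
  have P: "P \<ge> 0" unfolding P_def by (rule integral_nonneg) (use p in \<open>auto simp: absolutely_integrable_on_def\<close>)
  \<comment> \<open>\<kappa> is tuned so that the gain \<open>P / \<kappa>\<close> is at most one
    half.\<close>
  have \<kappa>0: "\<kappa> > 0" "P / \<kappa> \<le> 1 / 2" using P unfolding \<kappa> P_def[symmetric] by (auto simp: field_simps)
  have "norm (integral {0..x} (\<lambda>s. integral {0..s} (\<lambda>t. p t * f t))) \<le> integral {0..x} (\<lambda>s. (m * P) * exp (\<kappa> * s))"
  proof (rule integral_norm_bound_integral)
    have "continuous_on {0..a} (\<lambda>s. integral {0..s} (\<lambda>t. p t * f t))"
      by (intro continuous_indefinite_integral absolutely_integrable_mult_continuous p f)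
    then show "(\<lambda>s. integral {0..s} (\<lambda>t. p t * f t)) integrable_on {0..x}"
      using x by (intro integrable_continuous_real) (auto intro: continuous_on_subset)
    show "(\<lambda>s. (m * P) * exp (\<kappa> * s)) integrable_on {0..x}"
      by (intro integrable_continuous_real continuous_intros)
    fix s assume s: "s \<in> {0..x}"
    have "norm (integral {0..s} (\<lambda>t. p t * f t)) \<le> (m * exp (\<kappa> * s)) * P"
      unfolding P_def
    proof (rule norm_integral_mult_le[OF p f])
      fix t assume t: "t \<in> {0..s}"
      then have "m * exp (\<kappa> * t) \<le> m * exp (\<kappa> * s)" using \<open>m \<ge> 0\<close> \<kappa>0 by (intro mult_left_mono) auto
      then show "norm (f t) \<le> m * exp (\<kappa> * s)" using le[of t] t s x by auto
    qed (use s x \<open>m \<ge> 0\<close> in auto)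
    then show "norm (integral {0..s} (\<lambda>t. p t * f t)) \<le> m * P * exp (\<kappa> * s)" by (simp add: mult_ac)
  qed
  also have "\<dots> = (m * P) * integral {0..x} (\<lambda>s. exp (\<kappa> * s))" by simp
  also have "\<dots> \<le> (m * P) * (exp (\<kappa> * x) / \<kappa>)"
    using integral_exp_le[OF \<kappa>0(1), of x] x \<open>m \<ge> 0\<close> P by (intro mult_left_mono) auto
  also have "\<dots> = (P / \<kappa>) * (m * exp (\<kappa> * x))" by simp
  also have "\<dots> \<le> (1 / 2) * (m * exp (\<kappa> * x))" using \<kappa>0 \<open>m \<ge> 0\<close> by (intro mult_right_mono) auto
  finally show ?thesis by simp
qed

text \<open>\<open>K\<close> is chosen before the data and the forcing. This uniformity gives
  uniqueness at once and later turns convergence of data and forcing into convergence of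
  solutions.\<close>

lemma ode_sol_bound:
  assumes p: "p absolutely_integrable_on {0..a}" and a: "a \<ge> 0"
  obtains K where "K > 0" 
    "\<And>g y yp G x. ode_sol a p g y yp \<Longrightarrow> continuous_on {0..a} g \<Longrightarrow> (\<And>t. t \<in> {0..a} \<Longrightarrow> norm (g t) \<le> G) \<Longrightarrow>
       x \<in> {0..a} \<Longrightarrow> norm (y x) \<le> K * (norm (y 0) + norm (yp 0) + G) \<and> norm (yp x) \<le> K * (norm (y 0) + norm (yp 0) + G)"
proof -
  define P where "P = integral {0..a} (\<lambda>t. norm (p t))"
  have P: "P \<ge> 0" unfolding P_def by (rule integral_nonneg) (use p in \<open>auto simp: absolutely_integrable_on_def\<close>)
  define \<kappa> where "\<kappa> = 2 * P + 1"
  \<comment> \<open>Chosen to dominate what data and forcing alone contribute,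
    \<open>norm (y 0) + a * (norm (yp 0) + G * a)\<close>.\<close>
  define c where "c = (1 + a + a * a)"
  define K0 where "K0 = 2 * c * exp (\<kappa> * a)"
  have c: "c \<ge> 1" using a by (simp add: c_def)
  have K0: "K0 \<ge> 0" using c by (simp add: K0_def)
  have main: "norm (y x) \<le> K0 * (norm (y 0) + norm (yp 0) + G) \<and>
     norm (yp x) \<le> (K0 * P + c) * (norm (y 0) + norm (yp 0) + G)"
    if sol: "ode_sol a p g y yp" and g: "continuous_on {0..a} g" and G: "\<And>t. t \<in> {0..a} \<Longrightarrow> norm (g t) \<le> G"
      and x: "x \<in> {0..a}" for g y yp G x
  proof -
    define N where "N = norm (y 0) + norm (yp 0) + G"
    have G0: "G \<ge> 0" using G[of 0] a by (auto intro: order_trans[OF norm_ge_zero])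
    then have N: "N \<ge> 0" by (simp add: N_def)
    have yc: "continuous_on {0..a} y" and ypc: "continuous_on {0..a} yp" using ode_solD(1,2)[OF sol] .
    have ai: "(\<lambda>t. p t * y t) absolutely_integrable_on {0..a}"
      by (intro absolutely_integrable_mult_continuous p yc)
    define v where "v s = integral {0..s} (\<lambda>t. p t * y t)" for s
    have vc: "continuous_on {0..a} v" unfolding v_def by (intro continuous_indefinite_integral ai)
    have gi: "norm (integral {0..s} g) \<le> G * a" if "s \<in> {0..a}" for s
    proof -
      have "norm (integral {0..s} g) \<le> G * (s - 0)"
        using that G g by (intro integral_bound) (auto intro: continuous_on_subset)
      also have "\<dots> \<le> G * a" using that G0 by (intro mult_left_mono) auto
      finally show ?thesis .
    qed
    have gc: "continuous_on {0..a} (\<lambda>s. integral {0..s} g)"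
      using g by (intro indefinite_integral_continuous_1 integrable_continuous_real)
    have yp_eq: "yp s = yp 0 + v s + integral {0..s} g" if s: "s \<in> {0..a}" for s
    proof -
      have "(\<lambda>t. p t * y t) integrable_on {0..s}" "g integrable_on {0..s}"
        using s by (auto intro!: integrable_on_subinterval[OF absolutely_integrable_on_def[THEN iffD1, THEN conjunct1, OF ai]]
          integrable_on_subinterval[OF integrable_continuous_real[OF g]])
      then have 1: "integral {0..s} (\<lambda>t. p t * y t + g t) = v s + integral {0..s} g"
        by (simp add: integral_add v_def)
      have 2: "yp s = yp 0 + integral {0..s} (\<lambda>t. p t * y t + g t)"
        using ode_solD(4)[OF sol s] .
      show ?thesis by (subst 2, subst 1) (simp only: add.assoc)
    qed
    have cN: "norm (y 0) + a * (norm (yp 0) + G * a) \<le> c * N"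
    proof -
      have "norm (y 0) + a * (norm (yp 0) + G * a) \<le> 1 * N + a * N + (a * a) * N"
        using a G0 by (auto simp: N_def algebra_simps intro!: add_mono mult_left_mono)
      then show ?thesis by (simp add: c_def algebra_simps)
    qed
    have y_le: "norm (y s) \<le> c * N + norm (integral {0..s} v)" if s: "s \<in> {0..a}" for s
    proof -
      have cs: "continuous_on {0..s} v" "continuous_on {0..s} (\<lambda>s. yp 0 + integral {0..s} g)"
        using vc gc s by (auto intro!: continuous_intros intro: continuous_on_subset)
      have "y s = y 0 + integral {0..s} yp" using ode_solD(3)[OF sol s] .
      also have "integral {0..s} yp = integral {0..s} (\<lambda>s. v s + (yp 0 + integral {0..s} g))"
        using s by (intro integral_cong, subst yp_eq) auto
      also have "\<dots> = integral {0..s} v + integral {0..s} (\<lambda>s. yp 0 + integral {0..s} g)"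
        using cs by (intro integral_add integrable_continuous_real)
      finally have "norm (y s) \<le> norm (y 0) + (norm (integral {0..s} v) + norm (integral {0..s} (\<lambda>s. yp 0 + integral {0..s} g)))"
        by (metis norm_triangle_ineq norm_triangle_mono order_refl)
      moreover have "norm (integral {0..s} (\<lambda>s. yp 0 + integral {0..s} g)) \<le> (norm (yp 0) + G * a) * (s - 0)"
      proof (rule integral_bound)
        fix t assume "t \<in> {0..s}"
        then show "norm (yp 0 + integral {0..t} g) \<le> norm (yp 0) + G * a"
          using gi[of t] s by (intro norm_triangle_mono) auto
      qed (use s cs in auto)
      moreover have "(norm (yp 0) + G * a) * (s - 0) \<le> (norm (yp 0) + G * a) * a"
        using s G0 a by (intro mult_left_mono) auto
      ultimately show ?thesis using cN by (simp add: mult.commute)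
    qed
    \<comment> \<open>Where the weighted modulus is maximal, the potential term is at most half of
      that maximum and can be absorbed on the left; hence the factor 2 in \<open>K0\<close>.\<close>
    have "compact ((\<lambda>s. norm (y s) * exp (- \<kappa> * s)) ` {0..a})"
      by (intro compact_continuous_image continuous_intros yc) auto
    then obtain s0 where s0: "s0 \<in> {0..a}"
      and s0max: "\<And>s. s \<in> {0..a} \<Longrightarrow> norm (y s) * exp (- \<kappa> * s) \<le> norm (y s0) * exp (- \<kappa> * s0)"
      using compact_attains_sup[of "(\<lambda>s. norm (y s) * exp (- \<kappa> * s)) ` {0..a}"] a by fastforce
    define m where "m = norm (y s0) * exp (- \<kappa> * s0)"
    have m0: "m \<ge> 0" by (simp add: m_def)
    have ym: "norm (y s) \<le> m * exp (\<kappa> * s)" if "s \<in> {0..a}" for s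
      using s0max[OF that] by (simp add: m_def exp_minus field_simps)
    have "norm (integral {0..s0} v) \<le> m / 2 * exp (\<kappa> * s0)"
      unfolding v_def by (rule double_integral_bound[OF p yc ym m0]) (auto simp: \<kappa>_def P_def s0[simplified])
    then have "norm (y s0) \<le> c * N + m / 2 * exp (\<kappa> * s0)" using y_le[OF s0] by linarith
    moreover have "norm (y s0) = m * exp (\<kappa> * s0)" by (simp add: m_def exp_minus)
    ultimately have "m * exp (\<kappa> * s0) \<le> 2 * (c * N)" by simp
    moreover have "m * 1 \<le> m * exp (\<kappa> * s0)" using m0 s0 P by (intro mult_left_mono) (auto simp: \<kappa>_def)
    ultimately have m2: "m \<le> 2 * (c * N)" by linarith
    have yb: "norm (y s) \<le> K0 * N" if s: "s \<in> {0..a}" for s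
    proof -
      have "norm (y s) \<le> m * exp (\<kappa> * s)" by (rule ym[OF s])
      also have "\<dots> \<le> (2 * (c * N)) * exp (\<kappa> * a)"
        using m2 m0 c N s P by (intro mult_mono) (auto simp: \<kappa>_def mult_left_mono)
      finally show ?thesis by (simp add: K0_def mult_ac)
    qed
    moreover have "norm (yp x) \<le> (K0 * P + c) * N"
    proof -
      have "norm (v x) \<le> (K0 * N) * P"
        unfolding v_def P_def by (rule norm_integral_mult_le[OF p yc]) (use yb x K0 N in auto)
      moreover have "norm (yp x) \<le> norm (yp 0) + norm (v x) + norm (integral {0..x} g)"
        unfolding yp_eq[OF x] by (meson norm_triangle_ineq norm_triangle_mono order_refl)
      moreover have "norm (yp 0) + G * a \<le> c * N"
      proof -
        have "norm (yp 0) + G * a \<le> 1 * N + a * N" using a G0 by (auto simp: N_def algebra_simps intro!: add_mono mult_left_mono)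
        also have "\<dots> \<le> c * N" using N a by (simp add: c_def distrib_right)
        finally show ?thesis .
      qed
      ultimately show ?thesis using gi[OF x] by (simp add: algebra_simps)
    qed
    ultimately show ?thesis using x by (simp add: N_def)
  qed
  show ?thesis
  proof (rule that[of "K0 + K0 * P + c"])
    show "0 < K0 + K0 * P + c" using K0 P c by (simp add: add_nonneg_pos)
    fix g y yp G x
    assume as: "ode_sol a p g y yp" "continuous_on {0..a} g" "\<And>t. t \<in> {0..a} \<Longrightarrow> norm (g t) \<le> G" "x \<in> {0..a}"
    have "G \<ge> 0" using as(3)[of 0] a by (auto intro: order_trans[OF norm_ge_zero])
    then have N: "norm (y 0) + norm (yp 0) + G \<ge> 0" by simp
    have "K0 \<le> K0 + K0 * P + c" "K0 * P + c \<le> K0 + K0 * P + c" using K0 P c by auto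
    then show "norm (y x) \<le> (K0 + K0 * P + c) * (norm (y 0) + norm (yp 0) + G) \<and>
       norm (yp x) \<le> (K0 + K0 * P + c) * (norm (y 0) + norm (yp 0) + G)"
      using main[OF as] N by (meson mult_right_mono order_trans)
  qed
qed

lemma ode_sol_lincomb:
  assumes p: "p absolutely_integrable_on {0..a}" and g: "continuous_on {0..a} g" and h: "continuous_on {0..a} h"
    and y: "ode_sol a p g y yp" and z: "ode_sol a p h z zp"
  shows "ode_sol a p (\<lambda>t. c * g t + d * h t) (\<lambda>t. c * y t + d * z t) (\<lambda>t. c * yp t + d * zp t)"
proof -
  have cont: "continuous_on {0..a} y" "continuous_on {0..a} yp" "continuous_on {0..a} z" "continuous_on {0..a} zp"
    using ode_solD(1,2)[OF y] ode_solD(1,2)[OF z] by auto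
  have sub: "f integrable_on {0..x}" if "f integrable_on {0..a}" "x \<in> {0..a}" for f :: "real \<Rightarrow> complex" and x
    by (rule integrable_on_subinterval[OF that(1)]) (use that(2) in auto)
  have ip: "(\<lambda>t. p t * f t) integrable_on {0..a}" if "continuous_on {0..a} f" for f
    using absolutely_integrable_mult_continuous[OF p that] by (simp add: absolutely_integrable_on_def)
  show ?thesis
    unfolding ode_sol_def
  proof (intro conjI ballI)
    fix x assume x: "x \<in> {0..a}"
    have "yp integrable_on {0..x}" "zp integrable_on {0..x}"
      using x cont by (simp_all add: sub integrable_continuous_real del: atLeastAtMost_iff)
    then have "integral {0..x} (\<lambda>t. c * yp t + d * zp t) = c * integral {0..x} yp + d * integral {0..x} zp"
      by (simp add: integral_add integrable_on_mult_right)
    then show "c * y x + d * z x = c * y 0 + d * z 0 + integral {0..x} (\<lambda>t. c * yp t + d * zp t)"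
      by (subst ode_solD(3)[OF y x], subst ode_solD(3)[OF z x]) (simp add: algebra_simps)
    have i: "(\<lambda>t. p t * y t + g t) integrable_on {0..x}" "(\<lambda>t. p t * z t + h t) integrable_on {0..x}"
      using x cont g h by (simp_all add: sub integrable_add ip integrable_continuous_real del: atLeastAtMost_iff)
    have "integral {0..x} (\<lambda>t. p t * (c * y t + d * z t) + (c * g t + d * h t))
       = integral {0..x} (\<lambda>t. c * (p t * y t + g t) + d * (p t * z t + h t))"
      by (simp add: algebra_simps)
    also have "\<dots> = c * integral {0..x} (\<lambda>t. p t * y t + g t) + d * integral {0..x} (\<lambda>t. p t * z t + h t)"
      using i by (simp only: integral_add integrable_on_mult_right integral_mult_right)
    finally show "c * yp x + d * zp x = c * yp 0 + d * zp 0 +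
        integral {0..x} (\<lambda>t. p t * (c * y t + d * z t) + (c * g t + d * h t))"
      by (subst ode_solD(4)[OF y x], subst ode_solD(4)[OF z x]) (simp add: algebra_simps)
  qed (intro continuous_intros cont)+
qed

text \<open>Trades a change of potential for a forcing term, so that solutions for different
  spectral parameters can be compared under one potential and one constant.\<close>

lemma ode_sol_shift_potential:
  assumes "ode_sol a p g y yp"
  shows "ode_sol a (\<lambda>t. p t - c) (\<lambda>t. c * y t + g t) y yp"
proof -
  have "(p t - c) * y t + (c * y t + g t) = p t * y t + g t" for t by (simp add: algebra_simps)
  then show ?thesis using assms unfolding ode_sol_def by presburger
qed

lemma ode_sol_unique:
  assumes p: "p absolutely_integrable_on {0..a}"
    and y: "ode_sol a p (\<lambda>t. 0) y yp" and z: "ode_sol a p (\<lambda>t. 0) z zp"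
    and init: "y 0 = z 0" "yp 0 = zp 0" and x: "x \<in> {0..a}"
  shows "y x = z x" "yp x = zp x"
proof -
  have a: "a \<ge> 0" using x by simp
  have "ode_sol a p (\<lambda>t. 1 * 0 + (-1) * 0) (\<lambda>t. 1 * y t + (-1) * z t) (\<lambda>t. 1 * yp t + (-1) * zp t)"
    by (rule ode_sol_lincomb[OF p _ _ y z]) auto
  then have d: "ode_sol a p (\<lambda>t. 0) (\<lambda>t. y t - z t) (\<lambda>t. yp t - zp t)" by simp
  obtain K where "\<And>g y yp G x. ode_sol a p g y yp \<Longrightarrow> continuous_on {0..a} g \<Longrightarrow> (\<And>t. t \<in> {0..a} \<Longrightarrow> norm (g t) \<le> G) \<Longrightarrow>
       x \<in> {0..a} \<Longrightarrow> norm (y x) \<le> K * (norm (y 0) + norm (yp 0) + G) \<and> norm (yp x) \<le> K * (norm (y 0) + norm (yp 0) + G)"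
    using ode_sol_bound[OF p a] by metis
  from this[OF d _ _ x, of 0] init show "y x = z x" "yp x = zp x" by auto
qed

text \<open>Neumann series for \<open>y = v0 + T y\<close>: in the weighted norm \<open>T\<close> at
  least halves its argument, so the iterates are summable and the partial sums converge
  uniformly.\<close>

lemma ode_sol_exists:
  fixes A B :: complex
  assumes p: "p absolutely_integrable_on {0..a}" and a: "a \<ge> 0" and g: "continuous_on {0..a} g"
  obtains y yp where "ode_sol a p g y yp" "y 0 = A" "yp 0 = B"
proof -
  define T where "T f x = integral {0..x} (\<lambda>s. integral {0..s} (\<lambda>t. p t * f t))" for f x
  \<comment> \<open>The solution for zero potential; it carries the data and the forcing, so the
    iteration itself is linear.\<close>
  define v0 where "v0 x = A + integral {0..x} (\<lambda>s. B + integral {0..s} g)" for x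
  define v where "v n = (T ^^ n) v0" for n
  define \<kappa> where "\<kappa> = 2 * integral {0..a} (\<lambda>t. norm (p t)) + 1"
  have P: "integral {0..a} (\<lambda>t. norm (p t)) \<ge> 0" by (rule integral_nonneg) (use p in \<open>auto simp: absolutely_integrable_on_def\<close>)
  then have \<kappa>0: "\<kappa> > 0" by (simp add: \<kappa>_def)
  have ci: "continuous_on {0..a} (\<lambda>x. integral {0..x} f)" if "continuous_on {0..a} f" for f :: "real \<Rightarrow> complex"
    using that by (intro indefinite_integral_continuous_1 integrable_continuous_real)
  have inner: "continuous_on {0..a} (\<lambda>s. integral {0..s} (\<lambda>t. p t * f t))" if "continuous_on {0..a} f" for f
    by (intro continuous_indefinite_integral absolutely_integrable_mult_continuous p that)
  have Tc: "continuous_on {0..a} (T f)" if "continuous_on {0..a} f" for f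
    unfolding T_def by (intro ci inner that)
  have sub: "f integrable_on {0..x}" if "continuous_on {0..a} f" "x \<in> {0..a}" for f :: "real \<Rightarrow> complex" and x
    by (rule integrable_on_subinterval[OF integrable_continuous_real[OF that(1)]]) (use that(2) in auto)
  have psub: "(\<lambda>t. p t * f t) integrable_on {0..x}" if "continuous_on {0..a} f" "x \<in> {0..a}" for f x
    by (rule integrable_on_subinterval[OF absolutely_integrable_on_def[THEN iffD1, THEN conjunct1, OF absolutely_integrable_mult_continuous[OF p that(1)]]])
      (use that(2) in auto)
  have Tadd: "T (\<lambda>t. f t + h t) x = T f x + T h x"
    if "continuous_on {0..a} f" "continuous_on {0..a} h" "x \<in> {0..a}" for f h x
  proof -
    have "T (\<lambda>t. f t + h t) x = integral {0..x} (\<lambda>s. integral {0..s} (\<lambda>t. p t * f t) + integral {0..s} (\<lambda>t. p t * h t))"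
      unfolding T_def
    proof (rule integral_cong)
      fix s assume s: "s \<in> {0..x}"
      then have "integral {0..s} (\<lambda>t. p t * f t + p t * h t) = integral {0..s} (\<lambda>t. p t * f t) + integral {0..s} (\<lambda>t. p t * h t)"
        using that by (intro integral_add psub) auto
      then show "integral {0..s} (\<lambda>t. p t * (f t + h t)) = integral {0..s} (\<lambda>t. p t * f t) + integral {0..s} (\<lambda>t. p t * h t)"
        by (simp add: algebra_simps)
    qed
    also have "\<dots> = T f x + T h x" unfolding T_def using that by (intro integral_add sub inner)
    finally show ?thesis .
  qed
  have v0c: "continuous_on {0..a} v0" unfolding v0_def by (intro continuous_intros ci g)
  have vc: "continuous_on {0..a} (v n)" for n
    by (induction n) (auto simp: v_def v0c Tc)
  obtain m where m: "\<And>x. x \<in> {0..a} \<Longrightarrow> norm (v0 x) \<le> m"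
  proof -
    have "compact (v0 ` {0..a})" using v0c by (intro compact_continuous_image) auto
    then show ?thesis using that compact_imp_bounded bounded_iff by (metis image_eqI)
  qed
  have m0: "m \<ge> 0" using m[of 0] a by (auto intro: order_trans[OF norm_ge_zero])
  have vb: "norm (v n x) \<le> m / 2 ^ n * exp (\<kappa> * x)" if "x \<in> {0..a}" for n x
    using that
  proof (induction n arbitrary: x)
    case 0
    have "norm (v0 x) \<le> m * 1" using m 0 by simp
    also have "\<dots> \<le> m * exp (\<kappa> * x)" using m0 \<kappa>0 0 by (intro mult_left_mono) auto
    finally show ?case by (simp add: v_def)
  next
    case (Suc n)
    have "norm (T (v n) x) \<le> (m / 2 ^ n) / 2 * exp (\<kappa> * x)"
      unfolding T_def by (rule double_integral_bound[OF p vc Suc.IH _ \<kappa>_def Suc.prems]) (use m0 in auto)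
    then show ?case by (simp add: v_def field_simps)
  qed
  define y where "y x = (\<Sum>i. v i x)" for x
  define S where "S n x = (\<Sum>i<n. v i x)" for n x
  have ul: "uniform_limit {0..a} S y sequentially"
    unfolding y_def[abs_def] S_def[abs_def]
  proof (rule Weierstrass_m_test)
    show "norm (v n x) \<le> m * exp (\<kappa> * a) * (1 / 2) ^ n" if "x \<in> {0..a}" for n x
    proof -
      have "norm (v n x) \<le> m / 2 ^ n * exp (\<kappa> * x)" using vb that by blast
      also have "\<dots> \<le> m / 2 ^ n * exp (\<kappa> * a)" using that \<kappa>0 m0 by (intro mult_left_mono) auto
      finally show ?thesis by (simp add: power_divide)
    qed
    show "summable (\<lambda>n. m * exp (\<kappa> * a) * (1 / 2) ^ n)" by (intro summable_mult summable_geometric) auto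
  qed
  have Sc: "continuous_on {0..a} (S n)" for n unfolding S_def by (intro continuous_intros vc)
  have yc: "continuous_on {0..a} y"
    by (rule uniform_limit_theorem[OF _ ul]) (use Sc in auto)
  have S_Suc: "S (Suc n) x = v0 x + T (S n) x" if "x \<in> {0..a}" for n x
    using that
  proof (induction n arbitrary: x)
    case 0 then show ?case by (simp add: S_def v_def T_def)
  next
    case (Suc n)
    have "S (Suc n) = (\<lambda>t. S n t + v n t)" by (auto simp: S_def)
    then have "T (S (Suc n)) x = T (S n) x + v (Suc n) x"
      using Tadd[OF Sc vc Suc.prems, of n n] by (simp add: v_def)
    moreover have "S (Suc (Suc n)) x = S (Suc n) x + v (Suc n) x" by (simp add: S_def)
    ultimately show ?case using Suc by simp
  qed
  \<comment> \<open>The fixed-point equation survives the limit because the weighted estimate,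
    applied to \<open>S n - y\<close>, makes \<open>T\<close> continuous.\<close>
  have y_eq: "y x = v0 x + T y x" if x: "x \<in> {0..a}" for x
  proof -
    have "(\<lambda>n. T (S n) x) \<longlonglongrightarrow> T y x"
    proof (rule LIMSEQ_I)
      fix e :: real assume e: "e > 0"
      define d where "d = e / exp (\<kappa> * x)"
      have d: "d > 0" using e by (simp add: d_def)
      obtain N where N: "\<And>n t. n \<ge> N \<Longrightarrow> t \<in> {0..a} \<Longrightarrow> norm (S n t - y t) < d"
        using uniform_limitD[OF ul d] unfolding eventually_sequentially dist_norm by blast
      have "norm (T (S n) x - T y x) < e" if n: "n \<ge> N" for n
      proof -
        have dc: "continuous_on {0..a} (\<lambda>t. S n t - y t)" by (intro continuous_intros Sc yc)
        have "T (\<lambda>t. y t + (S n t - y t)) x = T y x + T (\<lambda>t. S n t - y t) x"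
          by (rule Tadd[OF yc dc x])
        then have "T (S n) x - T y x = T (\<lambda>t. S n t - y t) x" by simp
        moreover have "norm (T (\<lambda>t. S n t - y t) x) \<le> d / 2 * exp (\<kappa> * x)"
          unfolding T_def
        proof (rule double_integral_bound[OF p dc _ _ \<kappa>_def x])
          fix t assume t: "t \<in> {0..a}"
          have "norm (S n t - y t) \<le> d * 1" using N[OF n t] by simp
          also have "\<dots> \<le> d * exp (\<kappa> * t)" using d t \<kappa>0 by (intro mult_left_mono) auto
          finally show "norm (S n t - y t) \<le> d * exp (\<kappa> * t)" .
        qed (use d in auto)
        moreover have "d / 2 * exp (\<kappa> * x) < e" using e by (simp add: d_def)
        ultimately show ?thesis by simp
      qed
      then show "\<exists>N. \<forall>n\<ge>N. norm (T (S n) x - T y x) < e" by blast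
    qed
    then have "(\<lambda>n. S (Suc n) x) \<longlonglongrightarrow> v0 x + T y x"
      unfolding S_Suc[OF x] by (intro tendsto_intros)
    moreover have "(\<lambda>n. S (Suc n) x) \<longlonglongrightarrow> y x"
      using tendsto_uniform_limitI[OF ul x] by (rule LIMSEQ_Suc)
    ultimately show ?thesis by (rule LIMSEQ_unique[rotated])
  qed
  define yp where "yp x = B + integral {0..x} (\<lambda>t. p t * y t + g t)" for x
  have yp_eq: "yp s = (B + integral {0..s} g) + integral {0..s} (\<lambda>t. p t * y t)" if "s \<in> {0..a}" for s
    unfolding yp_def integral_add[OF psub[OF yc that] sub[OF g that]] by simp
  have bc: "continuous_on {0..a} (\<lambda>s. B + integral {0..s} g)" by (intro continuous_intros ci g)
  have ypc: "continuous_on {0..a} yp"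
    by (rule continuous_on_eq[of _ "\<lambda>s. (B + integral {0..s} g) + integral {0..s} (\<lambda>t. p t * y t)"])
      (auto intro!: continuous_intros bc inner yc simp: yp_eq)
  have y0: "y 0 = A" using y_eq[of 0] a by (simp add: v0_def T_def)
  have "ode_sol a p g y yp"
    unfolding ode_sol_def
  proof (intro conjI ballI)
    fix x assume x: "x \<in> {0..a}"
    have "integral {0..x} yp = integral {0..x} (\<lambda>s. (B + integral {0..s} g) + integral {0..s} (\<lambda>t. p t * y t))"
      using x by (intro integral_cong) (auto simp: yp_eq)
    also have "\<dots> = integral {0..x} (\<lambda>s. B + integral {0..s} g) + T y x"
      unfolding T_def using x by (intro integral_add sub bc inner yc)
    finally show "y x = y 0 + integral {0..x} yp" using y_eq[OF x] by (simp add: y0 v0_def)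
    show "yp x = yp 0 + integral {0..x} (\<lambda>t. p t * y t + g t)" by (simp add: yp_def)
  qed (use yc ypc in auto)
  then show ?thesis using that y0 by (simp add: yp_def)
qed

section \<open>Reflection of the interval and Wronskians\<close>

lemma has_integral_reverse:
  fixes f :: "real \<Rightarrow> 'b::banach"
  assumes "(f has_integral i) {c..d}"
  shows "((\<lambda>t. f (a - t)) has_integral i) {a - d..a - c}"
proof (cases "c \<le> d")
  case True
  have "((\<lambda>t. f ((-1) *\<^sub>R t + a)) has_integral ((1 / \<bar>-1\<bar> ^ DIM(real)) *\<^sub>R i)) ((\<lambda>x. (1 / (-1)) *\<^sub>R x + - ((1 / (-1)) *\<^sub>R a)) ` cbox c d)"
    by (rule has_integral_affinity) (use assms in auto)
  moreover have "(\<lambda>x::real. (1 / (-1)) *\<^sub>R x + - ((1 / (-1)) *\<^sub>R a)) ` cbox c d = {a - d..a - c}"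
  proof -
    have "(\<lambda>x::real. (1 / (-1)) *\<^sub>R x + - ((1 / (-1)) *\<^sub>R a)) ` cbox c d = (\<lambda>x. a - x) ` {c..d}" by auto
    also have "\<dots> = {a - d..a - c}" using True by simp
    finally show ?thesis .
  qed
  ultimately show ?thesis by simp
next
  case False
  then have "{c..d} = {}" "{a - d..a - c} = {}" by auto
  then show ?thesis using assms by simp
qed

lemma integrable_reverse:
  fixes f :: "real \<Rightarrow> 'b::banach"
  assumes "f integrable_on {c..d}"
  shows "(\<lambda>t. f (a - t)) integrable_on {a - d..a - c}" "integral {a - d..a - c} (\<lambda>t. f (a - t)) = integral {c..d} f"
  using has_integral_reverse[OF integrable_integral[OF assms], of a] by (auto simp: integral_unique integrable_on_def)

lemma absolutely_integrable_reverse: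
  fixes p :: "real \<Rightarrow> complex"
  assumes "p absolutely_integrable_on {0..a}"
  shows "(\<lambda>t. p (a - t)) absolutely_integrable_on {0..a}"
  using assms integrable_reverse(1)[of p 0 a a] integrable_reverse(1)[of "\<lambda>t. norm (p t)" 0 a a]
  by (simp add: absolutely_integrable_on_def)

text \<open>Carries Cauchy data at the right end to the origin, where the initial value lemmas
  apply. The first derivative changes sign, the second does not.\<close>

lemma ode_sol_reverse:
  assumes p: "p absolutely_integrable_on {0..a}" and y: "ode_sol a p (\<lambda>t. 0) y yp"
  shows "ode_sol a (\<lambda>t. p (a - t)) (\<lambda>t. 0) (\<lambda>t. y (a - t)) (\<lambda>t. - yp (a - t))"
proof -
  have cont: "continuous_on {0..a} y" "continuous_on {0..a} yp" using ode_solD(1,2)[OF y] .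
  have crev: "continuous_on {0..a} (\<lambda>t. f (a - t))" if "continuous_on {0..a} f" for f :: "real \<Rightarrow> complex"
    by (rule continuous_on_compose2[OF that]) (auto intro!: continuous_intros)
  have key: "f (a - x) = f a - integral {0..x} (\<lambda>t. k (a - t))"
    if k: "k integrable_on {0..a}" and fk: "\<And>x. x \<in> {0..a} \<Longrightarrow> f x = f 0 + integral {0..x} k" and x: "x \<in> {0..a}"
    for f k :: "real \<Rightarrow> complex" and x
  proof -
    have ks: "k integrable_on {a - x..a}" by (rule integrable_on_subinterval[OF k]) (use x in auto)
    have "integral {0..a - x} k + integral {a - x..a} k = integral {0..a} k"
      using x k by (intro Henstock_Kurzweil_Integration.integral_combine) auto
    moreover have "integral {0..x} (\<lambda>t. k (a - t)) = integral {a - x..a} k"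
      using integrable_reverse(2)[OF ks, of a] by simp
    ultimately show ?thesis using fk[of "a - x"] fk[of a] x by (simp add: algebra_simps)
  qed
  have ip: "(\<lambda>t. p t * y t) integrable_on {0..a}"
    using absolutely_integrable_mult_continuous[OF p cont(1)] by (simp add: absolutely_integrable_on_def)
  show ?thesis
    unfolding ode_sol_def
  proof (intro conjI ballI)
    fix x assume x: "x \<in> {0..a}"
    have "y (a - x) = y a - integral {0..x} (\<lambda>t. yp (a - t))"
      by (rule key[OF integrable_continuous_real[OF cont(2)] ode_solD(3)[OF y] x])
    then show "y (a - x) = y (a - 0) + integral {0..x} (\<lambda>t. - yp (a - t))" by simp
    have "yp (a - x) = yp a - integral {0..x} (\<lambda>t. p (a - t) * y (a - t))"
      by (rule key[OF ip ode_solD0[OF y] x])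
    then show "- yp (a - x) = - yp (a - 0) + integral {0..x} (\<lambda>t. p (a - t) * y (a - t) + 0)" by simp
  qed (intro continuous_intros crev cont)+
qed

lemma ode_sol_has_derivative:
  assumes "ode_sol a p g y yp" "x \<in> {0..a}"
  shows "(y has_vector_derivative yp x) (at x within {0..a})"
proof -
  have "((\<lambda>u. y 0 + integral {0..u} yp) has_vector_derivative yp x) (at x within {0..a})"
    using integral_has_vector_derivative[OF ode_solD(2)[OF assms(1)] assms(2)]
    by (auto intro!: derivative_eq_intros)
  then show ?thesis
    by (rule has_vector_derivative_transform[OF assms(2), rotated]) (rule ode_solD(3)[OF assms(1)])
qed

text \<open>The products \<open>y * zp\<close> and \<open>z * yp\<close> have the same integrand
  \<open>yp * zp + p * y * z\<close>, so their difference keeps its initial value.\<close>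

lemma ode_sol_wronskian:
  assumes p: "p absolutely_integrable_on {0..a}"
    and y: "ode_sol a p (\<lambda>t. 0) y yp" and z: "ode_sol a p (\<lambda>t. 0) z zp" and x: "x \<in> {0..a}"
  shows "y x * zp x - yp x * z x = y 0 * zp 0 - yp 0 * z 0"
proof -
  have cont: "continuous_on {0..a} y" "continuous_on {0..a} yp" "continuous_on {0..a} z" "continuous_on {0..a} zp"
    using ode_solD(1,2)[OF y] ode_solD(1,2)[OF z] by auto
  have aip: "(\<lambda>t. p t * f t) absolutely_integrable_on {0..a}" if "continuous_on {0..a} f" for f
    by (intro absolutely_integrable_mult_continuous p that)
  have aic: "f absolutely_integrable_on {0..a}" if "continuous_on {0..a} f" for f :: "real \<Rightarrow> complex"
    using that by (rule absolutely_integrable_continuous_real)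
  have 1: "y x * zp x = y 0 * zp 0 + integral {0..x} (\<lambda>t. yp t * zp t + (p t * z t) * y t)"
    by (rule product_rule_integral[OF aic[OF cont(2)] aip[OF cont(3)] ode_solD(3)[OF y] ode_solD0[OF z] x])
  have "z x * yp x = z 0 * yp 0 + integral {0..x} (\<lambda>t. zp t * yp t + (p t * y t) * z t)"
    by (rule product_rule_integral[OF aic[OF cont(4)] aip[OF cont(1)] ode_solD(3)[OF z] ode_solD0[OF y] x])
  also have "(\<lambda>t. zp t * yp t + (p t * y t) * z t) = (\<lambda>t. yp t * zp t + (p t * z t) * y t)"
    by (auto simp: mult_ac)
  finally show ?thesis using 1 by (simp add: mult_ac)
qed

text \<open>The candidate derivative \<open>z\<close> solves the equation differentiated in
  \<open>l\<close>, whose forcing is \<open>- 2 * l * y\<close>. The difference quotient minus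
  \<open>z\<close> solves a problem with data and forcing tending to 0, and
  \<open>ode_sol_bound\<close> concludes.\<close>

lemma ode_sol_family_holomorphic:
  assumes q: "q absolutely_integrable_on {0..a}" and a: "a \<ge> 0"
    and sol: "\<And>l. ode_sol a (\<lambda>t. q t - l\<^sup>2) (\<lambda>t. 0) (y l) (yp l)"
    and A: "(\<lambda>l. y l 0) holomorphic_on UNIV" and B: "(\<lambda>l. yp l 0) holomorphic_on UNIV"
    and x: "x \<in> {0..a}"
  shows "(\<lambda>l. y l x) holomorphic_on UNIV" "(\<lambda>l. yp l x) holomorphic_on UNIV"
proof -
  have "((\<lambda>l. y l x) has_field_derivative z x) (at l) \<and> ((\<lambda>l. yp l x) has_field_derivative zp x) (at l)"
    if z: "ode_sol a (\<lambda>t. q t - l\<^sup>2) (\<lambda>t. - 2 * l * y l t) z zp"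
      and z0: "z 0 = deriv (\<lambda>l. y l 0) l" and zp0: "zp 0 = deriv (\<lambda>l. yp l 0) l" for l z zp
  proof -
    define p where "p t = q t - l\<^sup>2" for t
    have p: "p absolutely_integrable_on {0..a}" unfolding p_def
      by (rule set_integral_diff(1)[OF q absolutely_integrable_continuous_real[OF continuous_on_const]])
    have yc: "continuous_on {0..a} (y m)" for m using ode_solD(1)[OF sol[of m]] .
    obtain K where K: "K > 0" and bd: "\<And>g y yp G x. ode_sol a p g y yp \<Longrightarrow> continuous_on {0..a} g \<Longrightarrow> (\<And>t. t \<in> {0..a} \<Longrightarrow> norm (g t) \<le> G) \<Longrightarrow>
       x \<in> {0..a} \<Longrightarrow> norm (y x) \<le> K * (norm (y 0) + norm (yp 0) + G) \<and> norm (yp x) \<le> K * (norm (y 0) + norm (yp 0) + G)"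
      using ode_sol_bound[OF p a] by metis
    obtain Y where Y: "\<And>t. t \<in> {0..a} \<Longrightarrow> norm (y l t) \<le> Y"
    proof -
      have "compact (y l ` {0..a})" using yc by (intro compact_continuous_image) auto
      then show ?thesis using that compact_imp_bounded bounded_iff by (metis image_eqI)
    qed
    have sol_m: "ode_sol a p (\<lambda>t. (l\<^sup>2 - m\<^sup>2) * y m t) (y m) (yp m)" for m
      using ode_sol_shift_potential[OF sol[of m], of "l\<^sup>2 - m\<^sup>2"] by (simp add: p_def[abs_def] algebra_simps)
    have dsol: "ode_sol a p (\<lambda>t. (l\<^sup>2 - m\<^sup>2) * y m t) (\<lambda>t. y m t - y l t) (\<lambda>t. yp m t - yp l t)" for m
    proof -
      have "ode_sol a p (\<lambda>t. 1 * ((l\<^sup>2 - m\<^sup>2) * y m t) + (-1) * 0) (\<lambda>t. 1 * y m t + (-1) * y l t) (\<lambda>t. 1 * yp m t + (-1) * yp l t)"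
        by (rule ode_sol_lincomb[OF p _ _ sol_m]) (use sol[of l] yc in \<open>auto simp: p_def[abs_def] intro!: continuous_intros\<close>)
      then show ?thesis by simp
    qed
    define \<alpha> where "\<alpha> m = norm (y m 0 - y l 0) + norm (yp m 0 - yp l 0)" for m
    define \<delta> where "\<delta> m = 2 * K * (\<alpha> m + norm (l\<^sup>2 - m\<^sup>2) * Y)" for m
    \<comment> \<open>The forcing contains the unknown \<open>y m\<close>, so the maximal difference
      \<open>D\<close> occurs on both sides; for \<open>m\<close> near \<open>l\<close> its
      coefficient is at most 1/2 and it is absorbed.\<close>
    have d_le: "norm (y m t - y l t) \<le> \<delta> m" if small: "K * norm (l\<^sup>2 - m\<^sup>2) \<le> 1 / 2" and t: "t \<in> {0..a}" for m t
    proof -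
      have "compact ((\<lambda>s. norm (y m s - y l s)) ` {0..a})"
        by (intro compact_continuous_image continuous_intros yc) auto
      then obtain s0 where s0: "s0 \<in> {0..a}"
        and s0max: "\<And>s. s \<in> {0..a} \<Longrightarrow> norm (y m s - y l s) \<le> norm (y m s0 - y l s0)"
        using compact_attains_sup[of "(\<lambda>s. norm (y m s - y l s)) ` {0..a}"] a by fastforce
      define D where "D = norm (y m s0 - y l s0)"
      have "D \<le> K * (\<alpha> m + norm (l\<^sup>2 - m\<^sup>2) * (Y + D))"
        unfolding D_def \<alpha>_def
      proof (rule bd[OF dsol, THEN conjunct1])
        fix s assume s: "s \<in> {0..a}"
        have "norm (y m s) \<le> Y + norm (y m s0 - y l s0)"
          using Y[OF s] s0max[OF s] norm_triangle_ineq[of "y l s" "y m s - y l s"] by simp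
        then show "norm ((l\<^sup>2 - m\<^sup>2) * y m s) \<le> norm (l\<^sup>2 - m\<^sup>2) * (Y + norm (y m s0 - y l s0))"
          unfolding norm_mult by (rule mult_left_mono) simp
      qed (use s0 yc in \<open>auto intro!: continuous_intros\<close>)
      also have "\<dots> = K * (\<alpha> m + norm (l\<^sup>2 - m\<^sup>2) * Y) + (K * norm (l\<^sup>2 - m\<^sup>2)) * D" by (simp add: algebra_simps)
      also have "\<dots> \<le> K * (\<alpha> m + norm (l\<^sup>2 - m\<^sup>2) * Y) + (1 / 2) * D"
        using small by (intro add_left_mono mult_right_mono) (auto simp: D_def)
      finally show ?thesis using s0max[OF t] by (simp add: D_def \<delta>_def)
    qed
    define \<eta> where "\<eta> m = K * (norm ((y m 0 - y l 0) / (m - l) - z 0) + norm ((yp m 0 - yp l 0) / (m - l) - zp 0)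
       + (norm (m - l) * Y + norm (l + m) * \<delta> m))" for m
    have w_le: "norm ((y m x - y l x) / (m - l) - z x) \<le> \<eta> m \<and> norm ((yp m x - yp l x) / (m - l) - zp x) \<le> \<eta> m"
      if small: "K * norm (l\<^sup>2 - m\<^sup>2) \<le> 1 / 2" and ne: "m \<noteq> l" for m
    proof -
      define c where "c = 1 / (m - l)"
      have "ode_sol a p (\<lambda>t. c * ((l\<^sup>2 - m\<^sup>2) * y m t) + (-1) * (- 2 * l * y l t))
          (\<lambda>t. c * (y m t - y l t) + (-1) * z t) (\<lambda>t. c * (yp m t - yp l t) + (-1) * zp t)"
        by (rule ode_sol_lincomb[OF p _ _ dsol]) (use z yc in \<open>auto simp: p_def[abs_def] intro!: continuous_intros\<close>)
      then have ws: "ode_sol a p (\<lambda>t. c * ((l\<^sup>2 - m\<^sup>2) * y m t) + 2 * l * y l t)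
          (\<lambda>t. (y m t - y l t) / (m - l) - z t) (\<lambda>t. (yp m t - yp l t) / (m - l) - zp t)"
        by (simp add: c_def)
      show ?thesis
        unfolding \<eta>_def
      proof (rule bd[OF ws])
        fix t assume t: "t \<in> {0..a}"
        \<comment> \<open>The singular factor \<open>1 / (m - l)\<close> cancels, and what remains
          of the forcing is small by the continuity bound \<delta>.\<close>
        have "c * (l\<^sup>2 - m\<^sup>2) = - (l + m)"
          using ne by (simp add: c_def power2_eq_square field_simps)
        then have "c * ((l\<^sup>2 - m\<^sup>2) * y m t) + 2 * l * y l t = - (m - l) * y l t - (l + m) * (y m t - y l t)"
          by (simp add: mult.assoc[symmetric]) (simp add: algebra_simps)
        also have "norm \<dots> \<le> norm (m - l) * Y + norm (l + m) * \<delta> m"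
        proof (rule order_trans[OF norm_triangle_ineq4], unfold norm_mult norm_minus_cancel, rule add_mono)
          show "cmod (m - l) * cmod (y l t) \<le> cmod (m - l) * Y" using Y[OF t] by (intro mult_left_mono) auto
          show "cmod (l + m) * cmod (y m t - y l t) \<le> cmod (l + m) * \<delta> m"
            using d_le[OF small t] by (intro mult_left_mono) auto
        qed
        finally show "norm (c * ((l\<^sup>2 - m\<^sup>2) * y m t) + 2 * l * y l t) \<le> norm (m - l) * Y + norm (l + m) * \<delta> m" .
      qed (use x yc in \<open>auto intro!: continuous_intros\<close>)
    qed
    have dA: "((\<lambda>m. (y m 0 - y l 0) / (m - l)) \<longlongrightarrow> z 0) (at l)" and dB: "((\<lambda>m. (yp m 0 - yp l 0) / (m - l)) \<longlongrightarrow> zp 0) (at l)"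
      using holomorphic_derivI[OF A open_UNIV, of l] holomorphic_derivI[OF B open_UNIV, of l]
      unfolding z0 zp0 has_field_derivative_iff by auto
    have cA: "((\<lambda>m. y m 0) \<longlongrightarrow> y l 0) (at l)" and cB: "((\<lambda>m. yp m 0) \<longlongrightarrow> yp l 0) (at l)"
      using holomorphic_on_imp_continuous_on[OF A] holomorphic_on_imp_continuous_on[OF B]
      by (auto simp: continuous_on_eq_continuous_at isCont_def)
    have "(\<delta> \<longlongrightarrow> 2 * K * (norm (y l 0 - y l 0) + norm (yp l 0 - yp l 0) + norm (l\<^sup>2 - l\<^sup>2) * Y)) (at l)"
      unfolding \<delta>_def \<alpha>_def by (intro tendsto_intros cA cB)
    then have \<delta>0: "(\<delta> \<longlongrightarrow> 0) (at l)" by simp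
    have "(\<eta> \<longlongrightarrow> K * (norm (z 0 - z 0) + norm (zp 0 - zp 0) + (norm (l - l) * Y + norm (l + l) * 0))) (at l)"
      unfolding \<eta>_def by (intro tendsto_intros dA dB \<delta>0)
    then have \<eta>0: "(\<eta> \<longlongrightarrow> 0) (at l)" by simp
    have "((\<lambda>m. K * norm (l\<^sup>2 - m\<^sup>2)) \<longlongrightarrow> K * norm (l\<^sup>2 - l\<^sup>2)) (at l)" by (intro tendsto_intros)
    then have "\<forall>\<^sub>F m in at l. K * norm (l\<^sup>2 - m\<^sup>2) < 1 / 2"
      by (rule order_tendstoD(2)) simp
    then have ev: "\<forall>\<^sub>F m in at l. norm ((y m x - y l x) / (m - l) - z x) \<le> \<eta> m \<and> norm ((yp m x - yp l x) / (m - l) - zp x) \<le> \<eta> m"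
      using eventually_neq_at_within[of l l UNIV]
    proof eventually_elim
      case (elim m)
      then show ?case using w_le[of m] by auto
    qed
    have "((\<lambda>m. (y m x - y l x) / (m - l) - z x) \<longlongrightarrow> 0) (at l)"
      by (rule Lim_null_comparison[OF _ \<eta>0]) (use ev in \<open>auto elim: eventually_mono\<close>)
    moreover have "((\<lambda>m. (yp m x - yp l x) / (m - l) - zp x) \<longlongrightarrow> 0) (at l)"
      by (rule Lim_null_comparison[OF _ \<eta>0]) (use ev in \<open>auto elim: eventually_mono\<close>)
    ultimately show ?thesis unfolding has_field_derivative_iff
      by (auto simp: LIM_zero_iff)
  qed
  moreover have "\<exists>z zp. ode_sol a (\<lambda>t. q t - l\<^sup>2) (\<lambda>t. - 2 * l * y l t) z zp
     \<and> z 0 = deriv (\<lambda>l. y l 0) l \<and> zp 0 = deriv (\<lambda>l. yp l 0) l" for l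
  proof -
    have "(\<lambda>t. q t - l\<^sup>2) absolutely_integrable_on {0..a}"
      by (rule set_integral_diff(1)[OF q absolutely_integrable_continuous_real[OF continuous_on_const]])
    moreover have "continuous_on {0..a} (\<lambda>t. - 2 * l * y l t)"
      using ode_solD(1)[OF sol[of l]] by (intro continuous_intros)
    ultimately show ?thesis using ode_sol_exists[OF _ a] by metis
  qed
  ultimately show "(\<lambda>l. y l x) holomorphic_on UNIV" "(\<lambda>l. yp l x) holomorphic_on UNIV"
    unfolding holomorphic_on_def field_differentiable_def by (metis has_field_derivative_at_within)+
qed

section \<open>Passage to integral equations, and functions with vanishing integrals\<close>

lemma L2_on_imp_absolutely_integrable:
  assumes "L2_on {0<..<a} f"
  shows "f absolutely_integrable_on {0..a}"
proof -
  have m: "f \<in> borel_measurable (lebesgue_on {0<..<a})"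
    and i: "integrable (lebesgue_on {0<..<a}) (\<lambda>x. (cmod (f x))\<^sup>2)"
    using assms by (auto simp: L2_on_def)
  have "integrable (lebesgue_on {0<..<a}) (\<lambda>x. 1 + (cmod (f x))\<^sup>2)"
    using i by (intro Bochner_Integration.integrable_add) (auto simp: integrable_restrict_space simp flip: lmeasurable_iff_integrable)
  then have "integrable (lebesgue_on {0<..<a}) f"
  proof (rule Bochner_Integration.integrable_bound[OF _ m], intro AE_I2)
    fix x
    have "2 * cmod (f x) \<le> 1 + (cmod (f x))\<^sup>2"
      using zero_le_power2[of "cmod (f x) - 1"] by (simp add: power2_eq_square algebra_simps)
    moreover have "cmod (f x) \<le> 2 * cmod (f x)" by simp
    ultimately have "cmod (f x) \<le> 1 + (cmod (f x))\<^sup>2" by (rule order_trans[rotated])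
    then show "norm (f x) \<le> norm (1 + (cmod (f x))\<^sup>2)" by simp
  qed
  then have "f absolutely_integrable_on {0<..<a}"
    by (simp add: integrable_restrict_space set_integrable_def)
  then show ?thesis using absolutely_integrable_on_Icc_iff_Ioo by blast
qed

lemma sl_solution_imp_ode_sol:
  assumes q: "q absolutely_integrable_on {0..a}" and a: "a > 0" and y: "sl_solution a q \<rho> y"
  shows "ode_sol a (\<lambda>t. q t - \<rho>\<^sup>2) (\<lambda>t. 0) y (dx a y)"
proof -
  obtain y2 where diff: "\<forall>x\<in>{0..a}. y differentiable (at x within {0..a})"
    and y2: "y2 absolutely_integrable_on {0..a}"
    and yp: "\<forall>x\<in>{0..a}. dx a y x = dx a y 0 + integral {0..x} y2"
    and ae: "AE x in lebesgue. x \<in> {0<..<a} \<longrightarrow> - y2 x + q x * y x = \<rho>\<^sup>2 * y x"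
    using y unfolding sl_solution_def by blast
  have der: "(y has_vector_derivative dx a y x) (at x within {0..a})" if "x \<in> {0..a}" for x
    using diff that unfolding dx_def by (simp add: vector_derivative_works)
  have yc: "continuous_on {0..a} y"
    using diff by (simp add: continuous_on_eq_continuous_within differentiable_imp_continuous_within)
  have "continuous_on {0..a} (\<lambda>x. dx a y 0 + integral {0..x} y2)"
    by (intro continuous_intros continuous_indefinite_integral y2)
  then have ypc: "continuous_on {0..a} (dx a y)"
    by (rule continuous_on_eq) (rule bspec[OF yp, symmetric])
  obtain N where N: "N \<in> null_sets lebesgue"
    "{x \<in> space lebesgue. \<not> (x \<in> {0<..<a} \<longrightarrow> - y2 x + q x * y x = \<rho>\<^sup>2 * y x)} \<subseteq> N"
    using ae unfolding eventually_ae_filter by blast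
  \<comment> \<open>The equation is known only on the open interval, so both endpoints join the
    exceptional set.\<close>
  have neg: "negligible (N \<union> {0, a})" using N(1) negligible_iff_null_sets by auto
  show ?thesis
    unfolding ode_sol_def
  proof (intro conjI ballI yc ypc)
    fix x assume x: "x \<in> {0..a}"
    have "(dx a y has_integral (y x - y 0)) {0..x}"
      using x by (intro fundamental_theorem_of_calculus has_vector_derivative_within_subset[OF der]) auto
    then have "integral {0..x} (dx a y) = y x - y 0" by (rule integral_unique)
    then show "y x = y 0 + integral {0..x} (dx a y)" by (metis add.commute diff_add_cancel)
    have "integral {0..x} y2 = integral {0..x} (\<lambda>t. (q t - \<rho>\<^sup>2) * y t + 0)"
    proof (rule integral_spike[OF neg])
      fix t assume "t \<in> {0..x} - (N \<union> {0, a})"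
      then have "t \<in> {0<..<a}" "t \<notin> N" using x by auto
      then have "- y2 t + q t * y t = \<rho>\<^sup>2 * y t" using N(2) by auto
      then show "(q t - \<rho>\<^sup>2) * y t + 0 = y2 t" by (simp add: algebra_simps)
    qed
    then show "dx a y x = dx a y 0 + integral {0..x} (\<lambda>t. (q t - \<rho>\<^sup>2) * y t + 0)"
      using bspec[OF yp x] by (simp only:)
  qed
qed

lemma sigma_finite_lebesgue: "sigma_finite_measure (lebesgue :: real measure)"
proof
  define A where "A = range (\<lambda>n::nat. {- real n..real n})"
  have "x \<in> \<Union>A" for x :: real
  proof -
    obtain n :: nat where "\<bar>x\<bar> \<le> n" using real_arch_simple by blast
    then show ?thesis by (auto simp: A_def abs_le_iff intro!: exI[of _ n])
  qed
  then have U: "\<Union>A = space lebesgue" by auto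
  show "\<exists>A. countable A \<and> A \<subseteq> sets (lebesgue :: real measure) \<and> \<Union>A = space lebesgue \<and> (\<forall>a\<in>A. emeasure lebesgue a \<noteq> \<infinity>)"
    by (intro exI[of _ A]) (use U in \<open>auto simp: A_def infinity_ennreal_def intro!: fmeasurableD2\<close>)
qed

text \<open>Vanishing on half-lines spreads to Borel sets by a pi-lambda argument, then to Lebesgue
  sets, which differ from Borel sets by null sets. A density whose integrals all vanish is zero
  almost everywhere.\<close>

lemma AE_zero_of_indefinite_integral_zero:
  fixes f :: "real \<Rightarrow> complex"
  assumes f: "f absolutely_integrable_on {0..a}" and a: "a \<ge> 0"
    and zero: "\<And>x. x \<in> {0..a} \<Longrightarrow> integral {0..x} f = 0"
  shows "AE x in lebesgue. x \<in> {0..a} \<longrightarrow> f x = 0"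
proof -
  define F where "F x = indicator {0..a} x *\<^sub>R f x" for x
  have F: "integrable lebesgue F" using f by (simp add: set_integrable_def F_def[abs_def])
  have Fs: "set_integrable lebesgue A F" if "A \<in> sets lebesgue" for A
    unfolding set_integrable_def using integrable_mult_indicator[OF that F] .
  have atMost: "set_lebesgue_integral lebesgue {..x} F = 0" for x
  proof -
    have "set_lebesgue_integral lebesgue {..x} F = set_lebesgue_integral lebesgue {0..min x a} f"
      unfolding set_lebesgue_integral_def F_def
      by (intro Bochner_Integration.integral_cong) (auto simp: indicator_def)
    also have "\<dots> = integral {0..min x a} f"
      by (intro set_lebesgue_integral_eq_integral absolutely_integrable_on_subinterval[OF f]) auto
    also have "\<dots> = 0" by (cases "x \<ge> 0") (use zero[of "min x a"] a in auto)
    finally show ?thesis .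
  qed
  \<comment> \<open>Needed for complements in the induction; \<open>F\<close> lives on
    \<open>{0..a}\<close>, so the half-line up to \<open>a\<close> already gives the full
    integral.\<close>
  have total: "set_lebesgue_integral lebesgue UNIV F = 0"
  proof -
    have "set_lebesgue_integral lebesgue UNIV F = set_lebesgue_integral lebesgue {..a} F"
      unfolding set_lebesgue_integral_def F_def
      by (intro Bochner_Integration.integral_cong) (auto simp: indicator_def)
    then show ?thesis using atMost by simp
  qed
  have borel: "A \<in> sets lebesgue \<and> set_lebesgue_integral lebesgue A F = 0" if "A \<in> sigma_sets UNIV (range (\<lambda>x::real. {..x}))" for A
  proof -
    have "Int_stable (range (\<lambda>x::real. {..x}))"
      by (auto simp: Int_stable_def)
    moreover have "range (\<lambda>x::real. {..x}) \<subseteq> Pow UNIV" by simp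
    ultimately show ?thesis
      using that
    proof (induction rule: sigma_sets_induct_disjoint)
      case (basic A)
      then show ?case using atMost by auto
    next
      case empty
      then show ?case by (simp add: set_lebesgue_integral_def)
    next
      case (compl A)
      have "set_lebesgue_integral lebesgue (A \<union> (UNIV - A)) F
          = set_lebesgue_integral lebesgue A F + set_lebesgue_integral lebesgue (UNIV - A) F"
        using compl by (intro set_integral_Un Fs) auto
      then show ?case using total compl by auto
    next
      case (union A)
      have "set_lebesgue_integral lebesgue (\<Union>i. A i) F = (\<Sum>i. set_lebesgue_integral lebesgue (A i) F)"
        using union by (intro lebesgue_integral_countable_add Fs) (auto simp: disjoint_family_on_def)
      then show ?case using union by auto
    qed
  qed
  have "AE x in lebesgue. F x = 0"
  proof (rule sigma_finite_measure.density_zero[OF sigma_finite_lebesgue F])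
    fix A :: "real set" assume "A \<in> sets lebesgue"
    then obtain S N N' where A: "A = S \<union> N" "N \<subseteq> N'" "N' \<in> null_sets lborel" "S \<in> sets lborel"
      by (rule sets_completionE)
    have "S \<in> sigma_sets UNIV (range (\<lambda>x::real. {..x}))"
      using A(4) borel_eq_atMost[where 'a=real] by (metis sets_lborel sets_measure_of subset_UNIV Pow_UNIV)
    then have S: "S \<in> sets lebesgue" "set_lebesgue_integral lebesgue S F = 0" using borel by auto
    have N': "N' \<in> null_sets lebesgue" using A(3) by (rule null_sets_completionI)
    have "set_lebesgue_integral lebesgue A F = set_lebesgue_integral lebesgue S F"
      unfolding set_lebesgue_integral_def
    proof (rule integral_cong_AE)
      show "AE x in lebesgue. indicat_real A x *\<^sub>R F x = indicat_real S x *\<^sub>R F x"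
        by (rule AE_I'[OF N']) (use A in \<open>auto simp: indicator_def\<close>)
    qed (use Fs[OF \<open>A \<in> sets lebesgue\<close>] Fs[OF S(1)] in \<open>auto simp: set_integrable_def\<close>)
    then show "set_lebesgue_integral lebesgue A F = 0" using S by simp
  qed
  then show ?thesis by eventually_elim (auto simp: F_def)
qed

text \<open>Derivatives within the closed interval make this valid at the endpoint 0 too, where it
  recovers the Robin constants from equality of solutions.\<close>

lemma ode_sol_derivative_eq:
  assumes y: "ode_sol a p g y yp" and z: "ode_sol a p' g' z zp" and a: "a > 0"
    and eq: "\<And>t. t \<in> {0..a} \<Longrightarrow> y t = z t" and x: "x \<in> {0..a}"
  shows "yp x = zp x"
proof -
  have "(z has_vector_derivative yp x) (at x within {0..a})"
    by (rule has_vector_derivative_transform[OF x _ ode_sol_has_derivative[OF y x]]) (use eq in auto)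
  then show ?thesis
    using vector_derivative_unique_within_closed_interval[of 0 a x z] ode_sol_has_derivative[OF z x] a x by simp
qed

subsection \<open>Asymptotics in the spectral parameter\<close>

text \<open>The derivative of \<open>yp + \<omega> * y\<close> is
  \<open>q * y + \<omega> * (yp + \<omega> * y)\<close>, so the exponential leaves only the
  potential term. Replacing \<omega> by its negative covers
  \<open>yp - \<omega> * y\<close>.\<close>

lemma ode_sol_integrating_factor:
  fixes \<omega> :: complex
  assumes q: "q absolutely_integrable_on {0..a}" and y: "ode_sol a (\<lambda>t. q t + \<omega>\<^sup>2) (\<lambda>t. 0) y yp"
    and x: "x \<in> {0..a}"
  shows "(yp x + \<omega> * y x) * exp (- \<omega> * of_real x) =
    (yp 0 + \<omega> * y 0) + integral {0..x} (\<lambda>t. q t * (y t * exp (- \<omega> * of_real t)))"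
proof -
  note cont = ode_solD(1,2)[OF y]
  have p: "(\<lambda>t. q t + \<omega>\<^sup>2) absolutely_integrable_on {0..a}"
    by (rule set_integral_add(1)[OF q absolutely_integrable_continuous_real[OF continuous_on_const]])
  define f where "f t = (q t + \<omega>\<^sup>2) * y t + \<omega> * yp t" for t
  have wyp: "continuous_on {0..a} (\<lambda>t. \<omega> * yp t)" by (intro continuous_intros cont)
  have f1: "(\<lambda>t. (q t + \<omega>\<^sup>2) * y t) absolutely_integrable_on {0..a}"
    by (intro absolutely_integrable_mult_continuous p cont)
  have f2: "(\<lambda>t. \<omega> * yp t) absolutely_integrable_on {0..a}"
    by (rule absolutely_integrable_continuous_real[OF wyp])
  have f: "f absolutely_integrable_on {0..a}" unfolding f_def by (rule set_integral_add(1)[OF f1 f2])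
  have Ff: "yp s + \<omega> * y s = (yp 0 + \<omega> * y 0) + integral {0..s} f" if s: "s \<in> {0..a}" for s
  proof -
    have "(\<lambda>t. (q t + \<omega>\<^sup>2) * y t) integrable_on {0..s}" "(\<lambda>t. \<omega> * yp t) integrable_on {0..s}" "yp integrable_on {0..s}"
      using s by (auto intro!: integrable_on_subinterval[OF absolutely_integrable_on_def[THEN iffD1, THEN conjunct1, OF f1]]
          integrable_on_subinterval[OF integrable_continuous_real[OF wyp]] integrable_on_subinterval[OF integrable_continuous_real[OF cont(2)]])
    then have "integral {0..s} f = integral {0..s} (\<lambda>t. (q t + \<omega>\<^sup>2) * y t) + \<omega> * integral {0..s} yp"
      unfolding f_def by (simp add: integral_add)
    then show ?thesis
      by (subst ode_solD0[OF y s], subst ode_solD(3)[OF y s]) (simp add: algebra_simps)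
  qed
  have ec: "continuous_on {0..a} (\<lambda>t. - \<omega> * exp (- \<omega> * complex_of_real t))" by (intro continuous_intros)
  have E: "exp (- \<omega> * of_real s) = exp (- \<omega> * of_real 0) + integral {0..s} (\<lambda>t. - \<omega> * exp (- \<omega> * of_real t))"
    if s: "s \<in> {0..a}" for s
  proof -
    have "((\<lambda>t. - \<omega> * exp (- \<omega> * of_real t)) has_integral (exp (- \<omega> * of_real s) - exp (- \<omega> * of_real 0))) {0..s}"
    proof (rule fundamental_theorem_of_calculus)
      fix t
      show "((\<lambda>t. exp (- \<omega> * of_real t)) has_vector_derivative - \<omega> * exp (- \<omega> * of_real t)) (at t within {0..s})"
        by (rule has_vector_derivative_real_field) (auto intro!: derivative_eq_intros)
    qed (use s in auto)
    then have "integral {0..s} (\<lambda>t. - \<omega> * exp (- \<omega> * of_real t)) = exp (- \<omega> * of_real s) - exp (- \<omega> * of_real 0)"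
      by (rule integral_unique)
    then show ?thesis by (metis add.commute diff_add_cancel)
  qed
  have "(yp x + \<omega> * y x) * exp (- \<omega> * of_real x) = (yp 0 + \<omega> * y 0) * exp (- \<omega> * of_real 0)
     + integral {0..x} (\<lambda>t. f t * exp (- \<omega> * of_real t) + (- \<omega> * exp (- \<omega> * of_real t)) * (yp t + \<omega> * y t))"
    by (rule product_rule_integral[OF f absolutely_integrable_continuous_real[OF ec] Ff E x])
  also have "(\<lambda>t. f t * exp (- \<omega> * of_real t) + (- \<omega> * exp (- \<omega> * of_real t)) * (yp t + \<omega> * y t))
     = (\<lambda>t. q t * (y t * exp (- \<omega> * of_real t)))"
    by (auto simp: f_def algebra_simps power2_eq_square)
  finally show ?thesis by simp
qed

text \<open>The combinations \<open>yp + \<omega> * y\<close> and \<open>yp - \<omega> * y\<close>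
  determine \<open>2 * \<omega> * y\<close>. At the maximum \<open>m\<close> of
  \<open>norm (y s) * exp (- \<rho> * s)\<close> the potential contributes at most
  \<open>2 * (m * Q)\<close>, which \<open>norm \<omega> \<ge> 2 * Q\<close> absorbs, so
  \<open>m \<le> N\<close>. The constants are uniform in the direction of \<omega>, and the data
  stay free.\<close>

lemma ode_sol_asymptotics:
  fixes \<omega> :: complex
  assumes q: "q absolutely_integrable_on {0..a}" and a: "a \<ge> 0" and Q: "Q = integral {0..a} (\<lambda>t. norm (q t))"
    and y: "ode_sol a (\<lambda>t. q t + \<omega>\<^sup>2) (\<lambda>t. 0) y yp"
    and \<rho>: "\<rho> = Re \<omega>" "\<rho> \<ge> 0" and large: "norm \<omega> \<ge> 2 * Q" "\<omega> \<noteq> 0"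
    and N: "N = (norm (yp 0 + \<omega> * y 0) + norm (yp 0 - \<omega> * y 0)) / norm \<omega>"
    and x: "x \<in> {0..a}"
  shows "norm (y x) \<le> N * exp (\<rho> * x)"
    and "norm ((yp x + \<omega> * y x) * exp (- \<omega> * of_real x) - (yp 0 + \<omega> * y 0)) \<le> Q * N"
    and "norm (yp x - \<omega> * y x) \<le> norm (yp 0 - \<omega> * y 0) * exp (- \<rho> * x) + Q * N * exp (\<rho> * x)"
    and "norm (yp x) \<le> norm \<omega> * N * exp (\<rho> * x)"
proof -
  note cont = ode_solD(1,2)[OF y]
  have Q0: "Q \<ge> 0" unfolding Q by (rule integral_nonneg) (use q in \<open>auto simp: absolutely_integrable_on_def\<close>)
  have "compact ((\<lambda>s. norm (y s) * exp (- \<rho> * s)) ` {0..a})"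
    by (intro compact_continuous_image continuous_intros cont) auto
  then obtain s0 where s0: "s0 \<in> {0..a}"
    and s0max: "\<And>s. s \<in> {0..a} \<Longrightarrow> norm (y s) * exp (- \<rho> * s) \<le> norm (y s0) * exp (- \<rho> * s0)"
    using compact_attains_sup[of "(\<lambda>s. norm (y s) * exp (- \<rho> * s)) ` {0..a}"] a by fastforce
  define m where "m = norm (y s0) * exp (- \<rho> * s0)"
  have m0: "m \<ge> 0" by (simp add: m_def)
  have ym: "norm (y s) \<le> m * exp (\<rho> * s)" if "s \<in> {0..a}" for s
    using s0max[OF that] by (simp add: m_def exp_minus field_simps)
  have nexp: "norm (exp (- \<omega> * of_real t)) = exp (- \<rho> * t)" "norm (exp (\<omega> * of_real t)) = exp (\<rho> * t)" for t
    by (simp_all add: \<rho>)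
  define u0 v0 where "u0 = yp 0 + \<omega> * y 0" and "v0 = yp 0 - \<omega> * y 0"
  have u: "norm ((yp s + \<omega> * y s) * exp (- \<omega> * of_real s) - u0) \<le> m * Q" if s: "s \<in> {0..a}" for s
  proof -
    have "norm (integral {0..s} (\<lambda>t. q t * (y t * exp (- \<omega> * of_real t)))) \<le> m * Q"
      unfolding Q
    proof (rule norm_integral_mult_le[OF q _ _ s m0])
      show "continuous_on {0..a} (\<lambda>t. y t * exp (- \<omega> * of_real t))" by (intro continuous_intros cont)
      fix t assume "t \<in> {0..s}"
      then have "norm (y t) * exp (- \<rho> * t) \<le> m" using s0max[of t] s by (simp add: m_def)
      then show "norm (y t * exp (- \<omega> * of_real t)) \<le> m" unfolding norm_mult nexp .
    qed
    then show ?thesis using ode_sol_integrating_factor[OF q y s] by (simp add: u0_def)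
  qed
  have u': "norm (yp s + \<omega> * y s) \<le> (norm u0 + m * Q) * exp (\<rho> * s)" if s: "s \<in> {0..a}" for s
  proof -
    have "norm ((yp s + \<omega> * y s) * exp (- \<omega> * of_real s)) \<le> norm u0 + m * Q"
      using u[OF s] norm_triangle_ineq2[of "(yp s + \<omega> * y s) * exp (- \<omega> * of_real s)" u0] by linarith
    then have "norm (yp s + \<omega> * y s) * exp (- \<rho> * s) \<le> norm u0 + m * Q" unfolding norm_mult nexp .
    then have "norm (yp s + \<omega> * y s) * exp (- \<rho> * s) * exp (\<rho> * s) \<le> (norm u0 + m * Q) * exp (\<rho> * s)"
      by (rule mult_right_mono) simp
    moreover have "norm (yp s + \<omega> * y s) * exp (- \<rho> * s) * exp (\<rho> * s) = norm (yp s + \<omega> * y s)"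
      unfolding mult.assoc exp_add[symmetric] by simp
    ultimately show ?thesis by metis
  qed
  have v: "norm (yp s - \<omega> * y s) \<le> norm v0 * exp (- \<rho> * s) + m * Q * exp (\<rho> * s)" if s: "s \<in> {0..a}" for s
  proof -
    have y': "ode_sol a (\<lambda>t. q t + (- \<omega>)\<^sup>2) (\<lambda>t. 0) y yp" using y by simp
    \<comment> \<open>For \<open>- \<omega>\<close> the integrating factor adds to the growth of
      \<open>y\<close> instead of compensating it; the later multiplication by
      \<open>exp (- \<rho> * s)\<close> restores the order \<open>exp (\<rho> * s)\<close>.\<close>
    have "norm (integral {0..s} (\<lambda>t. q t * (y t * exp (- (- \<omega>) * of_real t)))) \<le> (m * exp (2 * \<rho> * s)) * Q"
      unfolding Q
    proof (rule norm_integral_mult_le[OF q _ _ s])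
      show "continuous_on {0..a} (\<lambda>t. y t * exp (- (- \<omega>) * of_real t))" by (intro continuous_intros cont)
      fix t assume t: "t \<in> {0..s}"
      then have "norm (y t) * exp (\<rho> * t) \<le> (m * exp (\<rho> * t)) * exp (\<rho> * t)" using ym[of t] s by (intro mult_right_mono) auto
      also have "\<dots> = m * exp (2 * \<rho> * t)" by (simp add: exp_add[symmetric])
      also have "\<dots> \<le> m * exp (2 * \<rho> * s)" using t m0 \<rho>(2) by (intro mult_left_mono) (auto intro: mult_left_mono)
      finally show "norm (y t * exp (- (- \<omega>) * of_real t)) \<le> m * exp (2 * \<rho> * s)" unfolding norm_mult minus_minus nexp .
    qed (use m0 in auto)
    moreover have "(yp s - \<omega> * y s) * exp (\<omega> * of_real s) = v0 + integral {0..s} (\<lambda>t. q t * (y t * exp (- (- \<omega>) * of_real t)))"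
      using ode_sol_integrating_factor[OF q y' s] by (simp add: v0_def)
    ultimately have "norm ((yp s - \<omega> * y s) * exp (\<omega> * of_real s)) \<le> norm v0 + m * exp (2 * \<rho> * s) * Q"
      using norm_triangle_ineq[of v0 "integral {0..s} (\<lambda>t. q t * (y t * exp (- (- \<omega>) * of_real t)))"] by simp
    then have "norm (yp s - \<omega> * y s) * exp (\<rho> * s) \<le> norm v0 + m * exp (2 * \<rho> * s) * Q" unfolding norm_mult nexp .
    then have "norm (yp s - \<omega> * y s) * exp (\<rho> * s) * exp (- \<rho> * s) \<le> (norm v0 + m * exp (2 * \<rho> * s) * Q) * exp (- \<rho> * s)"
      by (rule mult_right_mono) simp
    also have "norm (yp s - \<omega> * y s) * exp (\<rho> * s) * exp (- \<rho> * s) = norm (yp s - \<omega> * y s)"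
      unfolding mult.assoc exp_add[symmetric] by simp
    also have "(norm v0 + m * exp (2 * \<rho> * s) * Q) * exp (- \<rho> * s) = norm v0 * exp (- \<rho> * s) + m * Q * (exp (2 * \<rho> * s) * exp (- \<rho> * s))" by (simp add: algebra_simps)
    also have "exp (2 * \<rho> * s) * exp (- \<rho> * s) = exp (\<rho> * s)" by (simp add: exp_add[symmetric])
    finally show ?thesis .
  qed
  have y2: "2 * norm \<omega> * norm (y s) \<le> (norm u0 + norm v0 + 2 * (m * Q)) * exp (\<rho> * s)"
    and yp2: "2 * norm (yp s) \<le> (norm u0 + norm v0 + 2 * (m * Q)) * exp (\<rho> * s)" if s: "s \<in> {0..a}" for s
  proof -
    have "exp (- \<rho> * s) \<le> exp (\<rho> * s)" using s \<rho>(2) by simp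
    then have "norm v0 * exp (- \<rho> * s) \<le> norm v0 * exp (\<rho> * s)" by (intro mult_left_mono) auto
    then have uv: "norm (yp s + \<omega> * y s) + norm (yp s - \<omega> * y s) \<le> (norm u0 + norm v0 + 2 * (m * Q)) * exp (\<rho> * s)"
      using u'[OF s] v[OF s] by (simp add: algebra_simps)
    have "2 * norm \<omega> * norm (y s) = norm ((yp s + \<omega> * y s) - (yp s - \<omega> * y s))" by (simp add: norm_mult[symmetric])
    then show "2 * norm \<omega> * norm (y s) \<le> (norm u0 + norm v0 + 2 * (m * Q)) * exp (\<rho> * s)"
      using uv norm_triangle_ineq4[of "yp s + \<omega> * y s" "yp s - \<omega> * y s"] by linarith
    have "2 * norm (yp s) = norm ((yp s + \<omega> * y s) + (yp s - \<omega> * y s))"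
      by (simp add: mult_2[symmetric] norm_mult)
    then show "2 * norm (yp s) \<le> (norm u0 + norm v0 + 2 * (m * Q)) * exp (\<rho> * s)"
      using uv norm_triangle_ineq[of "yp s + \<omega> * y s" "yp s - \<omega> * y s"] by linarith
  qed
  have \<omega>0: "norm \<omega> > 0" using large by simp
  have ys0: "norm (y s0) = m * exp (\<rho> * s0)" by (simp add: m_def exp_minus)
  have "(2 * norm \<omega> * m) * exp (\<rho> * s0) \<le> (norm u0 + norm v0 + 2 * (m * Q)) * exp (\<rho> * s0)"
    using y2[OF s0] unfolding ys0 by (simp add: mult_ac)
  then have "2 * norm \<omega> * m \<le> norm u0 + norm v0 + 2 * (m * Q)" by (rule mult_right_le_imp_le) simp
  moreover have mQ: "2 * (m * Q) \<le> norm \<omega> * m" using mult_right_mono[OF large(1) m0] by (simp add: mult_ac)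
  ultimately have "norm \<omega> * m \<le> norm u0 + norm v0" by linarith
  then have mN: "m \<le> N" unfolding N u0_def[symmetric] v0_def[symmetric] using \<omega>0 by (simp add: field_simps)
  have N\<omega>: "norm \<omega> * N = norm u0 + norm v0" using \<omega>0 by (simp add: N u0_def v0_def)
  have mQN: "m * Q \<le> Q * N" using mult_left_mono[OF mN Q0] by (simp add: mult.commute)
  show "norm (y x) \<le> N * exp (\<rho> * x)"
    by (rule order_trans[OF ym[OF x] mult_right_mono[OF mN]]) simp
  show "norm ((yp x + \<omega> * y x) * exp (- \<omega> * of_real x) - (yp 0 + \<omega> * y 0)) \<le> Q * N"
    using u[OF x] mQN by (simp add: u0_def)
  show "norm (yp x - \<omega> * y x) \<le> norm (yp 0 - \<omega> * y 0) * exp (- \<rho> * x) + Q * N * exp (\<rho> * x)"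
    using v[OF x] mult_right_mono[OF mQN, of "exp (\<rho> * x)"] by (simp add: v0_def)
  have "2 * (m * Q) \<le> norm \<omega> * N" using mQ mult_left_mono[OF mN, of "norm \<omega>"] by simp
  then have "(norm u0 + norm v0 + 2 * (m * Q)) * exp (\<rho> * x) \<le> (2 * (norm \<omega> * N)) * exp (\<rho> * x)"
    unfolding N\<omega> by (intro mult_right_mono) auto
  then show "norm (yp x) \<le> norm \<omega> * N * exp (\<rho> * x)" using yp2[OF x] by linarith
qed

lemma ode_sol_family_exp_type:
  assumes q: "q absolutely_integrable_on {0..a}" and a: "a \<ge> 0"
    and sol: "\<And>l. ode_sol a (\<lambda>t. q t - l\<^sup>2) (\<lambda>t. 0) (y l) (yp l)"
    and A: "(\<lambda>l. y l 0) holomorphic_on UNIV" "exp_type (\<lambda>l. y l 0)"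
    and B: "(\<lambda>l. yp l 0) holomorphic_on UNIV" "exp_type (\<lambda>l. yp l 0)"
    and x: "x \<in> {0..a}"
  shows "exp_type (\<lambda>l. y l x)" "exp_type (\<lambda>l. yp l x)"
proof -
  define Q where "Q = integral {0..a} (\<lambda>t. norm (q t))"
  obtain C1 D1 where 1: "C1 \<ge> 0" "D1 \<ge> 0" "\<And>l. norm (y l 0) \<le> exp (C1 + D1 * cmod l)" using exp_typeE[OF A(2)] by metis
  obtain C2 D2 where 2: "C2 \<ge> 0" "D2 \<ge> 0" "\<And>l. norm (yp l 0) \<le> exp (C2 + D2 * cmod l)" using exp_typeE[OF B(2)] by metis
  define C D where "C = C1 + C2" and "D = D1 + D2"
  \<comment> \<open>In the rate, \<open>D\<close> comes from the data and \<open>a\<close> from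
    \<open>exp (Re \<omega> * x)\<close>; the summands 1 and 2 come from
    \<open>2 * (1 + cmod l) \<le> exp 2 * exp (cmod l)\<close>.\<close>
  have bd: "norm (y l x) \<le> exp ((C + 2) + (D + a + 1) * cmod l) \<and> norm (yp l x) \<le> exp ((C + 2) + (D + a + 1) * cmod l)"
    if l: "cmod l \<ge> max 1 (2 * Q)" for l
  proof -
    define \<omega> where "\<omega> = (if Im l \<le> 0 then \<i> * l else - \<i> * l)"
    have \<omega>: "\<omega>\<^sup>2 = - l\<^sup>2" "Re \<omega> \<ge> 0" "norm \<omega> = norm l" "Re \<omega> \<le> norm l"
      using abs_Im_le_cmod[of l] by (auto simp: \<omega>_def power_mult_distrib norm_mult)
    have s: "ode_sol a (\<lambda>t. q t + \<omega>\<^sup>2) (\<lambda>t. 0) (y l) (yp l)" using sol[of l] \<omega>(1) by simp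
    define N where "N = (norm (yp l 0 + \<omega> * y l 0) + norm (yp l 0 - \<omega> * y l 0)) / norm \<omega>"
    have \<omega>1: "norm \<omega> \<ge> 1" "norm \<omega> \<ge> 2 * Q" "\<omega> \<noteq> 0" using l \<omega>(3) by auto
    note as = ode_sol_asymptotics[OF q a Q_def s refl \<omega>(2) \<omega>1(2,3) N_def x]
    define X where "X = exp (C + D * cmod l)"
    have "C1 + D1 * cmod l \<le> C + D * cmod l" "C2 + D2 * cmod l \<le> C + D * cmod l"
      using 1 2 by (auto simp: C_def D_def distrib_right)
    then have X: "norm (y l 0) \<le> X" "norm (yp l 0) \<le> X" "X \<ge> 0"
      using 1(3)[of l] 2(3)[of l] unfolding X_def by (auto intro: order_trans)
    have N1: "norm \<omega> * N \<le> 2 * norm (yp l 0) + 2 * (norm \<omega> * norm (y l 0))"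
    proof -
      have "norm \<omega> * N = norm (yp l 0 + \<omega> * y l 0) + norm (yp l 0 - \<omega> * y l 0)" using \<omega>1 by (simp add: N_def)
      then show ?thesis
        using norm_triangle_ineq[of "yp l 0" "\<omega> * y l 0"] norm_triangle_ineq4[of "yp l 0" "\<omega> * y l 0"] by (simp add: norm_mult)
    qed
    also have "\<dots> \<le> 2 * X + 2 * (norm \<omega> * X)" using X by (intro add_mono mult_left_mono) auto
    also have "\<dots> = 2 * (1 + cmod l) * X" using \<omega>(3) by (simp add: algebra_simps)
    also have "\<dots> \<le> exp 2 * exp (cmod l) * X"
    proof (intro mult_right_mono mult_mono)
      show "(2::real) \<le> exp 2" using exp_ge_add_one_self[of 2] by linarith
    qed (use X exp_ge_add_one_self[of "cmod l"] in auto)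
    finally have \<omega>N: "norm \<omega> * N \<le> exp 2 * exp (cmod l) * X" .
    have N0: "N \<ge> 0" by (simp add: N_def)
    have NN: "N \<le> norm \<omega> * N" using mult_right_mono[OF \<omega>1(1) N0] by simp
    have ex: "exp (Re \<omega> * x) \<le> exp (a * cmod l)"
    proof -
      have "Re \<omega> * x \<le> cmod l * a" using \<omega> x by (intro mult_mono) auto
      then show ?thesis by (simp add: mult.commute)
    qed
    have "norm \<omega> * N * exp (Re \<omega> * x) \<le> (exp 2 * exp (cmod l) * X) * exp (a * cmod l)"
      by (rule mult_mono[OF \<omega>N ex]) (use X in auto)
    also have "\<dots> = exp ((C + 2) + (D + a + 1) * cmod l)" by (simp add: X_def exp_add[symmetric] algebra_simps)
    finally have fin: "norm \<omega> * N * exp (Re \<omega> * x) \<le> exp ((C + 2) + (D + a + 1) * cmod l)" .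
    moreover have "N * exp (Re \<omega> * x) \<le> norm \<omega> * N * exp (Re \<omega> * x)" using NN by (intro mult_right_mono) auto
    ultimately show ?thesis using as(1,4) by linarith
  qed
  note hol = ode_sol_family_holomorphic[OF q a sol A(1) B(1) x]
  show "exp_type (\<lambda>l. y l x)"
    by (rule exp_type_outside_ball[OF holomorphic_on_imp_continuous_on[OF hol(1)]]) (use bd in blast)
  show "exp_type (\<lambda>l. yp l x)"
    by (rule exp_type_outside_ball[OF holomorphic_on_imp_continuous_on[OF hol(2)]]) (use bd in blast)
qed

text \<open>\<open>yp \<tau> 0\<close> may grow linearly in \<tau>, as it does for a boundary
  condition linear in the spectral parameter. The limits are those of the free solution
  \<open>A * cosh (\<tau> * x) + B * sinh (\<tau> * x)\<close>; the potential enters at order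
  \<open>Q / \<tau>\<close>.\<close>

lemma ode_sol_ray_limits:
  assumes q: "q absolutely_integrable_on {0..a}"
    and sol: "\<And>\<tau>::real. ode_sol a (\<lambda>t. q t + (of_real \<tau>)\<^sup>2) (\<lambda>t. 0) (y \<tau>) (yp \<tau>)"
    and A: "((\<lambda>\<tau>. y \<tau> 0) \<longlongrightarrow> A) at_top" and B: "((\<lambda>\<tau>. yp \<tau> 0 / of_real \<tau>) \<longlongrightarrow> B) at_top"
    and x: "0 < x" "x \<le> a"
  shows "((\<lambda>\<tau>. y \<tau> x * exp (- of_real \<tau> * of_real x)) \<longlongrightarrow> (A + B) / 2) at_top"
    and "((\<lambda>\<tau>. yp \<tau> x / of_real \<tau> * exp (- of_real \<tau> * of_real x)) \<longlongrightarrow> (A + B) / 2) at_top"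
proof -
  define Q where "Q = integral {0..a} (\<lambda>t. norm (q t))"
  define e where "e \<tau> = exp (- of_real \<tau> * complex_of_real x)" for \<tau> :: real
  define u0 where "u0 \<tau> = yp \<tau> 0 / of_real \<tau> + y \<tau> 0" for \<tau> :: real
  define v0 where "v0 \<tau> = yp \<tau> 0 / of_real \<tau> - y \<tau> 0" for \<tau> :: real
  define u where "u \<tau> = (yp \<tau> x / of_real \<tau> + y \<tau> x) * e \<tau>" for \<tau> :: real
  define v where "v \<tau> = (yp \<tau> x / of_real \<tau> - y \<tau> x) * e \<tau>" for \<tau> :: real
  define N where "N \<tau> = norm (u0 \<tau>) + norm (v0 \<tau>)" for \<tau>
  have u0: "(u0 \<longlongrightarrow> B + A) at_top" unfolding u0_def by (intro tendsto_intros A B)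
  have v0: "(v0 \<longlongrightarrow> B - A) at_top" unfolding v0_def by (intro tendsto_intros A B)
  have N: "(N \<longlongrightarrow> norm (B + A) + norm (B - A)) at_top" unfolding N_def by (intro tendsto_intros u0 v0)
  have inv: "((\<lambda>\<tau>::real. Q / \<tau>) \<longlongrightarrow> 0) at_top" by real_asymp
  \<comment> \<open>Here \<open>x > 0\<close> matters: the decaying exponential has to vanish
    against the growing one.\<close>
  have ex: "((\<lambda>\<tau>::real. exp (- 2 * \<tau> * x)) \<longlongrightarrow> 0) at_top" using x by real_asymp
  have QN: "((\<lambda>\<tau>. Q / \<tau> * N \<tau>) \<longlongrightarrow> 0) at_top" using tendsto_mult[OF inv N] by simp
  have ev: "\<forall>\<^sub>F \<tau> in at_top. norm (u \<tau> - u0 \<tau>) \<le> Q / \<tau> * N \<tau> \<and> norm (v \<tau>) \<le> norm (v0 \<tau>) * exp (- 2 * \<tau> * x) + Q / \<tau> * N \<tau>"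
    using eventually_gt_at_top[of "max 0 (2 * Q)"]
  proof eventually_elim
    case (elim \<tau>)
    define \<omega> where "\<omega> = complex_of_real \<tau>"
    have \<tau>: "\<tau> > 0" "norm \<omega> = \<tau>" "\<omega> \<noteq> 0" "Re \<omega> = \<tau>" using elim by (auto simp: \<omega>_def)
    have xa: "x \<in> {0..a}" using x by simp
    have eqs: "yp \<tau> 0 + \<omega> * y \<tau> 0 = \<omega> * u0 \<tau>" "yp \<tau> 0 - \<omega> * y \<tau> 0 = \<omega> * v0 \<tau>"
      "(yp \<tau> x + \<omega> * y \<tau> x) * exp (- \<omega> * of_real x) = \<omega> * u \<tau>"
      "(yp \<tau> x - \<omega> * y \<tau> x) * exp (- \<omega> * of_real x) = \<omega> * v \<tau>"
      using \<tau>(3) by (simp_all add: u0_def v0_def u_def v_def e_def \<omega>_def field_simps)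
    have NN: "N \<tau> = (norm (yp \<tau> 0 + \<omega> * y \<tau> 0) + norm (yp \<tau> 0 - \<omega> * y \<tau> 0)) / norm \<omega>"
      unfolding eqs N_def using \<tau> by (simp add: norm_mult field_simps)
    note as = ode_sol_asymptotics[OF q _ Q_def sol[of \<tau>, folded \<omega>_def] \<tau>(4)[symmetric] _ _ \<tau>(3) NN xa]
    have "norm (\<omega> * u \<tau> - \<omega> * u0 \<tau>) \<le> Q * N \<tau>"
      using as(2) elim \<tau> x unfolding eqs by simp
    then have 1: "\<tau> * norm (u \<tau> - u0 \<tau>) \<le> Q * N \<tau>" using \<tau> by (simp add: right_diff_distrib[symmetric] norm_mult)
    have "norm (yp \<tau> x - \<omega> * y \<tau> x) \<le> \<tau> * norm (v0 \<tau>) * exp (- \<tau> * x) + Q * N \<tau> * exp (\<tau> * x)"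
      using as(3) elim \<tau> x unfolding eqs(2) by (simp add: norm_mult)
    then have "norm (yp \<tau> x - \<omega> * y \<tau> x) * exp (- \<tau> * x) \<le> (\<tau> * norm (v0 \<tau>) * exp (- \<tau> * x) + Q * N \<tau> * exp (\<tau> * x)) * exp (- \<tau> * x)"
      by (intro mult_right_mono) auto
    also have "\<dots> = \<tau> * norm (v0 \<tau>) * (exp (- \<tau> * x) * exp (- \<tau> * x)) + Q * N \<tau> * (exp (\<tau> * x) * exp (- \<tau> * x))"
      by (simp add: algebra_simps)
    also have "\<dots> = \<tau> * norm (v0 \<tau>) * exp (- 2 * \<tau> * x) + Q * N \<tau>"
      by (simp add: exp_add[symmetric])
    also have "norm (yp \<tau> x - \<omega> * y \<tau> x) * exp (- \<tau> * x) = norm (\<omega> * v \<tau>)"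
      unfolding eqs(4)[symmetric] norm_mult[of _ "exp _"] by (simp add: \<omega>_def)
    finally have 2: "\<tau> * norm (v \<tau>) \<le> \<tau> * norm (v0 \<tau>) * exp (- 2 * \<tau> * x) + Q * N \<tau>" using \<tau> by (simp add: norm_mult)
    show ?case
    proof
      show "norm (u \<tau> - u0 \<tau>) \<le> Q / \<tau> * N \<tau>" using 1 \<tau> by (simp add: field_simps)
      have "\<tau> * norm (v \<tau>) \<le> \<tau> * (norm (v0 \<tau>) * exp (- 2 * \<tau> * x) + Q / \<tau> * N \<tau>)"
        using 2 \<tau> by (simp add: algebra_simps)
      then show "norm (v \<tau>) \<le> norm (v0 \<tau>) * exp (- 2 * \<tau> * x) + Q / \<tau> * N \<tau>" using \<tau> by simp
    qed
  qed
  have "((\<lambda>\<tau>. u \<tau> - u0 \<tau>) \<longlongrightarrow> 0) at_top"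
    by (rule Lim_null_comparison[OF _ QN]) (use ev in \<open>auto elim: eventually_mono\<close>)
  from tendsto_add[OF this u0] have u: "(u \<longlongrightarrow> B + A) at_top" by simp
  have "((\<lambda>\<tau>. norm (v0 \<tau>) * exp (- 2 * \<tau> * x) + Q / \<tau> * N \<tau>) \<longlongrightarrow> norm (B - A) * 0 + 0) at_top"
    by (intro tendsto_intros v0 ex QN)
  then have vv: "((\<lambda>\<tau>. norm (v0 \<tau>) * exp (- 2 * \<tau> * x) + Q / \<tau> * N \<tau>) \<longlongrightarrow> 0) at_top" by simp
  have v: "(v \<longlongrightarrow> 0) at_top"
    by (rule Lim_null_comparison[OF _ vv]) (use ev in \<open>auto elim: eventually_mono\<close>)
  have "((\<lambda>\<tau>. (u \<tau> - v \<tau>) / 2) \<longlongrightarrow> (B + A - 0) / 2) at_top" by (intro tendsto_intros u v) simp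
  moreover have "(u \<tau> - v \<tau>) / 2 = y \<tau> x * e \<tau>" for \<tau> by (simp add: u_def v_def algebra_simps)
  ultimately show "((\<lambda>\<tau>. y \<tau> x * exp (- of_real \<tau> * of_real x)) \<longlongrightarrow> (A + B) / 2) at_top"
    by (simp add: e_def add.commute)
  have "((\<lambda>\<tau>. (u \<tau> + v \<tau>) / 2) \<longlongrightarrow> (B + A + 0) / 2) at_top" by (intro tendsto_intros u v) simp
  moreover have "(u \<tau> + v \<tau>) / 2 = yp \<tau> x / of_real \<tau> * e \<tau>" for \<tau> by (simp add: u_def v_def algebra_simps)
  ultimately show "((\<lambda>\<tau>. yp \<tau> x / of_real \<tau> * exp (- of_real \<tau> * of_real x)) \<longlongrightarrow> (A + B) / 2) at_top"
    by (simp add: e_def add.commute)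
qed

subsection \<open>Uniqueness\<close>

lemma entire_mult_eq_zero:
  fixes f g :: "complex \<Rightarrow> complex"
  assumes f: "f holomorphic_on UNIV" and g: "g holomorphic_on UNIV"
    and fg: "\<And>z. f z * g z = 0" and g0: "g z0 \<noteq> 0"
  shows "f z = 0"
proof (rule analytic_continuation_open[of "{z. g z \<noteq> 0}" UNIV f "\<lambda>_. 0"])
  show "open {z. g z \<noteq> 0}"
    using holomorphic_on_imp_continuous_on[OF g] by (intro open_Collect_neq continuous_intros) auto
qed (use assms in auto)

text \<open>Picks the square root of \<open>- l\<^sup>2\<close> in the closed right half-plane,
  where \<open>ode_sol_asymptotics\<close> applies.\<close>

lemma growth_exponent:
  fixes l :: complex
  obtains \<omega> where "\<omega>\<^sup>2 = - l\<^sup>2" "Re \<omega> = \<bar>Im l\<bar>" "norm \<omega> = norm l"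
proof (cases "Im l \<le> 0")
  case True
  then show ?thesis by (intro that[of "\<i> * l"]) (auto simp: power_mult_distrib norm_mult)
next
  case False
  then show ?thesis by (intro that[of "- \<i> * l"]) (auto simp: power_mult_distrib norm_mult)
qed

lemma dirichlet_family_upper_bound:
  assumes q: "q absolutely_integrable_on {0..a}" and a: "a > 0"
    and sol: "\<And>l. ode_sol a (\<lambda>t. q t - l\<^sup>2) (\<lambda>t. 0) (y l) (yp l)" "\<And>l. y l 0 = 0" "\<And>l. yp l 0 = 1"
  obtains R where "\<And>l x. cmod l \<ge> R \<Longrightarrow> x \<in> {0..a} \<Longrightarrow> cmod (y l x) \<le> 2 / cmod l * exp (\<bar>Im l\<bar> * x)"
proof -
  define Q where "Q = integral {0..a} (\<lambda>t. norm (q t))"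
  \<comment> \<open>With data 0 and 1 the quantity \<open>N\<close> is \<open>2 / cmod l\<close>;
    the extra 1 keeps \<open>l\<close> away from 0.\<close>
  show ?thesis
  proof (rule that[of "2 * Q + 1"])
    fix l x assume l: "cmod l \<ge> 2 * Q + 1" and x: "x \<in> {0..a}"
    have Q0: "Q \<ge> 0" unfolding Q_def by (rule integral_nonneg) (use q in \<open>auto simp: absolutely_integrable_on_def\<close>)
    obtain \<omega> where \<omega>: "\<omega>\<^sup>2 = - l\<^sup>2" "Re \<omega> = \<bar>Im l\<bar>" "norm \<omega> = norm l" by (rule growth_exponent)
    have s: "ode_sol a (\<lambda>t. q t + \<omega>\<^sup>2) (\<lambda>t. 0) (y l) (yp l)" using sol(1)[of l] by (simp add: \<omega>)
    have "cmod \<omega> \<ge> 2 * Q" "\<omega> \<noteq> 0" using l Q0 \<omega>(3) by auto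
    from ode_sol_asymptotics(1)[OF q _ Q_def s \<omega>(2)[symmetric] _ this refl x] a
    show "cmod (y l x) \<le> 2 / cmod l * exp (\<bar>Im l\<bar> * x)" by (simp add: sol \<omega>)
  qed
qed

text \<open>In the sector \<open>cmod l \<le> 3 * \<bar>Im l\<bar>\<close>, so for large
  \<open>l\<close> the exponential \<open>exp (\<bar>Im l\<bar> * a)\<close> dominates its
  reciprocal and no cancellation can occur at \<open>a\<close>.\<close>

lemma robin_family_bounds:
  assumes q: "q absolutely_integrable_on {0..a}" and a: "a > 0"
    and sol: "\<And>l. ode_sol a (\<lambda>t. q t - l\<^sup>2) (\<lambda>t. 0) (y l) (yp l)" "\<And>l. y l 0 = 1" "\<And>l. yp l 0 = b"
  obtains R where "R > 0"
    "\<And>l x. cmod l \<ge> R \<Longrightarrow> x \<in> {0..a} \<Longrightarrow> cmod (y l x) \<le> 3 * exp (\<bar>Im l\<bar> * x)"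
    "\<And>l. cmod l \<ge> R \<Longrightarrow> \<bar>Re l\<bar> \<le> 2 * \<bar>Im l\<bar> \<Longrightarrow> cmod (y l a) \<ge> exp (\<bar>Im l\<bar> * a) / 8"
proof -
  define Q where "Q = integral {0..a} (\<lambda>t. norm (q t))"
  have Q0: "Q \<ge> 0" unfolding Q_def by (rule integral_nonneg) (use q in \<open>auto simp: absolutely_integrable_on_def\<close>)
  \<comment> \<open>\<open>8 * cmod b\<close> gives \<open>cmod b \<le> W / 8\<close> and
    \<open>N \<le> 9 / 4\<close>; \<open>36 * Q\<close> then gives
    \<open>Q * N \<le> W / 16\<close>; \<open>12 / a\<close> gives \<open>\<rho> * a \<ge> 4\<close>
    in the sector, hence \<open>exp (- \<rho> * a) \<le> exp (\<rho> * a) / 8\<close>.\<close>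
  define R where "R = 1 + 36 * Q + 8 * cmod b + 12 / a"
  have R: "R \<ge> 1" "R \<ge> 36 * Q" "R \<ge> 8 * cmod b" "R \<ge> 12 / a"
    using Q0 a by (auto simp: R_def)
  have "(\<forall>x\<in>{0..a}. cmod (y l x) \<le> 3 * exp (\<bar>Im l\<bar> * x)) \<and>
      (\<bar>Re l\<bar> \<le> 2 * \<bar>Im l\<bar> \<longrightarrow> cmod (y l a) \<ge> exp (\<bar>Im l\<bar> * a) / 8)" if l: "cmod l \<ge> R" for l
  proof -
    obtain \<omega> where \<omega>: "\<omega>\<^sup>2 = - l\<^sup>2" "Re \<omega> = \<bar>Im l\<bar>" "norm \<omega> = norm l" by (rule growth_exponent)
    define W where "W = cmod l"
    define \<rho> where "\<rho> = \<bar>Im l\<bar>"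
    define N where "N = (cmod (yp l 0 + \<omega> * y l 0) + cmod (yp l 0 - \<omega> * y l 0)) / cmod \<omega>"
    have W: "W \<ge> R" "W > 0" "cmod \<omega> = W" using l R \<omega>(3) by (auto simp: W_def)
    have s: "ode_sol a (\<lambda>t. q t + \<omega>\<^sup>2) (\<lambda>t. 0) (y l) (yp l)" using sol(1)[of l] by (simp add: \<omega>)
    have "cmod \<omega> \<ge> 2 * Q" "\<omega> \<noteq> 0" using W R Q0 by auto
    note as = ode_sol_asymptotics[OF q less_imp_le[OF a] Q_def s \<omega>(2)[folded \<rho>_def, symmetric] _ this N_def]
    have bW: "cmod b \<le> W / 8" using R(3) W by simp
    have N1: "N \<le> 9 / 4"
    proof -
      have "cmod (b + \<omega>) + cmod (b - \<omega>) \<le> 2 * cmod b + 2 * W"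
        using norm_triangle_ineq[of b \<omega>] norm_triangle_ineq4[of b \<omega>] W(3) by simp
      also have "\<dots> \<le> 9 / 4 * W" using bW by simp
      finally show ?thesis using W unfolding N_def sol by (subst pos_divide_le_eq) auto
    qed
    have up: "cmod (y l x) \<le> 3 * exp (\<rho> * x)" if x: "x \<in> {0..a}" for x
    proof -
      have "cmod (y l x) \<le> N * exp (\<rho> * x)" using as(1)[OF _ x] by (simp add: \<rho>_def)
      also have "\<dots> \<le> 3 * exp (\<rho> * x)" using N1 by (intro mult_right_mono) auto
      finally show ?thesis .
    qed
    have low: "exp (\<rho> * a) / 8 \<le> cmod (y l a)" if sec: "\<bar>Re l\<bar> \<le> 2 * \<rho>"
    proof -
      have aa: "a \<in> {0..a}" using a by simp
      have QN: "Q * N \<le> W / 16"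
      proof -
        have "Q * N \<le> Q * (9 / 4)" using N1 Q0 by (intro mult_left_mono) auto
        then show ?thesis using R(2) W by simp
      qed
      have "W \<le> 3 * \<rho>" using cmod_le[of l] sec by (simp add: W_def \<rho>_def)
      then have "12 / a \<le> 3 * \<rho>" using R(4) W by simp
      then have "4 \<le> \<rho> * a" using a by (simp add: field_simps)
      then have 8: "8 \<le> exp (2 * (\<rho> * a))" using exp_ge_add_one_self[of "2 * (\<rho> * a)"] by linarith
      have "8 * exp (- \<rho> * a) \<le> exp (2 * (\<rho> * a)) * exp (- \<rho> * a)" by (rule mult_right_mono[OF 8]) simp
      also have "\<dots> = exp (\<rho> * a)" by (simp add: exp_add[symmetric])
      finally have e2: "exp (- \<rho> * a) \<le> exp (\<rho> * a) / 8" by simp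
      have u0: "cmod (b + \<omega>) \<ge> 7 / 8 * W"
        using norm_triangle_ineq4[of "b + \<omega>" b] W(3) bW by simp
      have v0: "cmod (b - \<omega>) \<le> 9 / 8 * W"
        using norm_triangle_ineq4[of b \<omega>] W(3) bW by simp
      have nexp: "cmod (exp (- \<omega> * of_real a)) = exp (- \<rho> * a)" by (simp add: \<omega> \<rho>_def)
      have "cmod ((yp l a + \<omega> * y l a) * exp (- \<omega> * of_real a) - (b + \<omega>)) \<le> Q * N"
        using as(2)[OF _ aa] by (simp add: sol \<rho>_def)
      then have "cmod (yp l a + \<omega> * y l a) * exp (- \<rho> * a) \<ge> cmod (b + \<omega>) - Q * N"
        using norm_triangle_ineq2[of "b + \<omega>" "(yp l a + \<omega> * y l a) * exp (- \<omega> * of_real a)"]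
        unfolding nexp[symmetric] norm_mult[symmetric] by (simp add: norm_minus_commute)
      then have "cmod (yp l a + \<omega> * y l a) * exp (- \<rho> * a) \<ge> 13 / 16 * W" using u0 QN by linarith
      then have "13 / 16 * W * exp (\<rho> * a) \<le> cmod (yp l a + \<omega> * y l a) * exp (- \<rho> * a) * exp (\<rho> * a)"
        by (intro mult_right_mono) auto
      also have "\<dots> = cmod (yp l a + \<omega> * y l a)" unfolding mult.assoc exp_add[symmetric] by simp
      finally have U: "13 / 16 * W * exp (\<rho> * a) \<le> cmod (yp l a + \<omega> * y l a)" .
      have "cmod (yp l a - \<omega> * y l a) \<le> cmod (b - \<omega>) * exp (- \<rho> * a) + Q * N * exp (\<rho> * a)"
        using as(3)[OF _ aa] by (simp add: sol \<rho>_def)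
      also have "\<dots> \<le> (9 / 8 * W) * (exp (\<rho> * a) / 8) + W / 16 * exp (\<rho> * a)"
        using v0 e2 QN W by (intro add_mono mult_mono mult_right_mono) auto
      also have "\<dots> = 13 / 64 * W * exp (\<rho> * a)" by (simp add: algebra_simps)
      finally have V: "cmod (yp l a - \<omega> * y l a) \<le> 13 / 64 * W * exp (\<rho> * a)" .
      have "2 * W * cmod (y l a) = cmod (2 * \<omega> * y l a)" by (simp add: norm_mult W(3))
      also have "2 * \<omega> * y l a = (yp l a + \<omega> * y l a) - (yp l a - \<omega> * y l a)" by simp
      finally have "2 * W * cmod (y l a) \<ge> 13 / 16 * W * exp (\<rho> * a) - 13 / 64 * W * exp (\<rho> * a)"
        using U V norm_triangle_ineq2[of "yp l a + \<omega> * y l a" "yp l a - \<omega> * y l a"] by linarith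
      \<comment> \<open>The difference is \<open>39 / 64\<close>, while only \<open>1 / 4\<close> is
        required.\<close>
      moreover have "13 / 16 * W * exp (\<rho> * a) - 13 / 64 * W * exp (\<rho> * a) \<ge> 2 * W * (exp (\<rho> * a) / 8)"
        using mult_pos_pos[OF W(2) exp_gt_zero[of "\<rho> * a"]] by (simp add: algebra_simps)
      ultimately have "2 * W * (exp (\<rho> * a) / 8) \<le> 2 * W * cmod (y l a)" by linarith
      then show ?thesis using W(2) by simp
    qed
    show ?thesis using up low unfolding \<rho>_def by blast
  qed
  then show ?thesis using R(1) by (intro that[of R]) auto
qed

text \<open>\<open>\<Theta>, \<sigma>\<close> is the fundamental system at the right end, in the reflected variable \<open>a - x\<close>, with
  \<open>\<Theta>(0) = 1\<close>, \<open>\<Theta>'(0) = \<beta>\<close>, \<open>\<sigma>(0) = 0\<close>, \<open>\<sigma>'(0) = 1\<close>. Then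
  \<open>\<phi>(a - t) = \<phi>(a) \<Theta>(t) - (\<phi>'(a) + \<beta> \<phi>(a)) \<sigma>(t)\<close>, which identifies the entire function
  \<open>\<Theta> \<sigma>t - \<Theta>t \<sigma>\<close> with \<open>(\<phi> \<sigma>t - \<phi>t \<sigma>) / \<phi>(a)\<close>, of size \<open>O(1/\<lambda>)\<close> off the real axis.\<close>

lemma borg_uniqueness:
  fixes \<phi> \<phi>p \<phi>t \<phi>tp :: "complex \<Rightarrow> real \<Rightarrow> complex"
  assumes a: "a > 0" and q: "q absolutely_integrable_on {0..a}" and qt: "qt absolutely_integrable_on {0..a}"
    and \<phi>: "\<And>l. ode_sol a (\<lambda>t. q t - l\<^sup>2) (\<lambda>t. 0) (\<phi> l) (\<phi>p l)" "\<And>l. \<phi> l 0 = 1" "\<And>l. \<phi>p l 0 = b"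
    and \<phi>t: "\<And>l. ode_sol a (\<lambda>t. qt t - l\<^sup>2) (\<lambda>t. 0) (\<phi>t l) (\<phi>tp l)" "\<And>l. \<phi>t l 0 = 1" "\<And>l. \<phi>tp l 0 = bt"
    and eq1: "\<And>l. l \<noteq> 0 \<Longrightarrow> \<phi>t l a = \<phi> l a"
    and eq2: "\<And>l. l \<noteq> 0 \<Longrightarrow> \<phi>tp l a + \<beta>t * \<phi>t l a = \<phi>p l a + \<beta> * \<phi> l a"
  shows "bt = b" "\<beta>t = \<beta>" "AE x in lebesgue. x \<in> {0<..<a} \<longrightarrow> qt x = q x"
proof -
  define r where "r t = q (a - t)" for t
  define rt where "rt t = qt (a - t)" for t
  have r: "r absolutely_integrable_on {0..a}" and rt: "rt absolutely_integrable_on {0..a}"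
    unfolding r_def rt_def by (intro absolutely_integrable_reverse q qt)+
  have shift: "(\<lambda>t. p t - l\<^sup>2) absolutely_integrable_on {0..a}" if "p absolutely_integrable_on {0..a}" for p and l :: complex
    by (rule set_integral_diff(1)[OF that absolutely_integrable_continuous_real[OF continuous_on_const]])
  have a0: "a \<ge> 0" using a by simp
  have ex: "\<exists>y yp. \<forall>l. ode_sol a (\<lambda>t. p t - l\<^sup>2) (\<lambda>t. 0) (y l) (yp l) \<and> y l 0 = A \<and> yp l 0 = B"
    if "p absolutely_integrable_on {0..a}" for p and A B :: complex
  proof -
    have "\<forall>l. \<exists>y yp. ode_sol a (\<lambda>t. p t - l\<^sup>2) (\<lambda>t. 0) y yp \<and> y 0 = A \<and> yp 0 = B"
      using ode_sol_exists[OF shift[OF that] a0 continuous_on_const] by metis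
    then show ?thesis by metis
  qed
  obtain \<Theta> \<Theta>p where \<Theta>: "\<And>l. ode_sol a (\<lambda>t. r t - l\<^sup>2) (\<lambda>t. 0) (\<Theta> l) (\<Theta>p l)" "\<And>l. \<Theta> l 0 = 1" "\<And>l. \<Theta>p l 0 = \<beta>"
    using ex[OF r] by metis
  obtain \<sigma> \<sigma>p where \<sigma>: "\<And>l. ode_sol a (\<lambda>t. r t - l\<^sup>2) (\<lambda>t. 0) (\<sigma> l) (\<sigma>p l)" "\<And>l. \<sigma> l 0 = 0" "\<And>l. \<sigma>p l 0 = 1"
    using ex[OF r] by metis
  obtain \<Theta>t \<Theta>tp where \<Theta>t: "\<And>l. ode_sol a (\<lambda>t. rt t - l\<^sup>2) (\<lambda>t. 0) (\<Theta>t l) (\<Theta>tp l)" "\<And>l. \<Theta>t l 0 = 1" "\<And>l. \<Theta>tp l 0 = \<beta>t"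
    using ex[OF rt] by metis
  obtain \<sigma>t \<sigma>tp where \<sigma>t: "\<And>l. ode_sol a (\<lambda>t. rt t - l\<^sup>2) (\<lambda>t. 0) (\<sigma>t l) (\<sigma>tp l)" "\<And>l. \<sigma>t l 0 = 0" "\<And>l. \<sigma>tp l 0 = 1"
    using ex[OF rt] by metis
  \<comment> \<open>At \<open>t = 0\<close> both sides have value \<open>f l a\<close> and
    derivative \<open>- fp l a\<close>, and both solve the reflected equation.\<close>
  have expand: "f l (a - t) = f l a * T l t - (fp l a + \<gamma> * f l a) * S l t"
    if p: "p absolutely_integrable_on {0..a}" and f: "\<And>l. ode_sol a (\<lambda>t. p t - l\<^sup>2) (\<lambda>t. 0) (f l) (fp l)"
      and T: "\<And>l. ode_sol a (\<lambda>t. p (a - t) - l\<^sup>2) (\<lambda>t. 0) (T l) (Tp l)" "\<And>l. T l 0 = 1" "\<And>l. Tp l 0 = \<gamma>"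
      and S: "\<And>l. ode_sol a (\<lambda>t. p (a - t) - l\<^sup>2) (\<lambda>t. 0) (S l) (Sp l)" "\<And>l. S l 0 = 0" "\<And>l. Sp l 0 = 1"
      and t: "t \<in> {0..a}" for p and f fp T Tp S Sp :: "complex \<Rightarrow> real \<Rightarrow> complex" and \<gamma> l t
  proof -
    have pr: "(\<lambda>t. p (a - t) - l\<^sup>2) absolutely_integrable_on {0..a}"
      by (intro shift absolutely_integrable_reverse p)
    have "ode_sol a (\<lambda>t. p (a - t) - l\<^sup>2) (\<lambda>t. f l a * 0 + (- (fp l a + \<gamma> * f l a)) * 0)
      (\<lambda>t. f l a * T l t + (- (fp l a + \<gamma> * f l a)) * S l t) (\<lambda>t. f l a * Tp l t + (- (fp l a + \<gamma> * f l a)) * Sp l t)"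
      by (rule ode_sol_lincomb[OF pr _ _ T(1) S(1)]) auto
    then have c: "ode_sol a (\<lambda>t. p (a - t) - l\<^sup>2) (\<lambda>t. 0)
      (\<lambda>t. f l a * T l t + (- (fp l a + \<gamma> * f l a)) * S l t) (\<lambda>t. f l a * Tp l t + (- (fp l a + \<gamma> * f l a)) * Sp l t)"
      by simp
    have rv: "ode_sol a (\<lambda>t. p (a - t) - l\<^sup>2) (\<lambda>t. 0) (\<lambda>t. f l (a - t)) (\<lambda>t. - fp l (a - t))"
      by (rule ode_sol_reverse[OF shift[OF p] f])
    have "f l (a - t) = f l a * T l t + (- (fp l a + \<gamma> * f l a)) * S l t"
      by (rule ode_sol_unique(1)[OF pr rv c _ _ t]) (simp_all add: T S)
    then show ?thesis by (simp add: algebra_simps)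
  qed
  have \<phi>_exp: "\<phi> l (a - t) = \<phi> l a * \<Theta> l t - (\<phi>p l a + \<beta> * \<phi> l a) * \<sigma> l t" if "t \<in> {0..a}" for l t
    by (rule expand[OF q \<phi>(1) \<Theta>[unfolded r_def] \<sigma>[unfolded r_def] that])
  have \<phi>t_exp: "\<phi>t l (a - t) = \<phi>t l a * \<Theta>t l t - (\<phi>tp l a + \<beta>t * \<phi>t l a) * \<sigma>t l t" if "t \<in> {0..a}" for l t
    by (rule expand[OF qt \<phi>t(1) \<Theta>t[unfolded rt_def] \<sigma>t[unfolded rt_def] that])
  have hol: "(\<lambda>l. \<Theta> l t) holomorphic_on UNIV" "(\<lambda>l. \<sigma> l t) holomorphic_on UNIV"
       "(\<lambda>l. \<Theta>t l t) holomorphic_on UNIV" "(\<lambda>l. \<sigma>t l t) holomorphic_on UNIV"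
    and et: "exp_type (\<lambda>l. \<Theta> l t)" "exp_type (\<lambda>l. \<sigma> l t)" "exp_type (\<lambda>l. \<Theta>t l t)" "exp_type (\<lambda>l. \<sigma>t l t)"
    if "t \<in> {0..a}" for t
    using ode_sol_family_holomorphic(1)[OF r a0 \<Theta>(1) _ _ that] ode_sol_family_holomorphic(1)[OF r a0 \<sigma>(1) _ _ that]
      ode_sol_family_holomorphic(1)[OF rt a0 \<Theta>t(1) _ _ that] ode_sol_family_holomorphic(1)[OF rt a0 \<sigma>t(1) _ _ that]
      ode_sol_family_exp_type(1)[OF r a0 \<Theta>(1) _ _ _ _ that] ode_sol_family_exp_type(1)[OF r a0 \<sigma>(1) _ _ _ _ that]
      ode_sol_family_exp_type(1)[OF rt a0 \<Theta>t(1) _ _ _ _ that] ode_sol_family_exp_type(1)[OF rt a0 \<sigma>t(1) _ _ _ _ that]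
    by (simp_all add: \<Theta> \<sigma> \<Theta>t \<sigma>t exp_type_const)
  define H where "H t l = \<Theta> l t * \<sigma>t l t - \<Theta>t l t * \<sigma> l t" for t l
  have H0: "H t l = 0" if t: "t \<in> {0..a}" for t l
  proof -
    obtain R1 where R1: "R1 > 0" "\<And>l x. cmod l \<ge> R1 \<Longrightarrow> x \<in> {0..a} \<Longrightarrow> cmod (\<phi> l x) \<le> 3 * exp (\<bar>Im l\<bar> * x)"
      "\<And>l. cmod l \<ge> R1 \<Longrightarrow> \<bar>Re l\<bar> \<le> 2 * \<bar>Im l\<bar> \<Longrightarrow> cmod (\<phi> l a) \<ge> exp (\<bar>Im l\<bar> * a) / 8"
      by (rule robin_family_bounds[OF q a \<phi>]) blast
    obtain R2 where R2: "\<And>l x. cmod l \<ge> R2 \<Longrightarrow> x \<in> {0..a} \<Longrightarrow> cmod (\<phi>t l x) \<le> 3 * exp (\<bar>Im l\<bar> * x)"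
      by (rule robin_family_bounds[OF qt a \<phi>t]) blast
    obtain R3 where R3: "\<And>l x. cmod l \<ge> R3 \<Longrightarrow> x \<in> {0..a} \<Longrightarrow> cmod (\<sigma> l x) \<le> 2 / cmod l * exp (\<bar>Im l\<bar> * x)"
      by (rule dirichlet_family_upper_bound[OF r a \<sigma>]) blast
    obtain R4 where R4: "\<And>l x. cmod l \<ge> R4 \<Longrightarrow> x \<in> {0..a} \<Longrightarrow> cmod (\<sigma>t l x) \<le> 2 / cmod l * exp (\<bar>Im l\<bar> * x)"
      by (rule dirichlet_family_upper_bound[OF rt a \<sigma>t]) blast
    define R where "R = max (max R1 R2) (max R3 R4)"
    show ?thesis
    \<comment> \<open>96 is 8 times 12: each of two products is at most
      \<open>6 / cmod l * X\<close>, and the divisor \<open>\<phi> l a\<close> has modulus at least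
      \<open>X / 8\<close>.\<close>
    proof (rule exp_type_vanishing_off_sector[of "H t" R 96])
      show "H t holomorphic_on UNIV" unfolding H_def by (intro holomorphic_intros hol t)
      show "exp_type (H t)" unfolding H_def by (intro exp_type_diff exp_type_mult et t)
      fix l assume sec: "\<bar>Re l\<bar> \<le> 2 * \<bar>Im l\<bar>" and l: "R \<le> cmod l"
      have lR: "cmod l \<ge> R1" "cmod l \<ge> R2" "cmod l \<ge> R3" "cmod l \<ge> R4" using l by (auto simp: R_def)
      have l0: "cmod l > 0" "l \<noteq> 0" using lR(1) R1(1) by auto
      define \<rho> where "\<rho> = \<bar>Im l\<bar>"
      define X where "X = exp (\<rho> * a)"
      have at: "a - t \<in> {0..a}" using t by auto
      have b1: "cmod (\<phi> l (a - t)) \<le> 3 * exp (\<rho> * (a - t))" unfolding \<rho>_def by (rule R1(2)[OF lR(1) at])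
      have b2: "cmod (\<phi>t l (a - t)) \<le> 3 * exp (\<rho> * (a - t))" unfolding \<rho>_def by (rule R2[OF lR(2) at])
      have b3: "cmod (\<sigma> l t) \<le> 2 / cmod l * exp (\<rho> * t)" unfolding \<rho>_def by (rule R3[OF lR(3) t])
      have b4: "cmod (\<sigma>t l t) \<le> 2 / cmod l * exp (\<rho> * t)" unfolding \<rho>_def by (rule R4[OF lR(4) t])
      have b5: "cmod (\<phi> l a) \<ge> X / 8" unfolding X_def \<rho>_def by (rule R1(3)[OF lR(1) sec])
      have XX: "(3 * exp (\<rho> * (a - t))) * (2 / cmod l * exp (\<rho> * t)) = 6 / cmod l * X"
        unfolding X_def by (simp add: exp_add[symmetric] algebra_simps)
      \<comment> \<open>The terms in \<open>\<sigma> * \<sigma>t\<close> cancel because both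
        expansions have the same two coefficients, by \<open>eq1\<close> and
        \<open>eq2\<close>.\<close>
      have "\<phi> l a * H t l = \<phi> l (a - t) * \<sigma>t l t - \<phi>t l (a - t) * \<sigma> l t"
        unfolding \<phi>_exp[OF t] \<phi>t_exp[OF t] H_def eq1[OF l0(2)] eq2[OF l0(2), unfolded eq1[OF l0(2)]] by (simp add: algebra_simps)
      also have "cmod \<dots> \<le> 6 / cmod l * X + 6 / cmod l * X"
        unfolding XX[symmetric]
        by (rule order_trans[OF norm_triangle_ineq4], unfold norm_mult, intro add_mono mult_mono b1 b2 b3 b4) auto
      finally have "cmod (\<phi> l a) * cmod (H t l) \<le> 12 / cmod l * X" by (simp add: norm_mult)
      moreover have "X / 8 * cmod (H t l) \<le> cmod (\<phi> l a) * cmod (H t l)" by (intro mult_right_mono b5) auto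
      ultimately have "8 * (X / 8 * cmod (H t l)) \<le> 8 * (12 / cmod l * X)" by simp
      then have "X * cmod (H t l) \<le> X * (96 / cmod l)" by (simp add: mult.commute)
      then show "cmod (H t l) \<le> 96 / cmod l" by (rule mult_left_le_imp_le) (simp add: X_def)
    qed
  qed
  \<comment> \<open>As \<open>H\<close> vanishes for all \<open>t\<close>, so does its derivative in
    \<open>t\<close>. Together with the two Wronskians, both equal to 1, this eliminates
    \<open>\<Theta>\<close> and \<open>\<Theta>t\<close>.\<close>
  have sq: "\<sigma> l t * \<sigma> l t = \<sigma>t l t * \<sigma>t l t" if t: "t \<in> {0..a}" for l t
  proof -
    have d: "(\<Theta> l has_vector_derivative \<Theta>p l t) (at t within {0..a})" "(\<sigma> l has_vector_derivative \<sigma>p l t) (at t within {0..a})"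
      "(\<Theta>t l has_vector_derivative \<Theta>tp l t) (at t within {0..a})" "(\<sigma>t l has_vector_derivative \<sigma>tp l t) (at t within {0..a})"
      by (rule ode_sol_has_derivative[OF _ t], rule \<Theta>(1) \<sigma>(1) \<Theta>t(1) \<sigma>t(1))+
    have "((\<lambda>t. \<Theta> l t * \<sigma>t l t - \<Theta>t l t * \<sigma> l t) has_vector_derivative
      (\<Theta> l t * \<sigma>tp l t + \<Theta>p l t * \<sigma>t l t - (\<Theta>t l t * \<sigma>p l t + \<Theta>tp l t * \<sigma> l t))) (at t within {0..a})"
      by (intro has_vector_derivative_diff has_vector_derivative_mult d)
    then have "((\<lambda>t. 0) has_vector_derivative
      (\<Theta> l t * \<sigma>tp l t + \<Theta>p l t * \<sigma>t l t - (\<Theta>t l t * \<sigma>p l t + \<Theta>tp l t * \<sigma> l t))) (at t within {0..a})"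
      by (rule has_vector_derivative_transform[OF t, rotated]) (use H0 in \<open>simp add: H_def\<close>)
    then have H': "\<Theta> l t * \<sigma>tp l t + \<Theta>p l t * \<sigma>t l t - (\<Theta>t l t * \<sigma>p l t + \<Theta>tp l t * \<sigma> l t) = 0"
      using vector_derivative_unique_within_closed_interval[of 0 a t "\<lambda>t. 0 :: complex"] a t
      by (metis box_real(2) has_vector_derivative_const)
    have w: "\<Theta> l t * \<sigma>p l t - \<Theta>p l t * \<sigma> l t = 1"
      using ode_sol_wronskian[OF shift[OF r] \<Theta>(1) \<sigma>(1) t] by (simp add: \<Theta> \<sigma>)
    have wt: "\<Theta>t l t * \<sigma>tp l t - \<Theta>tp l t * \<sigma>t l t = 1"
      using ode_sol_wronskian[OF shift[OF rt] \<Theta>t(1) \<sigma>t(1) t] by (simp add: \<Theta>t \<sigma>t)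
    have h: "\<Theta> l t * \<sigma>t l t = \<Theta>t l t * \<sigma> l t" using H0[OF t, of l] by (simp add: H_def)
    have "\<sigma> l t * \<sigma> l t * (\<Theta>t l t * \<sigma>tp l t - \<Theta>tp l t * \<sigma>t l t) - \<sigma>t l t * \<sigma>t l t * (\<Theta> l t * \<sigma>p l t - \<Theta>p l t * \<sigma> l t) = 0"
      using h H' by algebra
    then show ?thesis unfolding w wt by simp
  qed
  \<comment> \<open>Scaling the solution by \<tau> turns the data 0 and 1 into the limits
    \<open>A = 0\<close> and \<open>B = 1\<close>.\<close>
  have ray: "((\<lambda>\<tau>::real. \<tau> * \<sigma>' (\<i> * \<tau>) t * exp (- of_real \<tau> * of_real t)) \<longlongrightarrow> 1 / 2) at_top"
    if p: "p absolutely_integrable_on {0..a}" 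
      and s: "\<And>l. ode_sol a (\<lambda>t. p t - l\<^sup>2) (\<lambda>t. 0) (\<sigma>' l) (\<sigma>'p l)" "\<And>l. \<sigma>' l 0 = 0" "\<And>l. \<sigma>'p l 0 = 1"
      and t: "0 < t" "t \<le> a" for p and \<sigma>' \<sigma>'p :: "complex \<Rightarrow> real \<Rightarrow> complex" and t
  proof -
    have "ode_sol a (\<lambda>t. p t + (of_real \<tau>)\<^sup>2) (\<lambda>t. 0) (\<lambda>t. of_real \<tau> * \<sigma>' (\<i> * \<tau>) t) (\<lambda>t. of_real \<tau> * \<sigma>'p (\<i> * \<tau>) t)" for \<tau> :: real
    proof -
      have "ode_sol a (\<lambda>t. p t - (\<i> * \<tau>)\<^sup>2) (\<lambda>t. of_real \<tau> * 0 + 0 * 0) (\<lambda>t. of_real \<tau> * \<sigma>' (\<i> * \<tau>) t + 0 * \<sigma>' (\<i> * \<tau>) t)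
         (\<lambda>t. of_real \<tau> * \<sigma>'p (\<i> * \<tau>) t + 0 * \<sigma>'p (\<i> * \<tau>) t)"
        by (rule ode_sol_lincomb[OF shift[OF p] _ _ s(1) s(1)]) auto
      then show ?thesis by (simp add: power_mult_distrib)
    qed
    note 1 = this
    have A: "((\<lambda>\<tau>::real. of_real \<tau> * \<sigma>' (\<i> * \<tau>) 0) \<longlongrightarrow> 0) at_top" by (simp add: s)
    have "\<forall>\<^sub>F \<tau> in at_top. 1 = of_real \<tau> * \<sigma>'p (\<i> * of_real \<tau>) 0 / complex_of_real \<tau>"
      using eventually_gt_at_top[of 0] by eventually_elim (simp add: s)
    then have B: "((\<lambda>\<tau>::real. of_real \<tau> * \<sigma>'p (\<i> * \<tau>) 0 / of_real \<tau>) \<longlongrightarrow> 1) at_top"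
      by (rule Lim_transform_eventually[OF tendsto_const])
    show ?thesis using ode_sol_ray_limits(1)[OF p 1 A B t] by simp
  qed
  have ev_nz: "\<forall>\<^sub>F \<tau>::real in at_top. \<sigma> (\<i> * of_real \<tau>) t \<noteq> 0" if t: "0 < t" "t \<le> a" for t
  proof -
    have "\<forall>\<^sub>F \<tau>::real in at_top. \<tau> * \<sigma> (\<i> * \<tau>) t * exp (- of_real \<tau> * of_real t) \<noteq> 0"
      by (rule tendsto_imp_eventually_ne[OF ray[OF r \<sigma> t]]) simp
    then show ?thesis by (rule eventually_mono) auto
  qed
  then have nz: "\<exists>l. \<sigma> l t \<noteq> 0" if t: "0 < t" "t \<le> a" for t
    using that eventually_happens'[OF trivial_limit_at_top_linorder] by blast
  have \<sigma>_eq: "\<sigma> l t = \<sigma>t l t" if t: "t \<in> {0..a}" for l t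
  proof (cases "t = 0")
    case False
    then have t': "0 < t" "t \<le> a" using t by auto
    \<comment> \<open>Equality of squares leaves a sign. The sum tends to 1, so
      \<open>\<sigma> + \<sigma>t\<close> is not identically zero in \<open>l\<close> and the entire
      factor \<open>\<sigma> - \<sigma>t\<close> must vanish.\<close>
    have "((\<lambda>\<tau>::real. \<tau> * \<sigma> (\<i> * \<tau>) t * exp (- of_real \<tau> * of_real t) + \<tau> * \<sigma>t (\<i> * \<tau>) t * exp (- of_real \<tau> * of_real t)) \<longlongrightarrow> 1 / 2 + 1 / 2) at_top"
      by (intro tendsto_add ray[OF r \<sigma> t'] ray[OF rt \<sigma>t t'])
    then have "\<forall>\<^sub>F \<tau>::real in at_top. \<tau> * \<sigma> (\<i> * \<tau>) t * exp (- of_real \<tau> * of_real t) + \<tau> * \<sigma>t (\<i> * \<tau>) t * exp (- of_real \<tau> * of_real t) \<noteq> 0"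
      by (rule tendsto_imp_eventually_ne) simp
    then obtain \<tau> :: real where "\<tau> * \<sigma> (\<i> * \<tau>) t * exp (- of_real \<tau> * of_real t) + \<tau> * \<sigma>t (\<i> * \<tau>) t * exp (- of_real \<tau> * of_real t) \<noteq> 0"
      using eventually_happens'[OF trivial_limit_at_top_linorder] by blast
    moreover have "\<tau> * \<sigma> (\<i> * \<tau>) t * exp (- of_real \<tau> * of_real t) + \<tau> * \<sigma>t (\<i> * \<tau>) t * exp (- of_real \<tau> * of_real t)
       = (\<sigma> (\<i> * \<tau>) t + \<sigma>t (\<i> * \<tau>) t) * (of_real \<tau> * exp (- of_real \<tau> * of_real t))" by (simp add: algebra_simps)
    ultimately have ne: "\<sigma> (\<i> * \<tau>) t + \<sigma>t (\<i> * \<tau>) t \<noteq> 0" by auto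
    have "\<sigma> l t - \<sigma>t l t = 0"
      by (rule entire_mult_eq_zero[where f = "\<lambda>l. \<sigma> l t - \<sigma>t l t" and g = "\<lambda>l. \<sigma> l t + \<sigma>t l t", OF _ _ _ ne])
        (use sq[OF t] in \<open>auto intro!: holomorphic_intros hol t simp: algebra_simps\<close>)
    then show ?thesis by simp
  qed (simp add: \<sigma> \<sigma>t)
  have \<Theta>_eq: "\<Theta> l t = \<Theta>t l t" if t: "t \<in> {0..a}" for l t
  proof (cases "t = 0")
    case False
    then have "0 < t" "t \<le> a" using t by auto
    then obtain l0 where ne: "\<sigma> l0 t \<noteq> 0" using nz by blast
    have "\<Theta> l t - \<Theta>t l t = 0"
      by (rule entire_mult_eq_zero[where f = "\<lambda>l. \<Theta> l t - \<Theta>t l t" and g = "\<lambda>l. \<sigma> l t", OF _ _ _ ne])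
        (use H0[OF t] in \<open>auto intro!: holomorphic_intros hol t simp: H_def \<sigma>_eq[OF t] algebra_simps\<close>)
    then show ?thesis by simp
  qed (simp add: \<Theta> \<Theta>t)
  have z0: "0 \<in> {0..a}" using a by simp
  show \<beta>: "\<beta>t = \<beta>"
    using ode_sol_derivative_eq[OF \<Theta>(1) \<Theta>t(1) a \<Theta>_eq z0, of 0] by (simp add: \<Theta> \<Theta>t)
  \<comment> \<open>Any fixed nonzero parameter would do; 0 is excluded by \<open>eq1\<close> and
    \<open>eq2\<close>.\<close>
  have "\<phi> 1 x = \<phi>t 1 x" if x: "x \<in> {0..a}" for x
  proof -
    have t: "a - x \<in> {0..a}" using x by auto
    show ?thesis
      using \<phi>_exp[OF t, of 1] \<phi>t_exp[OF t, of 1] eq1[of 1] eq2[of 1] \<Theta>_eq[OF t, of 1] \<sigma>_eq[OF t, of 1] by simp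
  qed
  from ode_sol_derivative_eq[OF \<phi>(1) \<phi>t(1) a this z0] show "bt = b" by (simp add: \<phi> \<phi>t)
  have AE1: "AE t in lebesgue. t \<in> {0..a} \<longrightarrow> (r t - rt t) * \<sigma> l t = 0" for l
  proof (rule AE_zero_of_indefinite_integral_zero[OF _ a0])
    have sc: "continuous_on {0..a} (\<sigma> l)" using ode_solD(1)[OF \<sigma>(1)] .
    show "(\<lambda>t. (r t - rt t) * \<sigma> l t) absolutely_integrable_on {0..a}"
      by (rule absolutely_integrable_mult_continuous[OF set_integral_diff(1)[OF r rt] sc])
    fix x assume x: "x \<in> {0..a}"
    have ii: "(\<lambda>t. (p t - l\<^sup>2) * \<sigma> l t) integrable_on {0..x}" if "p absolutely_integrable_on {0..a}" for p
      by (rule integrable_on_subinterval[OF absolutely_integrable_on_def[THEN iffD1, THEN conjunct1,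
            OF absolutely_integrable_mult_continuous[OF shift[OF that] sc]]]) (use x in auto)
    have sp: "\<sigma>p l x = \<sigma>tp l x"
      using ode_sol_derivative_eq[OF \<sigma>(1) \<sigma>t(1) a \<sigma>_eq x] .
    have "integral {0..x} (\<lambda>t. (rt t - l\<^sup>2) * \<sigma>t l t) = integral {0..x} (\<lambda>t. (rt t - l\<^sup>2) * \<sigma> l t)"
      using x by (intro integral_cong) (auto simp: \<sigma>_eq)
    then have "integral {0..x} (\<lambda>t. (r t - l\<^sup>2) * \<sigma> l t) = integral {0..x} (\<lambda>t. (rt t - l\<^sup>2) * \<sigma> l t)"
      using ode_solD0[OF \<sigma>(1)[of l] x] ode_solD0[OF \<sigma>t(1)[of l] x] sp by (simp add: \<sigma> \<sigma>t)
    then have "integral {0..x} (\<lambda>t. (r t - l\<^sup>2) * \<sigma> l t - (rt t - l\<^sup>2) * \<sigma> l t) = 0"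
      using integral_diff[OF ii[OF r] ii[OF rt]] by simp
    then show "integral {0..x} (\<lambda>t. (r t - rt t) * \<sigma> l t) = 0" by (simp add: algebra_simps)
  qed
  \<comment> \<open>The exceptional null set depends on \<open>l\<close>, and \<sigma> may have
    zeros in \<open>t\<close>. Countably many parameters \<open>\<i> * n\<close> keep the union
    null, and for each \<open>t\<close> all large \<open>n\<close> give a nonzero value.\<close>
  have "AE t in lebesgue. \<forall>n::nat. t \<in> {0..a} \<longrightarrow> (r t - rt t) * \<sigma> (\<i> * of_real (real n)) t = 0"
    unfolding AE_all_countable using AE1 by blast
  then have "AE t in lebesgue. t \<in> {0<..<a} \<longrightarrow> r t = rt t"
  proof (rule AE_mp, intro AE_I2 impI)
    fix t assume h: "\<forall>n::nat. t \<in> {0..a} \<longrightarrow> (r t - rt t) * \<sigma> (\<i> * of_real (real n)) t = 0" and t: "t \<in> {0<..<a}"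
    have "\<forall>\<^sub>F n::nat in sequentially. \<sigma> (\<i> * of_real (real n)) t \<noteq> 0"
      by (rule eventually_compose_filterlim[OF ev_nz filterlim_real_sequentially]) (use t in auto)
    then obtain n :: nat where "\<sigma> (\<i> * of_real (real n)) t \<noteq> 0"
      using eventually_happens'[OF sequentially_bot] by blast
    then show "r t = rt t" using h t by auto
  qed
  then obtain N where N: "N \<in> null_sets lebesgue" "{t \<in> space lebesgue. \<not> (t \<in> {0<..<a} \<longrightarrow> r t = rt t)} \<subseteq> N"
    unfolding eventually_ae_filter by blast
  \<comment> \<open>The identity was found in the reflected variable, so its exceptional set is
    reflected back.\<close>
  have "negligible ((\<lambda>t. a - t) ` N)"
    by (rule negligible_differentiable_image_negligible) (use N(1) in \<open>auto simp: negligible_iff_null_sets intro!: derivative_intros\<close>)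
  then have "(\<lambda>t. a - t) ` N \<in> null_sets lebesgue" by (simp add: negligible_iff_null_sets)
  then show "AE x in lebesgue. x \<in> {0<..<a} \<longrightarrow> qt x = q x"
  proof (rule AE_I')
    show "{x \<in> space lebesgue. \<not> (x \<in> {0<..<a} \<longrightarrow> qt x = q x)} \<subseteq> (\<lambda>t. a - t) ` N"
    proof
      fix x assume "x \<in> {x \<in> space lebesgue. \<not> (x \<in> {0<..<a} \<longrightarrow> qt x = q x)}"
      then have "a - x \<in> N" using N(2) by (auto simp: r_def rt_def)
      then show "x \<in> (\<lambda>t. a - t) ` N" by (rule rev_image_eqI) simp
    qed
  qed
qed

section \<open>Characteristic functions and comparison of constants\<close>

lemma solves_ivp_imp_ode_sol:
  assumes a: "a > 0" and q: "L2_on {0<..<a} q" and y: "solves_ivp a q \<alpha>\<^sub>0 \<beta>\<^sub>0 y"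
  shows "q absolutely_integrable_on {0..a}"
    and "ode_sol a (\<lambda>t. q t - l\<^sup>2) (\<lambda>t. 0) (y l) (dx a (y l))"
    and "y l 0 = 1" and "dx a (y l) 0 = \<i> * of_real \<alpha>\<^sub>0 * l + \<beta>\<^sub>0"
proof -
  show "q absolutely_integrable_on {0..a}" using L2_on_imp_absolutely_integrable[OF q] .
  from sl_solution_imp_ode_sol[OF this a] y
  show "ode_sol a (\<lambda>t. q t - l\<^sup>2) (\<lambda>t. 0) (y l) (dx a (y l))" "y l 0 = 1" "dx a (y l) 0 = \<i> * of_real \<alpha>\<^sub>0 * l + \<beta>\<^sub>0"
    unfolding solves_ivp_def by auto
qed

text \<open>The following lemmas on \<open>Delta_plus\<close> allow a real coefficient \<delta> of
  either sign, so they serve both characteristic functions.\<close>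

lemma Delta_minus_eq_Delta_plus: "Delta_minus a \<alpha> \<beta> y = Delta_plus a (- \<alpha>) \<beta> y"
  by (auto simp: Delta_minus_def Delta_plus_def)

lemma Delta_plus_entire:
  assumes a: "a > 0" and q: "L2_on {0<..<a} q" and y: "solves_ivp a q \<alpha>\<^sub>0 \<beta>\<^sub>0 y"
  shows "Delta_plus a \<delta> \<beta> y holomorphic_on UNIV" "exp_type (Delta_plus a \<delta> \<beta> y)"
proof -
  note s = solves_ivp_imp_ode_sol[OF a q y]
  have a0: "a \<ge> 0" "a \<in> {0..a}" using a by auto
  have A: "(\<lambda>l. y l 0) holomorphic_on UNIV" "exp_type (\<lambda>l. y l 0)"
    by (simp_all add: s exp_type_const)
  have B: "(\<lambda>l. dx a (y l) 0) holomorphic_on UNIV" "exp_type (\<lambda>l. dx a (y l) 0)"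
    unfolding s by (intro holomorphic_intros exp_type_intros)+
  note h = ode_sol_family_holomorphic[OF s(1) a0(1) s(2) A(1) B(1) a0(2)]
    and e = ode_sol_family_exp_type[OF s(1) a0(1) s(2) A B a0(2)]
  show "Delta_plus a \<delta> \<beta> y holomorphic_on UNIV"
    unfolding Delta_plus_def[abs_def] by (intro holomorphic_intros h)
  show "exp_type (Delta_plus a \<delta> \<beta> y)"
    unfolding Delta_plus_def[abs_def] by (intro exp_type_intros e)
qed

text \<open>\<open>s\<close> selects the half-axis. There
  \<open>\<i> * \<alpha>\<^sub>0 * \<lambda>\<close> equals
  \<open>- s * \<alpha>\<^sub>0 * \<tau>\<close>, so the ray limits apply with \<open>A = 1\<close>
  and \<open>B = - s * \<alpha>\<^sub>0\<close>; the boundary form at \<open>a\<close> contributes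
  \<open>1 - s * \<delta>\<close>.\<close>

lemma Delta_plus_ray_limit:
  assumes a: "a > 0" and q: "L2_on {0<..<a} q" and y: "solves_ivp a q \<alpha>\<^sub>0 \<beta>\<^sub>0 y" and s: "s\<^sup>2 = (1::real)"
  shows "((\<lambda>\<tau>::real. Delta_plus a \<delta> \<beta> y (\<i> * of_real s * of_real \<tau>) / of_real \<tau> * exp (- of_real \<tau> * of_real a))
    \<longlongrightarrow> of_real ((1 - s * \<alpha>\<^sub>0) * (1 - s * \<delta>) / 2)) at_top"
proof -
  note sol = solves_ivp_imp_ode_sol[OF a q y]
  define l where "l \<tau> = \<i> * of_real s * of_real \<tau>" for \<tau> :: real
  have cs: "(complex_of_real s)\<^sup>2 = 1" using s by (metis of_real_1 of_real_power)
  have il: "\<i> * of_real d * l \<tau> = - of_real (s * d) * of_real \<tau>" for d \<tau> by (simp add: l_def complex_eq_iff)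
  have 1: "ode_sol a (\<lambda>t. q t + (of_real \<tau>)\<^sup>2) (\<lambda>t. 0) (y (l \<tau>)) (dx a (y (l \<tau>)))" for \<tau>
    using sol(2)[of "l \<tau>"] by (simp add: l_def power_mult_distrib cs)
  have A: "((\<lambda>\<tau>. y (l \<tau>) 0) \<longlongrightarrow> 1) at_top" by (simp add: sol)
  have inv: "((\<lambda>\<tau>::real. c / of_real \<tau>) \<longlongrightarrow> 0) at_top" for c :: complex
    by (rule tendsto_divide_0[OF tendsto_const]) (rule filterlim_of_real_at_infinity)
  have lin: "((\<lambda>\<tau>::real. (\<i> * of_real d * l \<tau> + c) / of_real \<tau>) \<longlongrightarrow> - of_real (s * d)) at_top" for d c
  proof -
    have "((\<lambda>\<tau>::real. - of_real (s * d) + c / of_real \<tau>) \<longlongrightarrow> - of_real (s * d) + 0) at_top"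
      by (intro tendsto_intros inv)
    then have "((\<lambda>\<tau>::real. - of_real (s * d) + c / of_real \<tau>) \<longlongrightarrow> - of_real (s * d)) at_top" by simp
    moreover have "\<forall>\<^sub>F \<tau> in at_top. - of_real (s * d) + c / of_real \<tau> = (\<i> * of_real d * l \<tau> + c) / of_real \<tau>"
      using eventually_gt_at_top[of 0] by eventually_elim (simp only: il; simp add: field_simps)
    ultimately show ?thesis by (rule Lim_transform_eventually)
  qed
  have B: "((\<lambda>\<tau>. dx a (y (l \<tau>)) 0 / of_real \<tau>) \<longlongrightarrow> - of_real (s * \<alpha>\<^sub>0)) at_top"
    unfolding sol by (rule lin)
  note r = ode_sol_ray_limits[OF sol(1) 1 A B a order_refl]
  have lim: "((\<lambda>\<tau>. dx a (y (l \<tau>)) a / of_real \<tau> * exp (- of_real \<tau> * of_real a)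
        + (\<i> * of_real \<delta> * l \<tau> + \<beta>) / of_real \<tau> * (y (l \<tau>) a * exp (- of_real \<tau> * of_real a)))
     \<longlongrightarrow> (1 + - of_real (s * \<alpha>\<^sub>0)) / 2 + - of_real (s * \<delta>) * ((1 + - of_real (s * \<alpha>\<^sub>0)) / 2)) at_top"
    by (intro tendsto_add tendsto_mult r lin)
  have val: "(1 + - complex_of_real (s * \<alpha>\<^sub>0)) / 2 + - of_real (s * \<delta>) * ((1 + - of_real (s * \<alpha>\<^sub>0)) / 2)
      = of_real ((1 - s * \<alpha>\<^sub>0) * (1 - s * \<delta>) / 2)"
    by (simp add: field_simps)
  have eq: "dx a (y (l \<tau>)) a / of_real \<tau> * exp (- of_real \<tau> * of_real a)
        + (\<i> * of_real \<delta> * l \<tau> + \<beta>) / of_real \<tau> * (y (l \<tau>) a * exp (- of_real \<tau> * of_real a))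
      = Delta_plus a \<delta> \<beta> y (l \<tau>) / of_real \<tau> * exp (- of_real \<tau> * of_real a)" for \<tau>
    by (simp add: Delta_plus_def add_divide_distrib distrib_right mult.assoc)
  show ?thesis using lim unfolding val eq unfolding l_def .
qed

text \<open>Dividing two ray limits removes the common growth and leaves the quotient of leading
  coefficients. One half-axis must serve both problems, so \<open>s\<close> is shared.\<close>

lemma Delta_plus_proportional:
  assumes a: "a > 0" and q: "L2_on {0<..<a} q" and y: "solves_ivp a q \<alpha>\<^sub>0 \<beta>\<^sub>0 y"
    and qt: "L2_on {0<..<a} qt" and yt: "solves_ivp a qt \<alpha>\<^sub>0t \<beta>\<^sub>0t yt" and s: "s\<^sup>2 = (1::real)"
    and zeros: "same_zeros_on (- {0}) (Delta_plus a \<delta> \<beta> y) (Delta_plus a \<delta>t \<beta>t yt)"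
    and nz: "(1 - s * \<alpha>\<^sub>0) * (1 - s * \<delta>) \<noteq> 0" "(1 - s * \<alpha>\<^sub>0t) * (1 - s * \<delta>t) \<noteq> 0"
  shows "Delta_plus a \<delta> \<beta> y l =
    of_real ((1 - s * \<alpha>\<^sub>0) * (1 - s * \<delta>) / ((1 - s * \<alpha>\<^sub>0t) * (1 - s * \<delta>t))) * Delta_plus a \<delta>t \<beta>t yt l"
proof (rule same_zeros_proportional[OF Delta_plus_entire[OF a q y] Delta_plus_entire[OF a qt yt] zeros])
  show "\<i> * complex_of_real s \<noteq> 0" using s by auto
  show "complex_of_real ((1 - s * \<alpha>\<^sub>0) * (1 - s * \<delta>) / ((1 - s * \<alpha>\<^sub>0t) * (1 - s * \<delta>t))) \<noteq> 0"
    using nz by (simp del: of_real_mult of_real_diff)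
  let ?d = "\<lambda>\<tau>::real. Delta_plus a \<delta> \<beta> y (\<i> * of_real s * of_real \<tau>)"
  let ?dt = "\<lambda>\<tau>::real. Delta_plus a \<delta>t \<beta>t yt (\<i> * of_real s * of_real \<tau>)"
  let ?e = "\<lambda>\<tau>::real. exp (- of_real \<tau> * complex_of_real a)"
  have "((\<lambda>\<tau>. (?d \<tau> / of_real \<tau> * ?e \<tau>) / (?dt \<tau> / of_real \<tau> * ?e \<tau>)) \<longlongrightarrow>
      of_real ((1 - s * \<alpha>\<^sub>0) * (1 - s * \<delta>) / 2) / of_real ((1 - s * \<alpha>\<^sub>0t) * (1 - s * \<delta>t) / 2)) at_top"
    by (intro tendsto_divide Delta_plus_ray_limit[OF a q y s] Delta_plus_ray_limit[OF a qt yt s])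
      (use nz in \<open>simp del: of_real_mult of_real_diff\<close>)
  moreover have "complex_of_real ((1 - s * \<alpha>\<^sub>0) * (1 - s * \<delta>) / 2) / of_real ((1 - s * \<alpha>\<^sub>0t) * (1 - s * \<delta>t) / 2)
      = of_real ((1 - s * \<alpha>\<^sub>0) * (1 - s * \<delta>) / ((1 - s * \<alpha>\<^sub>0t) * (1 - s * \<delta>t)))"
    by (simp flip: of_real_divide)
  ultimately have lim: "((\<lambda>\<tau>. (?d \<tau> / of_real \<tau> * ?e \<tau>) / (?dt \<tau> / of_real \<tau> * ?e \<tau>)) \<longlongrightarrow>
      of_real ((1 - s * \<alpha>\<^sub>0) * (1 - s * \<delta>) / ((1 - s * \<alpha>\<^sub>0t) * (1 - s * \<delta>t)))) at_top" by simp
  have "\<forall>\<^sub>F \<tau> in at_top. (?d \<tau> / of_real \<tau> * ?e \<tau>) / (?dt \<tau> / of_real \<tau> * ?e \<tau>) = ?d \<tau> / ?dt \<tau>"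
    using eventually_gt_at_top[of 0] by eventually_elim simp
  from Lim_transform_eventually[OF lim this]
  show "((\<lambda>\<tau>. ?d \<tau> / ?dt \<tau>) \<longlongrightarrow>
      of_real ((1 - s * \<alpha>\<^sub>0) * (1 - s * \<delta>) / ((1 - s * \<alpha>\<^sub>0t) * (1 - s * \<delta>t)))) at_top" .
qed

text \<open>The even part in \<open>\<lambda>\<close> of \<open>y\<close> is the solution with \<open>\<phi>(0) = 1\<close>, \<open>\<phi>'(0) = \<beta>\<^sub>0\<close>, so the case
  \<open>\<alpha>\<^sub>0 = 0\<close> needs no separate treatment.\<close>

lemma solves_ivp_even_part:
  assumes a: "a > 0" and q: "L2_on {0<..<a} q" and y: "solves_ivp a q \<alpha>\<^sub>0 \<beta>\<^sub>0 y"
  shows "ode_sol a (\<lambda>t. q t - l\<^sup>2) (\<lambda>t. 0) (\<lambda>x. (y l x + y (- l) x) / 2) (\<lambda>x. (dx a (y l) x + dx a (y (- l)) x) / 2)"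
    and "(y l 0 + y (- l) 0) / 2 = 1" and "(dx a (y l) 0 + dx a (y (- l)) 0) / 2 = \<beta>\<^sub>0"
proof -
  note sol = solves_ivp_imp_ode_sol[OF a q y]
  have m: "ode_sol a (\<lambda>t. q t - l\<^sup>2) (\<lambda>t. 0) (y (- l)) (dx a (y (- l)))" using sol(2)[of "- l"] by simp
  have p: "(\<lambda>t. q t - l\<^sup>2) absolutely_integrable_on {0..a}"
    by (rule set_integral_diff(1)[OF sol(1) absolutely_integrable_continuous_real[OF continuous_on_const]])
  have "ode_sol a (\<lambda>t. q t - l\<^sup>2) (\<lambda>t. (1/2) * 0 + (1/2) * 0) (\<lambda>x. (1/2) * y l x + (1/2) * y (- l) x)
      (\<lambda>x. (1/2) * dx a (y l) x + (1/2) * dx a (y (- l)) x)"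
    by (rule ode_sol_lincomb[OF p _ _ sol(2) m]) auto
  then show "ode_sol a (\<lambda>t. q t - l\<^sup>2) (\<lambda>t. 0) (\<lambda>x. (y l x + y (- l) x) / 2) (\<lambda>x. (dx a (y l) x + dx a (y (- l)) x) / 2)"
    by (simp add: add_divide_distrib)
qed (simp_all add: solves_ivp_imp_ode_sol[OF a q y])

text \<open>Sum and difference of the two functions separate the data at \<open>a\<close>.
  \<open>L = 1\<close> is a premise of the second part because it follows only after the first is
  compared with the explicit value of \<open>L\<close>.\<close>

lemma proportional_Deltas:
  fixes L :: real
  assumes a: "a > 0" and q: "L2_on {0<..<a} q" and y: "solves_ivp a q \<alpha>\<^sub>0 \<beta>\<^sub>0 y"
    and qt: "L2_on {0<..<a} qt" and yt: "solves_ivp a qt \<alpha>\<^sub>0t \<beta>\<^sub>0t yt" and \<alpha>: "\<alpha> > 0"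
    and plus: "\<And>l. Delta_plus a \<alpha> \<beta> y l = of_real L * Delta_plus a \<alpha>t \<beta>t yt l"
    and minus: "\<And>l. Delta_minus a \<alpha> \<beta> y l = of_real L * Delta_minus a \<alpha>t \<beta>t yt l"
  shows "\<alpha> = L * \<alpha>t"
    and "L = 1 \<Longrightarrow> \<beta>\<^sub>0t = \<beta>\<^sub>0 \<and> \<beta>t = \<beta> \<and> (AE x in lebesgue. x \<in> {0<..<a} \<longrightarrow> qt x = q x)"
proof -
  have ya: "of_real \<alpha> * y l a = of_real (L * \<alpha>t) * yt l a"
    and va: "dx a (y l) a + \<beta> * y l a = of_real L * (dx a (yt l) a + \<beta>t * yt l a)" if l: "l \<noteq> 0" for l
  proof -
    have "Delta_plus a \<alpha> \<beta> y l - Delta_minus a \<alpha> \<beta> y l = of_real L * (Delta_plus a \<alpha>t \<beta>t yt l - Delta_minus a \<alpha>t \<beta>t yt l)"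
      by (simp add: plus minus algebra_simps)
    then have "2 * \<i> * l * (of_real \<alpha> * y l a) = 2 * \<i> * l * (of_real (L * \<alpha>t) * yt l a)"
      by (simp add: Delta_plus_def Delta_minus_def algebra_simps)
    then show "of_real \<alpha> * y l a = of_real (L * \<alpha>t) * yt l a" using l by simp
    have "Delta_plus a \<alpha> \<beta> y l + Delta_minus a \<alpha> \<beta> y l = of_real L * (Delta_plus a \<alpha>t \<beta>t yt l + Delta_minus a \<alpha>t \<beta>t yt l)"
      by (simp add: plus minus algebra_simps)
    then have "2 * (dx a (y l) a + \<beta> * y l a) = 2 * (of_real L * (dx a (yt l) a + \<beta>t * yt l a))"
      by (simp add: Delta_plus_def Delta_minus_def algebra_simps)
    then show "dx a (y l) a + \<beta> * y l a = of_real L * (dx a (yt l) a + \<beta>t * yt l a)"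
      by (rule mult_left_cancel[THEN iffD1, rotated]) simp
  qed
  define \<phi> where "\<phi> l x = (y l x + y (- l) x) / 2" for l x
  define \<phi>p where "\<phi>p l x = (dx a (y l) x + dx a (y (- l)) x) / 2" for l x
  define \<phi>t where "\<phi>t l x = (yt l x + yt (- l) x) / 2" for l x
  define \<phi>tp where "\<phi>tp l x = (dx a (yt l) x + dx a (yt (- l)) x) / 2" for l x
  have \<phi>: "ode_sol a (\<lambda>t. q t - l\<^sup>2) (\<lambda>t. 0) (\<phi> l) (\<phi>p l)" "\<phi> l 0 = 1" "\<phi>p l 0 = \<beta>\<^sub>0" for l
    unfolding \<phi>_def[abs_def] \<phi>p_def[abs_def] by (rule solves_ivp_even_part[OF a q y])+
  have \<phi>t: "ode_sol a (\<lambda>t. qt t - l\<^sup>2) (\<lambda>t. 0) (\<phi>t l) (\<phi>tp l)" "\<phi>t l 0 = 1" "\<phi>tp l 0 = \<beta>\<^sub>0t" for l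
    unfolding \<phi>t_def[abs_def] \<phi>tp_def[abs_def] by (rule solves_ivp_even_part[OF a qt yt])+
  have qi: "q absolutely_integrable_on {0..a}" "qt absolutely_integrable_on {0..a}"
    using L2_on_imp_absolutely_integrable q qt by auto
  have \<phi>a: "of_real \<alpha> * \<phi> l a = of_real (L * \<alpha>t) * \<phi>t l a"
    and \<phi>v: "\<phi>p l a + \<beta> * \<phi> l a = of_real L * (\<phi>tp l a + \<beta>t * \<phi>t l a)" if l: "l \<noteq> 0" for l
  proof -
    have "2 * (of_real \<alpha> * \<phi> l a) = of_real \<alpha> * y l a + of_real \<alpha> * y (- l) a" by (simp add: \<phi>_def algebra_simps)
    also have "\<dots> = 2 * (of_real (L * \<alpha>t) * \<phi>t l a)" using ya[of l] ya[of "- l"] l by (simp add: \<phi>t_def algebra_simps)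
    finally show "of_real \<alpha> * \<phi> l a = of_real (L * \<alpha>t) * \<phi>t l a" by simp
    have "2 * (\<phi>p l a + \<beta> * \<phi> l a) = (dx a (y l) a + \<beta> * y l a) + (dx a (y (- l)) a + \<beta> * y (- l) a)"
      by (simp add: \<phi>_def \<phi>p_def field_simps)
    also have "\<dots> = of_real L * (dx a (yt l) a + \<beta>t * yt l a) + of_real L * (dx a (yt (- l)) a + \<beta>t * yt (- l) a)"
      using va[of l] va[of "- l"] l by simp
    also have "\<dots> = 2 * (of_real L * (\<phi>tp l a + \<beta>t * \<phi>t l a))" by (simp add: \<phi>t_def \<phi>tp_def field_simps)
    finally show "\<phi>p l a + \<beta> * \<phi> l a = of_real L * (\<phi>tp l a + \<beta>t * \<phi>t l a)"
      by (rule mult_left_cancel[THEN iffD1, rotated]) simp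
  qed
  have ray: "((\<lambda>\<tau>::real. f (\<i> * \<tau>) a * exp (- of_real \<tau> * of_real a)) \<longlongrightarrow> 1 / 2) at_top"
    if p: "p absolutely_integrable_on {0..a}"
      and f: "\<And>l. ode_sol a (\<lambda>t. p t - l\<^sup>2) (\<lambda>t. 0) (f l) (fp l)" "\<And>l. f l 0 = 1" "\<And>l. fp l 0 = b" for p f fp b
  proof -
    have 1: "ode_sol a (\<lambda>t. p t + (of_real \<tau>)\<^sup>2) (\<lambda>t. 0) (f (\<i> * \<tau>)) (fp (\<i> * \<tau>))" for \<tau> :: real
      using f(1)[of "\<i> * \<tau>"] by (simp add: power_mult_distrib)
    have A: "((\<lambda>\<tau>::real. f (\<i> * \<tau>) 0) \<longlongrightarrow> 1) at_top" by (simp add: f)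
    have B: "((\<lambda>\<tau>::real. fp (\<i> * \<tau>) 0 / of_real \<tau>) \<longlongrightarrow> 0) at_top"
      unfolding f by (rule tendsto_divide_0[OF tendsto_const]) (rule filterlim_of_real_at_infinity)
    show ?thesis using ode_sol_ray_limits(1)[OF p 1 A B a order_refl] by simp
  qed
  have lim1: "((\<lambda>\<tau>::real. of_real \<alpha> * (\<phi> (\<i> * \<tau>) a * exp (- of_real \<tau> * of_real a))) \<longlongrightarrow> of_real \<alpha> * (1 / 2)) at_top"
    by (intro tendsto_mult tendsto_const ray[OF qi(1) \<phi>])
  have lim2: "((\<lambda>\<tau>::real. of_real (L * \<alpha>t) * (\<phi>t (\<i> * \<tau>) a * exp (- of_real \<tau> * of_real a))) \<longlongrightarrow> of_real (L * \<alpha>t) * (1 / 2)) at_top"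
    by (intro tendsto_mult tendsto_const ray[OF qi(2) \<phi>t])
  have ev: "\<forall>\<^sub>F \<tau>::real in at_top. of_real (L * \<alpha>t) * (\<phi>t (\<i> * \<tau>) a * exp (- of_real \<tau> * of_real a))
     = of_real \<alpha> * (\<phi> (\<i> * \<tau>) a * exp (- of_real \<tau> * of_real a))"
    using eventually_gt_at_top[of 0]
  proof eventually_elim
    case (elim \<tau>)
    then show ?case using \<phi>a[of "\<i> * \<tau>"] by (simp only: mult.assoc[symmetric]) simp
  qed
  \<comment> \<open>Both even parts have leading coefficient 1/2 at \<open>a\<close>, whatever the
    values of \<open>\<alpha>\<^sub>0\<close> and \<open>\<alpha>\<^sub>0t\<close>.\<close>
  have "complex_of_real \<alpha> * (1 / 2) = of_real (L * \<alpha>t) * (1 / 2)"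
    by (rule tendsto_unique[OF trivial_limit_at_top_linorder lim1 Lim_transform_eventually[OF lim2 ev]])
  then have "complex_of_real \<alpha> = of_real (L * \<alpha>t)" by (simp del: of_real_mult)
  then show \<alpha>L: "\<alpha> = L * \<alpha>t" by (simp only: of_real_eq_iff)
  assume L: "L = 1"
  have "\<phi>t l a = \<phi> l a" "\<phi>tp l a + \<beta>t * \<phi>t l a = \<phi>p l a + \<beta> * \<phi> l a" if "l \<noteq> 0" for l
    using \<phi>a[OF that] \<phi>v[OF that] \<alpha> L \<alpha>L by auto
  from borg_uniqueness[OF a qi \<phi> \<phi>t this]
  show "\<beta>\<^sub>0t = \<beta>\<^sub>0 \<and> \<beta>t = \<beta> \<and> (AE x in lebesgue. x \<in> {0<..<a} \<longrightarrow> qt x = q x)" by blast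
qed

theorem theorem4:
  fixes a \<alpha>\<^sub>0 \<alpha> \<alpha>\<^sub>0t \<alpha>t :: real
    and \<beta>\<^sub>0 \<beta> \<beta>\<^sub>0t \<beta>t :: complex
    and q qt :: "real \<Rightarrow> complex"
    and y yt :: "complex \<Rightarrow> real \<Rightarrow> complex"
  assumes "a > 0"
    and "L2_on {0<..<a} q" and "\<alpha>\<^sub>0 \<ge> 0" and "\<alpha> > 0"
    and "L2_on {0<..<a} qt" and "\<alpha>\<^sub>0t \<ge> 0" and "\<alpha>t > 0"
    and "solves_ivp a q \<alpha>\<^sub>0 \<beta>\<^sub>0 y"
    and "solves_ivp a qt \<alpha>\<^sub>0t \<beta>\<^sub>0t yt"
    and "same_zeros_on UNIV (Delta_plus a \<alpha> \<beta> y) (Delta_plus a \<alpha>t \<beta>t yt)"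
    and "same_zeros_on (- {0}) (Delta_minus a \<alpha> \<beta> y) (Delta_minus a \<alpha>t \<beta>t yt)"
  shows "(\<alpha>\<^sub>0 \<noteq> 1 \<and> \<alpha>\<^sub>0t = \<alpha>\<^sub>0 \<longrightarrow>
            \<alpha>t = \<alpha> \<and> \<beta>\<^sub>0t = \<beta>\<^sub>0 \<and> \<beta>t = \<beta> \<and>
            (AE x in lebesgue. x \<in> {0<..<a} \<longrightarrow> qt x = q x)) \<and>
         (\<alpha> \<noteq> 1 \<and> \<alpha>t = \<alpha> \<longrightarrow>
            \<alpha>\<^sub>0t = \<alpha>\<^sub>0 \<and> \<beta>\<^sub>0t = \<beta>\<^sub>0 \<and> \<beta>t = \<beta> \<and>
            (AE x in lebesgue. x \<in> {0<..<a} \<longrightarrow> qt x = q x))"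
proof -
  note ivp = assms(1,2,8,5,9)
  have zp: "same_zeros_on (- {0}) (Delta_plus a \<alpha> \<beta> y) (Delta_plus a \<alpha>t \<beta>t yt)"
    using assms(10) by (auto simp: same_zeros_on_def)
  have zm: "same_zeros_on (- {0}) (Delta_plus a (- \<alpha>) \<beta> y) (Delta_plus a (- \<alpha>t) \<beta>t yt)"
    using assms(11) unfolding Delta_minus_eq_Delta_plus .
  \<comment> \<open>The value on the half-axis \<open>s = -1\<close>, where all factors are
    positive.\<close>
  define Lp where "Lp = (1 + \<alpha>\<^sub>0) * (1 + \<alpha>) / ((1 + \<alpha>\<^sub>0t) * (1 + \<alpha>t))"
  have plus: "Delta_plus a \<alpha> \<beta> y l = of_real Lp * Delta_plus a \<alpha>t \<beta>t yt l" for l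
    using Delta_plus_proportional[OF ivp _ zp, of "-1" l] assms(3,4,6,7) by (simp add: Lp_def)
  show ?thesis
  proof (intro conjI impI; elim conjE)
    assume 1: "\<alpha>\<^sub>0 \<noteq> 1" "\<alpha>\<^sub>0t = \<alpha>\<^sub>0"
    \<comment> \<open>Here \<open>s = 1\<close>: the leading coefficient of
      \<open>Delta_minus\<close> is \<open>(1 - \<alpha>\<^sub>0) * (1 + \<alpha>)\<close>, and the
      shared factor \<open>1 - \<alpha>\<^sub>0\<close> cancels.\<close>
    define L where "L = (1 + \<alpha>) / (1 + \<alpha>t)"
    have "Lp = L" using 1 assms(3) by (simp add: Lp_def L_def)
    moreover have "Delta_minus a \<alpha> \<beta> y l = of_real L * Delta_minus a \<alpha>t \<beta>t yt l" for l
      using Delta_plus_proportional[OF ivp _ zm, of 1 l] assms(4,7) 1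
      by (simp add: L_def Delta_minus_eq_Delta_plus)
    ultimately have pd: "\<alpha> = L * \<alpha>t"
      "L = 1 \<Longrightarrow> \<beta>\<^sub>0t = \<beta>\<^sub>0 \<and> \<beta>t = \<beta> \<and> (AE x in lebesgue. x \<in> {0<..<a} \<longrightarrow> qt x = q x)"
      using proportional_Deltas[OF ivp assms(4)] plus by blast+
    have "\<alpha> * (1 + \<alpha>t) = (1 + \<alpha>) * \<alpha>t" using pd(1) assms(7) by (simp add: L_def field_simps)
    then have \<alpha>: "\<alpha>t = \<alpha>" by (simp add: algebra_simps)
    moreover have "L = 1" using \<alpha> assms(4) by (simp add: L_def)
    ultimately show "\<alpha>t = \<alpha>" "\<beta>\<^sub>0t = \<beta>\<^sub>0" "\<beta>t = \<beta>" "AE x in lebesgue. x \<in> {0<..<a} \<longrightarrow> qt x = q x"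
      using pd(2) by blast+
  next
    assume 2: "\<alpha> \<noteq> 1" "\<alpha>t = \<alpha>"
    \<comment> \<open>Here \<open>s = -1\<close>: the coefficient is
      \<open>(1 + \<alpha>\<^sub>0) * (1 - \<alpha>)\<close>, and the shared factor
      \<open>1 - \<alpha>\<close> cancels.\<close>
    define L where "L = (1 + \<alpha>\<^sub>0) / (1 + \<alpha>\<^sub>0t)"
    have "Lp = L" using 2 assms(4) by (simp add: Lp_def L_def)
    moreover have "Delta_minus a \<alpha> \<beta> y l = of_real L * Delta_minus a \<alpha>t \<beta>t yt l" for l
      using Delta_plus_proportional[OF ivp _ zm, of "-1" l] assms(3,6) 2
      by (simp add: L_def Delta_minus_eq_Delta_plus)
    ultimately have pd: "\<alpha> = L * \<alpha>t"
      "L = 1 \<Longrightarrow> \<beta>\<^sub>0t = \<beta>\<^sub>0 \<and> \<beta>t = \<beta> \<and> (AE x in lebesgue. x \<in> {0<..<a} \<longrightarrow> qt x = q x)"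
      using proportional_Deltas[OF ivp assms(4)] plus by blast+
    \<comment> \<open>With \<alpha> shared and positive, \<open>\<alpha> = L * \<alpha>\<close>
      gives \<open>L = 1\<close> before \<open>\<alpha>\<^sub>0\<close> is known.\<close>
    have L: "L = 1" using pd(1) 2 assms(4) by simp
    then have "\<alpha>\<^sub>0t = \<alpha>\<^sub>0" using assms(6) by (simp add: L_def field_simps)
    then show "\<alpha>\<^sub>0t = \<alpha>\<^sub>0" "\<beta>\<^sub>0t = \<beta>\<^sub>0" "\<beta>t = \<beta>" "AE x in lebesgue. x \<in> {0<..<a} \<longrightarrow> qt x = q x"
      using pd(2)[OF L] by blast+
  qed
qed

end
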